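(* Let $N$ be a compact orientable $n$-dimensional manifold with the number of generators of $\pi_1(N)$ equal to $k$, and let $T^{n+1}$ be the $(n+1)$-dimensional flat torus. (a) If $k<n$, then $N$ cannot be minimally embedded in $T^{n+1}$. (b) If $k=n$ and $N$ is minimally embedded in $T^{n+1}$, then $N$ is a flat $T^n$. (c) If $k>n$ and $N$ is minimally embedded in $T^{n+1}$, then $N$ is separating and, writing $T^{n+1}\setminus N=D_1\cup D_2$ with $D_1,D_2$ the two components, the number of generators of $\pi_1(D_j)$ must be bigger than $n$ for $j=1,2$.
   Context: $N$ is connected and without boundary. "The number of generators" of a group means the minimal number of elements needed to generate it. $N$ is minimally embedded in $T^{n+1}$ if it is embedded as a hypersurface with identically zero mean curvature. In (b), "flat $T^n$" means that $N$ with the induced metric is a flat $n$-dimensional torus. A compact connected embedded hypersurface $N$ of a compact manifold $M$ is *separating* if $M\setminus N$ has two nonempty connected components. *)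

theory Defs
  imports "HOL-Analysis.Analysis" "HOL-Algebra.Generated_Groups"
    "HOL-Library.Extended_Nat"
begin

section \<open>The fundamental group and the number of generators\<close>

definition loops :: "'a topology \<Rightarrow> 'a \<Rightarrow> (real \<Rightarrow> 'a) set" where
  "loops X x = {p. pathin X p \<and> p 0 = x \<and> p 1 = x}"

definition loop_homotopy :: "'a topology \<Rightarrow> 'a \<Rightarrow> ((real \<Rightarrow> 'a) \<times> (real \<Rightarrow> 'a)) set" where
  "loop_homotopy X x =
     {(p, q). homotopic_with (\<lambda>r. r 0 = x \<and> r 1 = x) (top_of_set {0..1}) X p q}"

text \<open>The library's \<open>+++\<close> needs a topological type class on the target; this is the same
  operation without it.\<close>

definition loop_join :: "(real \<Rightarrow> 'a) \<Rightarrow> (real \<Rightarrow> 'a) \<Rightarrow> real \<Rightarrow> 'a" where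
  "loop_join p q = (\<lambda>t. if t \<le> 1/2 then p (2 * t) else q (2 * t - 1))"

definition fundamental_group :: "'a topology \<Rightarrow> 'a \<Rightarrow> (real \<Rightarrow> 'a) set monoid" where
  "fundamental_group X x =
     \<lparr>carrier = loops X x // loop_homotopy X x,
      mult = (\<lambda>P Q. \<Union>p\<in>P. \<Union>q\<in>Q. loop_homotopy X x `` {loop_join p q}),
      one = loop_homotopy X x `` {\<lambda>t. x}\<rparr>"

text \<open>Equal to \<open>\<infinity>\<close> if the group is not finitely generated.\<close>

definition number_of_generators :: "('a, 'b) monoid_scheme \<Rightarrow> enat" where
  "number_of_generators G =
     (INF S\<in>{S. S \<subseteq> carrier G \<and> finite S \<and> generate G S = carrier G}. enat (card S))"


section \<open>Smooth manifolds and smooth maps\<close>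

text \<open>\<open>C_on k S f\<close> is meant for open \<open>S\<close> and finite-dimensional domains, where being \<open>C\<^sup>k\<close>
  can be tested on iterated directional derivatives.\<close>

primrec C_on :: "nat \<Rightarrow> 'a::euclidean_space set \<Rightarrow> ('a \<Rightarrow> 'b::euclidean_space) \<Rightarrow> bool" where
  "C_on 0 S f \<longleftrightarrow> continuous_on S f"
| "C_on (Suc k) S f \<longleftrightarrow>
     (\<forall>x\<in>S. f differentiable (at x)) \<and>
     (\<forall>v. C_on k S (\<lambda>x. frechet_derivative f (at x) v))"

definition smooth_on :: "'a::euclidean_space set \<Rightarrow> ('a \<Rightarrow> 'b::euclidean_space) \<Rightarrow> bool" where
  "smooth_on S f \<longleftrightarrow> (\<forall>k. C_on k S f)"

text \<open>A chart is a pair of its domain and the coordinate map.\<close>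

type_synonym ('b, 'e) chart = "'b set \<times> ('b \<Rightarrow> 'e)"

definition is_chart :: "'b topology \<Rightarrow> ('b, 'e::euclidean_space) chart \<Rightarrow> bool" where
  "is_chart X c \<longleftrightarrow>
     openin X (fst c) \<and> open (snd c ` fst c) \<and>
     homeomorphic_map (subtopology X (fst c)) (top_of_set (snd c ` fst c)) (snd c)"

text \<open>The coordinate expression of a map \<open>f\<close> with respect to a chart \<open>c\<close> of the source and a
  chart \<open>d\<close> of the target, and the set of coordinates on which it is meaningful. For
  \<open>f = id\<close> this is the transition map from \<open>c\<close> to \<open>d\<close>.\<close>

definition local_rep ::
  "('b, 'e::euclidean_space) chart \<Rightarrow> ('c, 'f::euclidean_space) chart \<Rightarrow> ('b \<Rightarrow> 'c) \<Rightarrow> 'e \<Rightarrow> 'f" where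
  "local_rep c d f = snd d \<circ> f \<circ> inv_into (fst c) (snd c)"

definition local_dom ::
  "('b, 'e::euclidean_space) chart \<Rightarrow> ('c, 'f::euclidean_space) chart \<Rightarrow> ('b \<Rightarrow> 'c) \<Rightarrow> 'e set" where
  "local_dom c d f = snd c ` (fst c \<inter> f -` fst d)"

definition smooth_atlas :: "'b topology \<Rightarrow> ('b, 'e::euclidean_space) chart set \<Rightarrow> bool" where
  "smooth_atlas X A \<longleftrightarrow>
     (\<forall>c\<in>A. is_chart X c) \<and> (\<Union>c\<in>A. fst c) = topspace X \<and>
     (\<forall>c\<in>A. \<forall>d\<in>A. smooth_on (local_dom c d id) (local_rep c d id))"

definition smooth_manifold :: "'b topology \<Rightarrow> ('b, 'e::euclidean_space) chart set \<Rightarrow> bool" where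
  "smooth_manifold X A \<longleftrightarrow> Hausdorff_space X \<and> second_countable X \<and> smooth_atlas X A"

text \<open>The smooth structure given by \<open>A\<close> contains an atlas \<open>B\<close> whose transition maps all
  preserve orientation.\<close>

definition orientable :: "'b topology \<Rightarrow> ('b, real^'n) chart set \<Rightarrow> bool" where
  "orientable X A \<longleftrightarrow>
     (\<exists>B. smooth_atlas X B \<and> smooth_atlas X (A \<union> B) \<and>
        (\<forall>c\<in>B. \<forall>d\<in>B. \<forall>y\<in>local_dom c d id. det (jacobian (local_rep c d id) (at y)) > 0))"

definition smooth_map ::
  "'b topology \<Rightarrow> ('b, 'e::euclidean_space) chart set \<Rightarrow>
   'c topology \<Rightarrow> ('c, 'f::euclidean_space) chart set \<Rightarrow> ('b \<Rightarrow> 'c) \<Rightarrow> bool" where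
  "smooth_map X A Y B f \<longleftrightarrow>
     continuous_map X Y f \<and>
     (\<forall>c\<in>A. \<forall>d\<in>B. smooth_on (local_dom c d f) (local_rep c d f))"

definition diffeomorphism ::
  "'b topology \<Rightarrow> ('b, 'e::euclidean_space) chart set \<Rightarrow>
   'c topology \<Rightarrow> ('c, 'f::euclidean_space) chart set \<Rightarrow> ('b \<Rightarrow> 'c) \<Rightarrow> bool" where
  "diffeomorphism X A Y B f \<longleftrightarrow>
     homeomorphic_map X Y f \<and> smooth_map X A Y B f \<and>
     smooth_map Y B X A (inv_into (topspace X) f)"

definition smooth_embedding ::
  "'b topology \<Rightarrow> ('b, 'e::euclidean_space) chart set \<Rightarrow>
   'c topology \<Rightarrow> ('c, 'f::euclidean_space) chart set \<Rightarrow> ('b \<Rightarrow> 'c) \<Rightarrow> bool" where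
  "smooth_embedding X A Y B f \<longleftrightarrow>
     embedding_map X Y f \<and> smooth_map X A Y B f \<and>
     (\<forall>c\<in>A. \<forall>d\<in>B. \<forall>y\<in>local_dom c d f. inj (frechet_derivative (local_rep c d f) (at y)))"


section \<open>Flat tori\<close>

definition full_lattice :: "'a::euclidean_space set \<Rightarrow> bool" where
  "full_lattice L \<longleftrightarrow>
     (\<exists>B. independent B \<and> span B = UNIV \<and>
        L = {v. \<exists>m::'a \<Rightarrow> int. v = (\<Sum>b\<in>B. of_int (m b) *\<^sub>R b)})"

definition torus_proj :: "'a::euclidean_space set \<Rightarrow> 'a \<Rightarrow> 'a set" where
  "torus_proj L x = (\<lambda>l. x + l) ` L"

text \<open>The quotient of Euclidean space by \<open>L\<close>, with the quotient topology.\<close>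

definition torus :: "'a::euclidean_space set \<Rightarrow> 'a set topology" where
  "torus L = topology (\<lambda>U. U \<subseteq> range (torus_proj L) \<and> open (torus_proj L -` U))"

lemma openin_torus:
  "openin (torus L) U \<longleftrightarrow> U \<subseteq> range (torus_proj L) \<and> open (torus_proj L -` U)"
proof -
  have "istopology (\<lambda>U. U \<subseteq> range (torus_proj L) \<and> open (torus_proj L -` U))"
    unfolding istopology_def by (auto simp: vimage_Union)
  then show ?thesis
    by (simp add: torus_def topology_inverse')
qed

lemma topspace_torus: "topspace (torus L) = range (torus_proj L)"
  by (metis (no_types, lifting) openin_torus openin_subset openin_topspace open_UNIV
      subset_antisym subset_refl vimage_eq UNIV_eq_I rangeI)

text \<open>The charts are the local inverses of the projection. They are isometries onto open subsets of
  Euclidean space for the flat metric on the torus, so metric quantities in the torus may be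
  computed in these charts with the Euclidean inner product.\<close>

definition torus_atlas :: "'a::euclidean_space set \<Rightarrow> ('a set, 'a) chart set" where
  "torus_atlas L =
     {(torus_proj L ` V, inv_into V (torus_proj L)) | V. open V \<and> inj_on (torus_proj L) V}"


section \<open>Minimal hypersurfaces in flat tori\<close>

definition first_fundamental_form ::
  "('e::euclidean_space \<Rightarrow> 'f::euclidean_space) \<Rightarrow> 'e \<Rightarrow> 'e \<Rightarrow> 'e \<Rightarrow> real" where
  "first_fundamental_form F y u v =
     frechet_derivative F (at y) u \<bullet> frechet_derivative F (at y) v"

definition second_fundamental_form ::
  "('e::euclidean_space \<Rightarrow> 'f::euclidean_space) \<Rightarrow> 'f \<Rightarrow> 'e \<Rightarrow> 'e \<Rightarrow> 'e \<Rightarrow> real" where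
  "second_fundamental_form F \<nu> y u v =
     frechet_derivative (\<lambda>z. frechet_derivative F (at z) v) (at y) u \<bullet> \<nu>"

definition unit_normal ::
  "('e::euclidean_space \<Rightarrow> 'f::euclidean_space) \<Rightarrow> 'e \<Rightarrow> 'f \<Rightarrow> bool" where
  "unit_normal F y \<nu> \<longleftrightarrow> norm \<nu> = 1 \<and> (\<forall>u. frechet_derivative F (at y) u \<bullet> \<nu> = 0)"

text \<open>The trace of the second fundamental form with respect to the first one.\<close>

definition mean_curvature ::
  "(real^'n \<Rightarrow> 'f::euclidean_space) \<Rightarrow> 'f \<Rightarrow> real^'n \<Rightarrow> real" where
  "mean_curvature F \<nu> y =
     trace (matrix_inv (\<chi> i j. first_fundamental_form F y (axis i 1) (axis j 1)) **
            (\<chi> i j. second_fundamental_form F \<nu> y (axis i 1) (axis j 1)))"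

definition minimal_embedding ::
  "'b topology \<Rightarrow> ('b, real^'n) chart set \<Rightarrow> (real^'m) set \<Rightarrow> ('b \<Rightarrow> (real^'m) set) \<Rightarrow> bool" where
  "minimal_embedding X A L f \<longleftrightarrow>
     CARD('m) = CARD('n) + 1 \<and>
     smooth_embedding X A (torus L) (torus_atlas L) f \<and>
     (\<forall>c\<in>A. \<forall>d\<in>torus_atlas L. \<forall>y\<in>local_dom c d f. \<forall>\<nu>.
        unit_normal (local_rep c d f) y \<nu> \<longrightarrow> mean_curvature (local_rep c d f) \<nu> y = 0)"

text \<open>The manifold \<open>(X, A)\<close>, with the metric induced by \<open>f\<close> from the flat metric of
  \<open>torus L\<close>, is isometric to a flat torus of its own dimension.\<close>

definition induced_flat_torus ::
  "'b topology \<Rightarrow> ('b, real^'n) chart set \<Rightarrow> (real^'m) set \<Rightarrow> ('b \<Rightarrow> (real^'m) set) \<Rightarrow> bool" where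
  "induced_flat_torus X A L f \<longleftrightarrow>
     (\<exists>(L' :: (real^'n) set) h. full_lattice L' \<and>
        diffeomorphism X A (torus L') (torus_atlas L') h \<and>
        (\<forall>c\<in>A. \<forall>d\<in>torus_atlas L. \<forall>e\<in>torus_atlas L'.
           \<forall>y\<in>local_dom c d f \<inter> local_dom c e h. \<forall>u v.
             first_fundamental_form (local_rep c d f) y u v =
             first_fundamental_form (local_rep c e h) y u v))"

definition separating :: "'a topology \<Rightarrow> 'a set \<Rightarrow> bool" where
  "separating M N \<longleftrightarrow>
     card (connected_components_of (subtopology M (topspace M - N))) = 2"

end

theory Submission
  imports Defs
begin

text \<open>Let \<open>P\<close> be the group of periods of the embedding, the displacements of lifts to Euclidean space
  of loops in the hypersurface. The dimension of its span is at most the number of generators of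
  \<open>\<pi>\<^sub>1\<close>. If a vector \<open>w\<close> is orthogonal to \<open>P\<close>, the coordinate \<open>\<langle>\<cdot>, w\<rangle>\<close> of the lifts is a
  well-defined function on the hypersurface; minimality makes it harmonic, so by compactness and
  the maximum principle it is constant. Two independent such functions contradict the
  dimension of the hypersurface, so the span of \<open>P\<close> has codimension at most one. If the codimension
  is one, the hypersurface lies in a hyperplane and is the quotient of that hyperplane by a lattice;
  its \<open>\<pi>\<^sub>1\<close> then has exactly \<open>n\<close> generators. If \<open>P\<close> spans, the intersection number with the hypersurface
  vanishes on \<open>P\<close> and hence on all loops of the torus, so the two sides of a tubular neighbourhood lie in
  different components. Every component contains one of the sides, and pushing loops into that side
  realises all of \<open>P\<close> there, so its \<open>\<pi>\<^sub>1\<close> needs at least \<open>n + 1\<close> generators.\<close>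

section \<open>Calculus of \<open>C\<^sup>k\<close> functions\<close>

text \<open>Only the real span of the periods is measured: its dimension lies between
  \<open>CARD('n)\<close> and k, and the three cases are the possible positions of this number.
  Working with real dimensions instead of ranks loses nothing, because a real-valued additive map on
  the lattice that vanishes on a real spanning set vanishes on the whole lattice. Lifting to
  Euclidean space rests on complex logarithms of the characters of the torus over contractible
  domains. The elliptic part never forms the Laplace operator of the induced metric: minimality is
  tested on frames orthonormal for that metric, and Hopf's barrier is differentiated twice along
  each frame vector. In codimension one the obstacle is global: a local displacement inside the
  hyperplane must be turned into a covering of all of the hypersurface, which invariance of domain
  and two open-closed arguments achieve. When the periods span, orientability enters by making local
  normals agree, and the intersection number is realised as the winding of a circle-valued function,
  so that its vanishing becomes the existence of a real logarithm.\<close>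

lemma frechet_derivative_cong_open:
  assumes "open S" "x \<in> S" "\<And>y. y \<in> S \<Longrightarrow> f y = g y"
  shows "frechet_derivative f (at x) = frechet_derivative g (at x)"
proof -
  have "(f has_derivative d) (at x) \<longleftrightarrow> (g has_derivative d) (at x)" for d
    using has_derivative_transform_within_open[OF _ assms(1,2), of f d UNIV g]
      has_derivative_transform_within_open[OF _ assms(1,2), of g d UNIV f] assms(3) by auto
  then show ?thesis
    unfolding frechet_derivative_def by simp
qed

lemma differentiable_cong_open:
  assumes "open S" "x \<in> S" "\<And>y. y \<in> S \<Longrightarrow> f y = g y" "f differentiable (at x)"
  shows "g differentiable (at x)"
  using assms(4) has_derivative_transform_within_open[OF _ assms(1,2), of f _ UNIV g] assms(3)
  unfolding differentiable_def by auto

lemma C_on_cong: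
  assumes "open S" "\<And>y. y \<in> S \<Longrightarrow> f y = g y" "C_on k S f"
  shows "C_on k S g"
  using assms(2,3)
proof (induction k arbitrary: f g)
  case 0
  then show ?case using continuous_on_cong[of S S f g] by simp
next
  case (Suc k)
  have "C_on k S (\<lambda>x. frechet_derivative g (at x) v)" for v
  proof (rule Suc.IH)
    show "C_on k S (\<lambda>x. frechet_derivative f (at x) v)" using Suc.prems by simp
    show "frechet_derivative f (at y) v = frechet_derivative g (at y) v" if "y \<in> S" for y
      using frechet_derivative_cong_open[OF assms(1) that, of f g] Suc.prems by simp
  qed
  moreover have "g differentiable (at x)" if "x \<in> S" for x
    by (rule differentiable_cong_open[OF assms(1) that, of f]) (use Suc.prems that in auto)
  ultimately show ?case by simp
qed

lemma C_on_subset: "C_on k S f \<Longrightarrow> T \<subseteq> S \<Longrightarrow> C_on k T f"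
  by (induction k arbitrary: f) (auto intro: continuous_on_subset)

lemma C_on_SucD: "C_on (Suc k) S f \<Longrightarrow> C_on k S f"
proof (induction k arbitrary: f)
  case 0
  then show ?case
    by (simp add: continuous_at_imp_continuous_on differentiable_imp_continuous_within)
next
  case (Suc k)
  then show ?case by simp
qed

lemma C_on_mono: "C_on k S f \<Longrightarrow> j \<le> k \<Longrightarrow> C_on j S f"
proof (induction k)
  case (Suc k)
  then show ?case by (cases "j = Suc k") (auto simp only: dest: C_on_SucD)
qed simp

lemma C_on_continuous: "C_on k S f \<Longrightarrow> continuous_on S f"
  using C_on_mono[of k S f 0] by (simp only: C_on.simps le0)

lemma C_on_local:
  assumes "\<And>x. x \<in> S \<Longrightarrow> \<exists>T. open T \<and> x \<in> T \<and> C_on k T f"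
  shows "C_on k S f"
  using assms
proof (induction k arbitrary: f)
  case 0
  show ?case
    unfolding C_on.simps
  proof (rule continuous_at_imp_continuous_on, rule ballI)
    fix x assume "x \<in> S"
    then obtain T where "open T" "x \<in> T" "C_on 0 T f" using 0 by blast
    then show "isCont f x" by (simp add: continuous_on_eq_continuous_at)
  qed
next
  case (Suc k)
  have "f differentiable (at x)" if "x \<in> S" for x
    using Suc.prems[OF that] by auto
  moreover have "C_on k S (\<lambda>x. frechet_derivative f (at x) v)" for v
  proof (rule Suc.IH)
    fix x assume "x \<in> S"
    then obtain T where "open T" "x \<in> T" "C_on (Suc k) T f" using Suc.prems by blast
    then show "\<exists>T. open T \<and> x \<in> T \<and> C_on k T (\<lambda>x. frechet_derivative f (at x) v)"
      by (intro exI[of _ T]) simp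
  qed
  ultimately show ?case by simp
qed

lemma smooth_on_local:
  assumes "\<And>x. x \<in> S \<Longrightarrow> \<exists>T. open T \<and> x \<in> T \<and> smooth_on T f"
  shows "smooth_on S f"
  unfolding smooth_on_def
proof (intro allI C_on_local)
  fix k x assume "x \<in> S"
  with assms obtain T where "open T" "x \<in> T" "smooth_on T f" by blast
  then show "\<exists>T. open T \<and> x \<in> T \<and> C_on k T f" by (auto simp: smooth_on_def)
qed

lemma smooth_on_cong:
  assumes "open S" "\<And>y. y \<in> S \<Longrightarrow> f y = g y" "smooth_on S f"
  shows "smooth_on S g"
  unfolding smooth_on_def
proof
  fix k
  show "C_on k S g" using assms by (intro C_on_cong[of S f g]) (simp_all add: smooth_on_def)
qed

lemma smooth_on_subset: "smooth_on S f \<Longrightarrow> T \<subseteq> S \<Longrightarrow> smooth_on T f"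
  using C_on_subset[of _ S f T] by (simp add: smooth_on_def)

lemma C_on_const [simp]: "C_on k S (\<lambda>x. c)"
proof (induction k arbitrary: c)
  case (Suc k)
  have "frechet_derivative (\<lambda>x::'a. c) (at x) = (\<lambda>v. 0)" for x
    by (simp add: frechet_derivative_const)
  then show ?case using Suc by simp
qed simp

lemma C_on_bounded_linear: "bounded_linear f \<Longrightarrow> C_on k S f"
proof (cases k)
  case 0
  then show "bounded_linear f \<Longrightarrow> ?thesis" by (simp add: linear_continuous_on)
next
  case (Suc j)
  assume f: "bounded_linear f"
  then have "frechet_derivative f (at x) = f" for x
    by (metis bounded_linear_imp_has_derivative frechet_derivative_at)
  then show ?thesis
    using Suc f bounded_linear_imp_differentiable by auto
qed

lemma C_on_bounded_linear_compose:
  assumes "open S" "bounded_linear h" "C_on k S f"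
  shows "C_on k S (\<lambda>x. h (f x))"
  using assms(3)
proof (induction k arbitrary: f)
  case 0
  then show ?case using assms by (simp add: bounded_linear.continuous_on)
next
  case (Suc k)
  have d: "((\<lambda>x. h (f x)) has_derivative (\<lambda>v. h (frechet_derivative f (at x) v))) (at x)"
    if "x \<in> S" for x
    using Suc.prems that
    by (intro bounded_linear.has_derivative[OF assms(2)]) (auto simp: frechet_derivative_works)
  have "C_on k S (\<lambda>x. h (frechet_derivative f (at x) v))" for v
    using Suc by simp
  then have "C_on k S (\<lambda>x. frechet_derivative (\<lambda>x. h (f x)) (at x) v)" for v
    by (rule C_on_cong[OF assms(1), rotated]) (simp add: frechet_derivative_at[OF d, symmetric])
  then show ?case using differentiableI[OF d] by simp
qed

lemma C_on_add:
  assumes "open S" "C_on k S f" "C_on k S g"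
  shows "C_on k S (\<lambda>x. f x + g x)"
  using assms(2,3)
proof (induction k arbitrary: f g)
  case 0
  then show ?case by (simp add: continuous_on_add)
next
  case (Suc k)
  have d: "((\<lambda>x. f x + g x) has_derivative
      (\<lambda>v. frechet_derivative f (at x) v + frechet_derivative g (at x) v)) (at x)"
    if "x \<in> S" for x
    using Suc.prems that
    by (intro has_derivative_add) (auto simp: frechet_derivative_works)
  have "C_on k S (\<lambda>x. frechet_derivative f (at x) v + frechet_derivative g (at x) v)" for v
    using Suc by simp
  then have "C_on k S (\<lambda>x. frechet_derivative (\<lambda>x. f x + g x) (at x) v)" for v
    by (rule C_on_cong[OF assms(1), rotated]) (simp add: frechet_derivative_at[OF d, symmetric])
  then show ?case using differentiableI[OF d] by simp
qed

lemma C_on_bilinear: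
  assumes "open S" "bounded_bilinear h" "C_on k S f" "C_on k S g"
  shows "C_on k S (\<lambda>x. h (f x) (g x))"
  using assms(3,4)
proof (induction k arbitrary: f g)
  case 0
  then show ?case using assms(2) by (simp add: bounded_bilinear.continuous_on)
next
  case (Suc k)
  have d: "((\<lambda>x. h (f x) (g x)) has_derivative
      (\<lambda>v. h (f x) (frechet_derivative g (at x) v) + h (frechet_derivative f (at x) v) (g x))) (at x)"
    if "x \<in> S" for x
    using Suc.prems that
    by (intro bounded_bilinear.FDERIV[OF assms(2)]) (auto simp: frechet_derivative_works)
  have "C_on k S f" "C_on k S g" using Suc.prems C_on_SucD by blast+
  then have "C_on k S (\<lambda>x. h (f x) (frechet_derivative g (at x) v)
      + h (frechet_derivative f (at x) v) (g x))" for v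
    using Suc by (intro C_on_add assms) auto
  then have "C_on k S (\<lambda>x. frechet_derivative (\<lambda>x. h (f x) (g x)) (at x) v)" for v
    by (rule C_on_cong[OF assms(1), rotated]) (simp add: frechet_derivative_at[OF d, symmetric])
  then show ?case using differentiableI[OF d] by simp
qed

lemmas C_on_mult = C_on_bilinear[OF _ bounded_bilinear_mult]
lemmas C_on_scaleR = C_on_bilinear[OF _ bounded_bilinear_scaleR]
lemmas C_on_inner = C_on_bilinear[OF _ bounded_bilinear_inner]

lemma C_on_sum:
  assumes "open S" "\<And>i. i \<in> I \<Longrightarrow> C_on k S (f i)"
  shows "C_on k S (\<lambda>x. \<Sum>i\<in>I. f i x)"
  using assms(2)
  by (induction I rule: infinite_finite_induct) (auto intro: C_on_add assms(1))

lemma C_on_prod: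
  fixes f :: "'i \<Rightarrow> 'a::euclidean_space \<Rightarrow> real"
  assumes "open S" "\<And>i. i \<in> I \<Longrightarrow> C_on k S (f i)"
  shows "C_on k S (\<lambda>x. \<Prod>i\<in>I. f i x)"
  using assms(2)
  by (induction I rule: infinite_finite_induct) (auto intro: C_on_mult assms(1))

text \<open>\<open>C_on\<close> sees derivatives only in fixed directions, whereas the chain rule
  produces a direction varying with the point. Expanding that direction in \<open>Basis\<close>
  turns the derivative into a sum of products, to which the product rules and the induction
  hypothesis for \<open>f\<close> apply; \<open>g\<close> stays fixed throughout.\<close>

lemma C_on_compose:
  assumes "open S" "open T" "C_on k S g" "C_on k T f" "g ` S \<subseteq> T"
  shows "C_on k S (\<lambda>x. f (g x))"
  using assms(3,4)
proof (induction k arbitrary: f)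
  case 0
  then show ?case using assms(5) by (auto intro: continuous_on_compose2)
next
  case (Suc k)
  let ?D = "\<lambda>x v. frechet_derivative f (at (g x)) (frechet_derivative g (at x) v)"
  have lin: "linear (frechet_derivative f (at (g x)))" if "x \<in> S" for x
    using Suc.prems assms(5) that by (intro linear_frechet_derivative) auto
  have d: "((\<lambda>x. f (g x)) has_derivative ?D x) (at x)" if "x \<in> S" for x
    using Suc.prems assms(5) that
    by (intro has_derivative_compose[of g _ x UNIV f])
      (auto simp: frechet_derivative_works[symmetric] image_subset_iff)
  have D: "(\<Sum>b\<in>Basis. (frechet_derivative g (at x) v \<bullet> b) *\<^sub>R frechet_derivative f (at (g x)) b) = ?D x v"
    if "x \<in> S" for x v
  proof -
    have "?D x v = frechet_derivative f (at (g x))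
        (\<Sum>b\<in>Basis. (frechet_derivative g (at x) v \<bullet> b) *\<^sub>R b)"
      by (simp only: euclidean_representation)
    then show ?thesis by (simp only: linear_sum[OF lin[OF that]] linear_scale[OF lin[OF that]])
  qed
  have "C_on k S (\<lambda>x. \<Sum>b\<in>Basis. (frechet_derivative g (at x) v \<bullet> b) *\<^sub>R
      frechet_derivative f (at (g x)) b)" for v
  proof (intro C_on_sum assms(1) C_on_scaleR)
    fix b :: 'b
    have "C_on k S (\<lambda>x. frechet_derivative g (at x) v)" using Suc.prems by simp
    then show "C_on k S (\<lambda>x. frechet_derivative g (at x) v \<bullet> b)"
      by (rule C_on_bounded_linear_compose[OF assms(1) bounded_linear_inner_left])
    show "C_on k S (\<lambda>x. frechet_derivative f (at (g x)) b)"
      using Suc.prems C_on_SucD[OF Suc.prems(1)] by (intro Suc.IH) auto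
  qed
  then have "C_on k S (\<lambda>x. ?D x v)" for v
    by (rule C_on_cong[OF assms(1), rotated]) (simp add: D)
  then have "C_on k S (\<lambda>x. frechet_derivative (\<lambda>x. f (g x)) (at x) v)" for v
    by (rule C_on_cong[OF assms(1), rotated]) (simp add: frechet_derivative_at[OF d, symmetric])
  then show ?case using differentiableI[OF d] by simp
qed

lemma smooth_on_compose:
  assumes "open S" "open T" "smooth_on S g" "smooth_on T f" "g ` S \<subseteq> T"
  shows "smooth_on S (\<lambda>x. f (g x))"
  using assms unfolding smooth_on_def by (auto intro: C_on_compose)

text \<open>The derivative is a polynomial in \<open>inverse\<close> itself, so each degree of
  smoothness yields the next.\<close>

lemma C_on_inverse_real: "C_on k (- {0::real}) inverse"
proof (induction k)
  case 0
  then show ?case by (auto intro: continuous_on_inverse continuous_on_id)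
next
  case (Suc k)
  have d: "(inverse has_derivative (\<lambda>v. - (inverse x * v * inverse x))) (at x)"
    if "x \<in> - {0::real}" for x
    using that by (intro has_derivative_inverse') auto
  have o: "open (- {0::real})" by auto
  have "C_on k (- {0}) (\<lambda>x. (- v) * (inverse x * inverse x))" for v :: real
    by (intro C_on_mult o Suc C_on_const)
  then have "C_on k (- {0}) (\<lambda>x::real. frechet_derivative inverse (at x) v)" for v
    by (rule C_on_cong[OF o, rotated])
      (simp add: frechet_derivative_at[OF d, symmetric] mult_ac)
  then show ?case using differentiableI[OF d] by simp
qed

lemma C_on_inverse:
  fixes f :: "'a::euclidean_space \<Rightarrow> real"
  assumes "open S" "C_on k S f" "\<And>x. x \<in> S \<Longrightarrow> f x \<noteq> 0"
  shows "C_on k S (\<lambda>x. inverse (f x))"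
  by (rule C_on_compose[OF assms(1) _ assms(2) C_on_inverse_real]) (use assms(3) in auto)

lemma C_on_sqrt: "C_on k {0<..} sqrt"
proof (induction k)
  case 0
  then show ?case by (auto intro: continuous_intros)
next
  case (Suc k)
  have d: "(sqrt has_derivative (\<lambda>v. v * (inverse (sqrt x) / 2))) (at x)"
    if "x \<in> {0<..}" for x
  proof -
    have "(\<lambda>v. v * (inverse (sqrt x) / 2)) = (*) (inverse (sqrt x) / 2)" by auto
    then show ?thesis
      using DERIV_real_sqrt[of x] that by (simp only: has_field_derivative_def greaterThan_iff)
  qed
  have o: "open {0::real<..}" by auto
  have "C_on k {0<..} (\<lambda>x. (v / 2) * inverse (sqrt x))" for v :: real
    by (intro C_on_mult o Suc C_on_const C_on_inverse) auto
  then have "C_on k {0<..} (\<lambda>x::real. frechet_derivative sqrt (at x) v)" for v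
    by (rule C_on_cong[OF o, rotated])
      (simp add: frechet_derivative_at[OF d, symmetric] mult_ac)
  then show ?case using differentiableI[OF d] by simp
qed

lemma C_on_vec_nth:
  assumes "open S" "C_on k S f"
  shows "C_on k S (\<lambda>x. f x $ i)"
  using C_on_bounded_linear_compose[OF assms(1) bounded_linear_vec_nth assms(2)] .

lemma C_on_vec:
  fixes f :: "'a::euclidean_space \<Rightarrow> real^'n"
  assumes "open S" "\<And>i. C_on k S (\<lambda>x. f x $ i)"
  shows "C_on k S f"
proof -
  have "C_on k S (\<lambda>x. \<Sum>i\<in>UNIV. f x $ i *\<^sub>R (axis i 1 :: real^'n))"
    by (intro C_on_sum C_on_scaleR assms C_on_const)
  moreover have "(\<Sum>i\<in>UNIV. f x $ i *\<^sub>R axis i 1) = f x" for x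
    using basis_expansion[of "f x"] by (simp add: scalar_mult_eq_scaleR)
  ultimately show ?thesis by (simp only:)
qed

lemma C_on_det:
  fixes a :: "'n::finite \<Rightarrow> 'n \<Rightarrow> 'a::euclidean_space \<Rightarrow> real"
  assumes "open S" "\<And>i j. C_on k S (a i j)"
  shows "C_on k S (\<lambda>x. det (\<chi> i j. a i j x))"
  unfolding det_def by (simp, intro C_on_sum C_on_mult C_on_prod assms C_on_const)

section \<open>Smoothness of the inverse of an injective immersion between equal dimensions\<close>

lemma
  fixes M :: "real^'n^'n"
  assumes "invertible M"
  shows matrix_inv_left: "matrix_inv M ** M = mat 1"
    and matrix_inv_right: "M ** matrix_inv M = mat 1"
  using assms someI_ex[of "\<lambda>A'. M ** A' = mat 1 \<and> A' ** M = mat 1"]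
  unfolding invertible_def matrix_inv_def by auto

text \<open>Since injectivity is given on all of \<open>U\<close>, invariance of domain already
  supplies openness and a continuous inverse. Smoothness is bootstrapped: the derivative of the
  inverse is the inverse Jacobian evaluated along the inverse map, so it is as smooth as that map,
  which therefore gains one degree.\<close>

lemma smooth_on_inverse_function:
  fixes G :: "real^'n \<Rightarrow> real^'n"
  assumes U: "open U" and G: "smooth_on U G" and inj: "inj_on G U"
    and imm: "\<And>y. y \<in> U \<Longrightarrow> inj (frechet_derivative G (at y))"
  shows "open (G ` U)" and "smooth_on (G ` U) (inv_into U G)"
proof -
  let ?K = "inv_into U G"
  have cG: "continuous_on U G" using G C_on_continuous smooth_on_def by blast
  show V: "open (G ` U)" by (rule invariance_of_domain[OF cG U inj])
  have cK: "continuous_on (G ` U) ?K"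
  proof -
    obtain g where g: "homeomorphism U (G ` U) G g"
      using invariance_of_domain_homeomorphism[OF U cG _ inj] by auto
    have "g x = ?K x" if x: "x \<in> G ` U" for x
      using x inj g by (auto simp: homeomorphism_def)
    then show ?thesis
      using g continuous_on_cong[of "G ` U" "G ` U" g ?K] by (simp add: homeomorphism_def)
  qed
  have KU: "?K ` (G ` U) \<subseteq> U" by (auto simp: inj)
  have GK: "G (?K x) = x" if "x \<in> G ` U" for x using that by (simp add: f_inv_into_f)
  have lin: "linear (frechet_derivative G (at y))" if "y \<in> U" for y
    using G that unfolding smooth_on_def by (intro linear_frechet_derivative) (metis C_on.simps(2))
  define J where "J y = matrix (frechet_derivative G (at y))" for y
  have Jinv: "det (J y) \<noteq> 0" if "y \<in> U" for y
    unfolding J_def using imm[OF that] lin[OF that]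
    by (simp add: det_nz_iff_inj)
  have Jv: "J y *v v = frechet_derivative G (at y) v" if "y \<in> U" for y v
    using lin[OF that] by (simp add: J_def matrix_works)
  have dK: "(?K has_derivative (\<lambda>v. matrix_inv (J (?K x)) *v v)) (at x)" if x: "x \<in> G ` U" for x
  proof (rule has_derivative_inverse_basic[where f = G and f' = "frechet_derivative G (at (?K x))" and T = "G ` U"])
    have y: "?K x \<in> U" using x KU by auto
    show "(G has_derivative frechet_derivative G (at (?K x))) (at (?K x))"
      using G y unfolding smooth_on_def by (metis C_on.simps(2) frechet_derivative_works)
    show "bounded_linear (\<lambda>v. matrix_inv (J (?K x)) *v v)"
      by (simp add: linear_linear matrix_vector_mul_bounded_linear)
    have "matrix_inv (J (?K x)) ** J (?K x) = mat 1"
      using Jinv[OF y] by (simp add: invertible_det_nz matrix_inv_left)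
    then show "(\<lambda>v. matrix_inv (J (?K x)) *v v) \<circ> frechet_derivative G (at (?K x)) = id"
      by (auto simp: fun_eq_iff Jv[OF y, symmetric] matrix_vector_mul_assoc)
    show "continuous (at x) ?K"
      using continuous_on_eq_continuous_at[OF V] cK x by blast
  qed (use x V GK in auto)
  have "C_on k (G ` U) ?K" for k
  proof (induction k)
    case 0
    then show ?case using cK by simp
  next
    case (Suc k)
    have "C_on k (G ` U) (\<lambda>x. matrix_inv (J (?K x)) *v v)" for v
    proof (rule C_on_vec[OF V])
      fix i
      have e: "C_on k (G ` U) (\<lambda>x. J (?K x) $ a $ b)" for a b
      proof -
        have "C_on k U (\<lambda>y. frechet_derivative G (at y) (axis b 1))"
          using G unfolding smooth_on_def by (metis C_on.simps(2))
        then have "C_on k U (\<lambda>y. frechet_derivative G (at y) (axis b 1) $ a)"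
          by (rule C_on_vec_nth[OF U])
        then have "C_on k (G ` U) (\<lambda>x. frechet_derivative G (at (?K x)) (axis b 1) $ a)"
          by (rule C_on_compose[OF V U Suc _ KU])
        then show ?thesis by (simp add: J_def matrix_def)
      qed
      \<comment> \<open>Numerator in Cramer's rule: column i of the Jacobian is replaced by
        \<open>v\<close>. This writes the inverse matrix through determinants, whose smoothness is
        known.\<close>
      define N where "N x = det (\<chi> a b. if b = i then v $ a else J (?K x) $ a $ b)" for x
      have "C_on k (G ` U) N"
        unfolding N_def
      proof (rule C_on_det[OF V])
        show "C_on k (G ` U) (\<lambda>x. if b = i then v $ a else J (?K x) $ a $ b)" for a b
          by (cases "b = i") (simp_all add: e)
      qed
      moreover have "C_on k (G ` U) (\<lambda>x. det (\<chi> a b. J (?K x) $ a $ b))"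
        by (intro C_on_det V e)
      ultimately have "C_on k (G ` U) (\<lambda>x. N x * inverse (det (\<chi> a b. J (?K x) $ a $ b)))"
        using Jinv KU by (intro C_on_mult C_on_inverse V) auto
      moreover have "N x * inverse (det (\<chi> a b. J (?K x) $ a $ b)) = (matrix_inv (J (?K x)) *v v) $ i"
        if "x \<in> G ` U" for x
      proof -
        have nz: "det (J (?K x)) \<noteq> 0" using that KU Jinv by auto
        then have "J (?K x) *v (matrix_inv (J (?K x)) *v v) = v"
          by (simp add: matrix_vector_mul_assoc invertible_det_nz matrix_inv_right)
        then show ?thesis
          using cramer[OF nz, of "matrix_inv (J (?K x)) *v v" v] by (simp add: N_def divide_inverse)
      qed
      ultimately show "C_on k (G ` U) (\<lambda>x. (matrix_inv (J (?K x)) *v v) $ i)"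
        by (rule C_on_cong[OF V, rotated]) simp
    qed
    then have "C_on k (G ` U) (\<lambda>x. frechet_derivative ?K (at x) v)" for v
      by (rule C_on_cong[OF V, rotated]) (simp add: frechet_derivative_at[OF dK, symmetric])
    then show ?case using dK differentiable_def by auto blast
  qed
  then show "smooth_on (G ` U) ?K" by (simp add: smooth_on_def)
qed

section \<open>Topology of flat tori\<close>

locale lattice_basis =
  fixes L :: "'a::euclidean_space set" and B :: "'a set"
  assumes indep: "independent B" and spanB: "span B = UNIV"
    and L_eq: "L = {v. \<exists>m::'a \<Rightarrow> int. v = (\<Sum>b\<in>B. of_int (m b) *\<^sub>R b)}"
begin

definition coord :: "'a \<Rightarrow> 'a \<Rightarrow> real" where "coord b x = representation B x b"

lemma finite_B: "finite B"
  using indep by (simp add: independent_bound)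

lemma coord_sum: "(\<Sum>b\<in>B. coord b x *\<^sub>R b) = x"
  unfolding coord_def by (rule sum_representation_eq[OF indep]) (auto simp: spanB finite_B)

lemma linear_coord: "linear (coord b)"
  unfolding coord_def
  by (intro linearI) (auto simp: representation_add representation_scale indep spanB)

lemma coord_add [simp]: "coord b (x + y) = coord b x + coord b y"
  and coord_diff [simp]: "coord b (x - y) = coord b x - coord b y"
  using linear_add[OF linear_coord] linear_diff[OF linear_coord] by auto

lemma continuous_coord: "continuous_on S (coord b)"
  using linear_coord linear_continuous_on linear_conv_bounded_linear by blast

lemma coord_basis: "b \<in> B \<Longrightarrow> c \<in> B \<Longrightarrow> coord b c = (if b = c then 1 else 0)"
  unfolding coord_def by (simp add: representation_basis indep)

lemma coord_combination: "c \<in> B \<Longrightarrow> coord c (\<Sum>b\<in>B. t b *\<^sub>R b) = t c"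
  by (simp add: linear_sum[OF linear_coord] linear_scale[OF linear_coord] coord_basis finite_B
      if_distrib cong: if_cong)

lemma mem_L: "x \<in> L \<longleftrightarrow> (\<forall>b\<in>B. coord b x \<in> \<int>)"
proof
  assume "x \<in> L" then show "\<forall>b\<in>B. coord b x \<in> \<int>"
    unfolding L_eq by (auto simp: coord_combination)
next
  assume "\<forall>b\<in>B. coord b x \<in> \<int>"
  then have "\<forall>b\<in>B. \<exists>m::int. coord b x = of_int m" by (auto elim: Ints_cases)
  then obtain m :: "'a \<Rightarrow> int" where "\<forall>b\<in>B. coord b x = of_int (m b)"
    using bchoice[of B "\<lambda>b m. coord b x = of_int m"] by auto
  then have "x = (\<Sum>b\<in>B. of_int (m b) *\<^sub>R b)"
    using coord_sum[of x] by simp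
  then show "x \<in> L" unfolding L_eq by blast
qed

lemma B_subset_L: "B \<subseteq> L"
  by (auto simp: mem_L coord_basis)

lemma zero_L: "0 \<in> L" by (simp add: mem_L linear_0[OF linear_coord])
lemma add_L: "x \<in> L \<Longrightarrow> y \<in> L \<Longrightarrow> x + y \<in> L" by (simp add: mem_L)
lemma diff_L: "x \<in> L \<Longrightarrow> y \<in> L \<Longrightarrow> x - y \<in> L" by (simp add: mem_L)
lemma minus_L: "x \<in> L \<Longrightarrow> - x \<in> L" using diff_L[OF zero_L] by simp

lemma mem_torus_proj: "y \<in> torus_proj L x \<longleftrightarrow> y - x \<in> L"
  unfolding torus_proj_def by (auto simp: image_iff intro!: bexI[of _ "y - x"])

lemma torus_proj_eq: "torus_proj L x = torus_proj L y \<longleftrightarrow> x - y \<in> L"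
proof
  assume "torus_proj L x = torus_proj L y"
  then show "x - y \<in> L" using mem_torus_proj[of x x] mem_torus_proj[of x y] zero_L by simp
next
  assume *: "x - y \<in> L"
  have "z - x \<in> L \<longleftrightarrow> z - y \<in> L" for z
    using add_L[OF _ *, of "z - x"] diff_L[OF _ *, of "z - y"] by auto
  then show "torus_proj L x = torus_proj L y" by (auto simp: mem_torus_proj)
qed

lemma proj_shift: "l \<in> L \<Longrightarrow> torus_proj L (x + l) = torus_proj L x"
  by (simp add: torus_proj_eq)

lemma continuous_proj: "continuous_map euclidean (torus L) (torus_proj L)"
  unfolding continuous_map_def
  by (auto simp: topspace_torus openin_torus vimage_def)

lemma open_vimage_proj_image:
  assumes "open V" shows "open (torus_proj L -` (torus_proj L ` V))"
proof -
  have "torus_proj L -` (torus_proj L ` V) = (\<Union>l\<in>L. (\<lambda>x. l + x) ` V)"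
    by (force simp: torus_proj_eq image_iff intro: bexI[of _ "_ - _"])
  then show ?thesis using assms by (auto intro: open_translation)
qed

lemma openin_proj_image: "open V \<Longrightarrow> openin (torus L) (torus_proj L ` V)"
  by (simp add: openin_torus open_vimage_proj_image image_mono)

lemma quotient_proj: "quotient_map euclidean (torus L) (torus_proj L)"
  by (rule continuous_open_imp_quotient_map)
    (auto simp: continuous_proj open_map_def openin_proj_image topspace_torus)

lemma proj_continuous_on:
  "continuous_on S g \<Longrightarrow> continuous_map (top_of_set S) (torus L) (\<lambda>x. torus_proj L (g x))"
  using continuous_map_compose[of "top_of_set S" euclidean g "torus L" "torus_proj L"]
    continuous_proj by (simp add: o_def)

text \<open>The characters of the torus dual to the basis. For b in \<open>B\<close> the
  representative picked by \<open>SOME\<close> is irrelevant, as another one changes the coordinate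
  by an integer. They separate points and reduce lifting problems to the choice of
  logarithms.\<close>

definition chi :: "'a \<Rightarrow> 'a set \<Rightarrow> complex" where
  "chi b s = cis (2 * pi * coord b (SOME x. x \<in> s))"

lemma chi_proj:
  assumes "b \<in> B" shows "chi b (torus_proj L x) = cis (2 * pi * coord b x)"
proof -
  have "x \<in> torus_proj L x" by (simp add: mem_torus_proj zero_L)
  then have "(SOME y. y \<in> torus_proj L x) - x \<in> L"
    by (metis mem_torus_proj someI)
  then have "coord b (SOME y. y \<in> torus_proj L x) - coord b x \<in> \<int>"
    using assms by (simp add: mem_L)
  then obtain n where "coord b (SOME y. y \<in> torus_proj L x) = coord b x + of_int n"
    by (auto simp: Ints_def) (metis add.commute diff_add_cancel)
  then have "chi b (torus_proj L x) = cis (2 * pi * coord b x) * cis (2 * pi * of_int n)"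
    by (simp add: chi_def cis_mult algebra_simps)
  then show ?thesis by (simp add: cis_multiple_2pi)
qed

lemma continuous_chi: "b \<in> B \<Longrightarrow> continuous_map (torus L) euclidean (chi b)"
  by (rule continuous_compose_quotient_map[OF quotient_proj])
    (auto simp: o_def chi_proj intro!: continuous_intros continuous_coord)

text \<open>Equality of all characters makes each coordinate difference an integer. The point on the
  left is built from arbitrary angles \<open>t b\<close>, because the lifts below come with angles
  read off from logarithms.\<close>

lemma chi_separates:
  assumes "\<And>b. b \<in> B \<Longrightarrow> cis (2 * pi * t b) = chi b (torus_proj L x)"
  shows "torus_proj L (\<Sum>b\<in>B. t b *\<^sub>R b) = torus_proj L x"
proof -
  have "coord b ((\<Sum>b\<in>B. t b *\<^sub>R b) - x) \<in> \<int>" if b: "b \<in> B" for b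
  proof -
    have "exp (\<i> * complex_of_real (2 * pi * t b)) = exp (\<i> * complex_of_real (2 * pi * coord b x))"
      using assms[OF b] chi_proj[OF b] by (simp add: cis_conv_exp)
    then obtain n :: int where "\<i> * complex_of_real (2 * pi * t b) =
        \<i> * complex_of_real (2 * pi * coord b x) + (of_int (2 * n) * pi) * \<i>"
      unfolding exp_eq by auto
    then have "\<i> * complex_of_real (2 * pi * t b) = \<i> * complex_of_real (2 * pi * (coord b x + n))"
      by (simp add: algebra_simps)
    then have "2 * pi * t b = 2 * pi * (coord b x + n)"
      by (metis mult_cancel_left of_real_eq_iff complex_i_not_zero)
    then have "t b - coord b x = n" by simp
    then show ?thesis by (simp add: coord_combination b)
  qed
  then show ?thesis by (simp add: torus_proj_eq mem_L)
qed

lemma Hausdorff_torus: "Hausdorff_space (torus L)"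
  unfolding Hausdorff_space_def
proof (intro allI impI, elim conjE)
  fix s t assume st: "s \<in> topspace (torus L)" "t \<in> topspace (torus L)" "s \<noteq> t"
  then obtain x y where xy: "s = torus_proj L x" "t = torus_proj L y" by (auto simp: topspace_torus)
  have "\<exists>b\<in>B. chi b s \<noteq> chi b t"
  proof (rule ccontr)
    assume "\<not> (\<exists>b\<in>B. chi b s \<noteq> chi b t)"
    then have "torus_proj L (\<Sum>b\<in>B. coord b x *\<^sub>R b) = torus_proj L y"
      by (intro chi_separates) (simp add: xy chi_proj)
    then show False using st xy by (simp add: coord_sum)
  qed
  then obtain b where b: "b \<in> B" "chi b s \<noteq> chi b t" by blast
  then obtain U V where UV: "open U" "open V" "chi b s \<in> U" "chi b t \<in> V" "U \<inter> V = {}"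
    using hausdorff by metis
  have "openin (torus L) {z \<in> topspace (torus L). chi b z \<in> W}" if "open W" for W
    using continuous_chi[OF b(1)] that openin_continuous_map_preimage by fastforce
  with UV st show "\<exists>U V. openin (torus L) U \<and> openin (torus L) V \<and> s \<in> U \<and> t \<in> V \<and> disjnt U V"
    by (intro exI[of _ "{z \<in> topspace (torus L). chi b z \<in> U}"]
        exI[of _ "{z \<in> topspace (torus L). chi b z \<in> V}"]) (auto simp: disjnt_def)
qed

lemma connected_torus: "connected_space (torus L)"
  using connectedin_continuous_map_image[OF continuous_proj, of UNIV]
  by (simp add: topspace_torus[symmetric] connectedin_topspace connected_UNIV)

text \<open>Over a contractible domain every character of the map has a continuous logarithm.
  Characters have modulus one, so only the imaginary part matters, and divided by 2 pi it is the
  coordinate of the lift along the corresponding basis vector.\<close>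

lemma lift_exists:
  fixes S :: "'c::real_normed_vector set"
  assumes "contractible S" "continuous_map (top_of_set S) (torus L) \<phi>"
  obtains g where "continuous_on S g" "\<And>s. s \<in> S \<Longrightarrow> torus_proj L (g s) = \<phi> s"
proof -
  have "\<exists>h. continuous_on S h \<and> (\<forall>s\<in>S. chi b (\<phi> s) = exp (h s))" if "b \<in> B" for b
  proof -
    have "continuous_map (top_of_set S) euclidean (chi b \<circ> \<phi>)"
      by (rule continuous_map_compose[OF assms(2) continuous_chi[OF that]])
    then have "continuous_on S (\<lambda>s. chi b (\<phi> s))" by (simp add: o_def)
    then obtain h where "continuous_on S h" "\<And>s. s \<in> S \<Longrightarrow> chi b (\<phi> s) = exp (h s)"
      using continuous_logarithm_on_contractible[OF _ assms(1)]
      by (metis chi_def cis_neq_zero)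
    then show ?thesis by blast
  qed
  then obtain h where h: "\<And>b. b \<in> B \<Longrightarrow> continuous_on S (h b)"
      "\<And>b s. b \<in> B \<Longrightarrow> s \<in> S \<Longrightarrow> chi b (\<phi> s) = exp (h b s)"
    by metis
  show thesis
  proof
    show "continuous_on S (\<lambda>s. \<Sum>b\<in>B. (Im (h b s) / (2 * pi)) *\<^sub>R b)"
      by (intro continuous_intros h) auto
    fix s assume s: "s \<in> S"
    then have "\<phi> s \<in> topspace (torus L)"
      using assms(2) by (auto simp: continuous_map_def)
    then obtain x where x: "\<phi> s = torus_proj L x" by (auto simp: topspace_torus)
    have "cis (2 * pi * (Im (h b s) / (2 * pi))) = chi b (torus_proj L x)" if "b \<in> B" for b
    proof -
      have e: "exp (h b s) = chi b (torus_proj L x)" using h(2)[OF that s] x by simp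
      then have "exp (Re (h b s)) = 1" by (metis chi_def norm_cis norm_exp_eq_Re)
      then have "exp (h b s) = cis (Im (h b s))" by (simp add: exp_eq_polar)
      then show ?thesis using e by simp
    qed
    then show "torus_proj L (\<Sum>b\<in>B. (Im (h b s) / (2 * pi)) *\<^sub>R b) = \<phi> s"
      unfolding x by (rule chi_separates)
  qed
qed

text \<open>Each coordinate is integer-valued, so distinct values are at distance at least 1. This
  is the discreteness behind uniqueness of lifts and, later, behind the comparison of lifts in
  different charts.\<close>

lemma constant_if_L_valued:
  fixes S :: "'c::topological_space set"
  assumes "connected S" "continuous_on S g" "\<And>s. s \<in> S \<Longrightarrow> g s \<in> L" "s \<in> S" "t \<in> S"
  shows "g s = g t"
proof -
  have "coord b (g s) = coord b (g t)" if b: "b \<in> B" for b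
  proof -
    have "(\<lambda>s. coord b (g s)) constant_on S"
    proof (rule continuous_discrete_range_constant[OF assms(1)])
      show "continuous_on S (\<lambda>s. coord b (g s))"
        using continuous_on_compose2[OF continuous_coord assms(2), of UNIV] by auto
      fix x assume x: "x \<in> S"
      show "\<exists>e>0. \<forall>y. y \<in> S \<and> coord b (g y) \<noteq> coord b (g x) \<longrightarrow> e \<le> norm (coord b (g y) - coord b (g x))"
      proof (intro exI[of _ 1] conjI allI impI)
        fix y assume y: "y \<in> S \<and> coord b (g y) \<noteq> coord b (g x)"
        then have "coord b (g y) - coord b (g x) \<in> \<int>"
          using assms(3) x b by (auto simp: mem_L)
        then show "1 \<le> norm (coord b (g y) - coord b (g x))"
          using y Ints_nonzero_abs_ge1[of "coord b (g y) - coord b (g x)"] by simp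
      qed simp
    qed
    then show ?thesis using assms(4,5) by (auto simp: constant_on_def)
  qed
  then show ?thesis using coord_sum[of "g s"] coord_sum[of "g t"] by (metis (no_types, lifting) sum.cong)
qed

lemma lift_unique:
  fixes S :: "'c::topological_space set"
  assumes "connected S" "continuous_on S g" "continuous_on S h"
    "\<And>s. s \<in> S \<Longrightarrow> torus_proj L (g s) = torus_proj L (h s)" "s \<in> S" "t \<in> S"
  shows "g s - h s = g t - h t"
  by (rule constant_if_L_valued[OF assms(1) _ _ assms(5,6), of "\<lambda>s. g s - h s"])
    (use assms in \<open>auto intro!: continuous_intros simp: torus_proj_eq\<close>)

lemma discrete_L: "\<exists>e>0. \<forall>l\<in>L. norm l < e \<longrightarrow> l = 0"
proof -
  obtain K where K: "\<And>b x. b \<in> B \<Longrightarrow> \<bar>coord b x\<bar> \<le> norm x * K b" "\<And>b. b \<in> B \<Longrightarrow> K b > 0"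
    using bounded_linear.pos_bounded[OF linear_coord[unfolded linear_conv_bounded_linear]]
    by (metis real_norm_def)
  \<comment> \<open>Dominates the norms of all coordinate functionals at once. A lattice vector
    shorter than \<open>1 / M\<close> has integer coordinates of modulus below 1; the extra 1 keeps
    \<open>M\<close> positive even if the sum is zero.\<close>
  define M where "M = (\<Sum>b\<in>B. K b) + 1"
  have M: "K b < M" if "b \<in> B" for b
  proof -
    have "K b \<le> sum K B" by (rule member_le_sum) (use K(2) that finite_B in \<open>auto intro: less_imp_le\<close>)
    then show ?thesis by (simp add: M_def)
  qed
  have Mpos: "M > 0" unfolding M_def using sum_nonneg[of B K] K(2) by (force intro: less_imp_le)
  show ?thesis
  proof (intro exI[of _ "1 / M"] conjI ballI impI)
    fix l assume l: "l \<in> L" "norm l < 1 / M"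
    have "coord b l = 0" if b: "b \<in> B" for b
    proof -
      have "\<bar>coord b l\<bar> \<le> norm l * M"
        using K(1)[OF b, of l] M[OF b] by (meson less_imp_le mult_left_mono norm_ge_zero order_trans)
      also have "\<dots> < 1" using l(2) Mpos by (simp add: field_simps)
      finally show ?thesis using l(1) b Ints_nonzero_abs_less1 by (auto simp: mem_L)
    qed
    then show "l = 0" using coord_sum[of l] by simp
  qed (use Mpos in auto)
qed

text \<open>By translation invariance one radius serves every centre. Half of the minimal lattice
  distance is taken since two points of a ball may be almost a diameter apart.\<close>

lemma inj_on_ball: "\<exists>r>0. \<forall>x. inj_on (torus_proj L) (ball x r)"
proof -
  obtain e where e: "e > 0" "\<And>l. l \<in> L \<Longrightarrow> norm l < e \<Longrightarrow> l = 0" using discrete_L by blast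
  have "inj_on (torus_proj L) (ball x (e / 2))" for x
  proof (rule inj_onI)
    fix y z assume yz: "y \<in> ball x (e / 2)" "z \<in> ball x (e / 2)" "torus_proj L y = torus_proj L z"
    have "norm (y - z) < e"
      using yz(1,2) dist_triangle_half_r[of x y e z] by (simp add: dist_norm)
    then show "y = z" using e(2)[of "y - z"] yz(3) by (simp add: torus_proj_eq)
  qed
  then show ?thesis using e(1) by (intro exI[of _ "e / 2"]) auto
qed

end

lemma full_lattice_obtain:
  assumes "full_lattice L" obtains B where "lattice_basis L B"
  using assms unfolding full_lattice_def lattice_basis_def by blast

lemma locally_path_connected_space_euclidean:
  "locally_path_connected_space (euclidean :: 'a::real_normed_vector topology)"
  unfolding locally_path_connected_space_def neighbourhood_base_of
proof (intro allI impI, elim conjE)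
  fix W and x :: 'a assume "openin euclidean W" "x \<in> W"
  then obtain e where "e > 0" "ball x e \<subseteq> W" by (auto simp: open_contains_ball)
  then show "\<exists>U V. openin euclidean U \<and> path_connectedin euclidean V \<and> x \<in> U \<and> U \<subseteq> V \<and> V \<subseteq> W"
    by (intro exI[of _ "ball x e"])
      (auto simp: path_connectedin_euclidean convex_imp_path_connected)
qed

lemma locally_path_connected_torus:
  "full_lattice L \<Longrightarrow> locally_path_connected_space (torus L)"
  by (metis full_lattice_obtain lattice_basis.quotient_proj locally_path_connected_space_euclidean
      locally_path_connected_space_quotient_map_image)

section \<open>The fundamental group\<close>

lemma loop_homotopy_iff:
  "(p, q) \<in> loop_homotopy X x \<longleftrightarrow>
     homotopic_with (\<lambda>r. r 0 = x \<and> r 1 = x) (top_of_set {0..1}) X p q"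
  by (simp add: loop_homotopy_def)

lemma loop_homotopy_subset: "loop_homotopy X x \<subseteq> loops X x \<times> loops X x"
proof clarify
  fix p q assume "(p, q) \<in> loop_homotopy X x"
  then have h: "homotopic_with (\<lambda>r. r 0 = x \<and> r 1 = x) (top_of_set {0..1}) X p q"
    by (simp add: loop_homotopy_iff)
  show "p \<in> loops X x \<and> q \<in> loops X x"
    using homotopic_with_imp_continuous_maps[OF h] homotopic_with_imp_property[OF h]
    by (simp add: loops_def pathin_def)
qed

lemma equiv_loop_homotopy: "equiv (loops X x) (loop_homotopy X x)"
proof (rule equivI)
  show "loop_homotopy X x \<subseteq> loops X x \<times> loops X x" by (rule loop_homotopy_subset)
  show "refl_on (loops X x) (loop_homotopy X x)"
    unfolding refl_on_def by (auto simp: loop_homotopy_iff loops_def pathin_def)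
  show "sym (loop_homotopy X x)"
    by (rule symI) (simp add: loop_homotopy_iff homotopic_with_sym)
  show "trans (loop_homotopy X x)"
    by (rule transI, unfold loop_homotopy_iff) (rule homotopic_with_trans)
qed

lemma pathin_compose_unit:
  assumes "pathin X p" "continuous_on {0..1} \<phi>" "\<phi> ` {0..1} \<subseteq> {0..1::real}"
  shows "pathin X (p \<circ> \<phi>)"
  unfolding pathin_def
  by (rule continuous_map_compose[where X' = "top_of_set {0..1}"])
    (use assms in \<open>auto simp: pathin_def\<close>)

text \<open>Associativity, units and inverses in the fundamental group all arise from two
  reparametrisations of one and the same path, which are homotopic by convexity of the unit
  interval.\<close>

lemma homotopic_reparametrisations:
  assumes p: "pathin X p" and \<phi>: "continuous_on {0..1} \<phi>" "\<phi> ` {0..1} \<subseteq> {0..1::real}"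
    and \<psi>: "continuous_on {0..1} \<psi>" "\<psi> ` {0..1} \<subseteq> {0..1}"
    and ends: "\<phi> 0 = \<psi> 0" "\<phi> 1 = \<psi> 1" "p (\<phi> 0) = x" "p (\<phi> 1) = x"
    and f: "\<And>t. t \<in> {0..1} \<Longrightarrow> f t = p (\<phi> t)" and g: "\<And>t. t \<in> {0..1} \<Longrightarrow> g t = p (\<psi> t)"
  shows "(f, g) \<in> loop_homotopy X x"
proof -
  let ?I = "top_of_set {0..1::real}"
  let ?m = "\<lambda>z. (1 - fst z) * \<phi> (snd z) + fst z * \<psi> (snd z)"
  have m: "?m z \<in> {0..1}" if z: "z \<in> {0..1} \<times> {0..1}" for z
  proof -
    have "(1 - fst z) *\<^sub>R \<phi> (snd z) + fst z *\<^sub>R \<psi> (snd z) \<in> {0..1}"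
      by (rule convexD[OF convex_real_interval(5)]) (use z \<phi>(2) \<psi>(2) in auto)
    then show ?thesis by simp
  qed
  have "continuous_on ({0..1} \<times> {0..1}) ?m"
    by (intro continuous_intros continuous_on_compose2[OF \<phi>(1)] continuous_on_compose2[OF \<psi>(1)]) auto
  then have "continuous_map (prod_topology ?I ?I) ?I ?m"
    using m by (auto simp: continuous_map_in_subtopology prod_topology_subtopology
        euclidean_product_topology subtopology_subtopology Times_Int_Times)
  then have "continuous_map (prod_topology ?I ?I) X (p \<circ> ?m)"
    using p continuous_map_compose unfolding pathin_def by blast
  then have "homotopic_with (\<lambda>r. r 0 = x \<and> r 1 = x) ?I X (p \<circ> \<phi>) (p \<circ> \<psi>)"
    unfolding homotopic_with_def
    by (intro exI[of _ "p \<circ> ?m"]) (use ends in \<open>auto simp: algebra_simps\<close>)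
  then have "homotopic_with (\<lambda>r. r 0 = x \<and> r 1 = x) ?I X f g"
    by (rule homotopic_with_eq) (use f g in auto)
  then show ?thesis by (simp add: loop_homotopy_iff)
qed

lemma continuous_on_unit_cases:
  fixes f g :: "real \<Rightarrow> 'a::topological_space"
  assumes "continuous_on {0..1/2} f" "continuous_on {1/2..1} g" "f (1/2) = g (1/2)"
  shows "continuous_on {0..1} (\<lambda>t. if t \<le> 1/2 then f t else g t)"
proof -
  have "continuous_on ({0..1/2} \<union> {1/2..1}) (\<lambda>t. if t \<le> 1/2 then f t else g t)"
  proof (rule continuous_on_cases)
    show "\<forall>t. t \<in> {0..1/2} \<and> \<not> t \<le> 1/2 \<or> t \<in> {1/2..1} \<and> t \<le> 1/2 \<longrightarrow> f t = g t"
      using assms(3) by (metis antisym atLeastAtMost_iff)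
  qed (use assms in auto)
  moreover have "{0..1/2} \<union> {1/2..1} = {0..1::real}" by auto
  ultimately show ?thesis by simp
qed

lemma pathin_join:
  assumes "pathin X p" "pathin X q" "p 1 = q 0"
  shows "pathin X (loop_join p q)"
  unfolding pathin_def loop_join_def
proof (rule continuous_map_cases_le)
  let ?I = "top_of_set {0..1::real}"
  show "continuous_map ?I euclideanreal (\<lambda>t. t)" "continuous_map ?I euclideanreal (\<lambda>t. 1/2)"
    by auto
  have 1: "continuous_map (subtopology ?I {t \<in> topspace ?I. t \<le> 1/2}) ?I (\<lambda>t. 2 * t)"
    by (auto simp: continuous_map_in_subtopology subtopology_subtopology intro!: continuous_intros)
  show "continuous_map (subtopology ?I {t \<in> topspace ?I. t \<le> 1/2}) X (\<lambda>t. p (2 * t))"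
    using continuous_map_compose[OF 1] assms(1) by (simp add: pathin_def o_def)
  have 2: "continuous_map (subtopology ?I {t \<in> topspace ?I. 1/2 \<le> t}) ?I (\<lambda>t. 2 * t - 1)"
    by (auto simp: continuous_map_in_subtopology subtopology_subtopology intro!: continuous_intros)
  show "continuous_map (subtopology ?I {t \<in> topspace ?I. 1/2 \<le> t}) X (\<lambda>t. q (2 * t - 1))"
    using continuous_map_compose[OF 2] assms(2) by (simp add: pathin_def o_def)
  show "p (2 * t) = q (2 * t - 1)" if "t \<in> topspace ?I" "t = 1/2" for t
    unfolding that(2) using assms(3) by simp
qed

lemma loop_join_loops: "p \<in> loops X x \<Longrightarrow> q \<in> loops X x \<Longrightarrow> loop_join p q \<in> loops X x"
  using pathin_join[of X p q] by (auto simp: loops_def loop_join_def)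

lemma loop_join_cong:
  assumes "(p, p') \<in> loop_homotopy X x" "(q, q') \<in> loop_homotopy X x"
  shows "(loop_join p q, loop_join p' q') \<in> loop_homotopy X x"
proof -
  let ?I = "top_of_set {0..1::real}"
  let ?II = "prod_topology ?I ?I"
  obtain h where h: "continuous_map ?II X h" "\<And>t. h (0, t) = p t" "\<And>t. h (1, t) = p' t"
      "\<And>s. s \<in> {0..1} \<Longrightarrow> h (s, 0) = x \<and> h (s, 1) = x"
    using assms(1) unfolding loop_homotopy_iff homotopic_with_def by auto
  obtain k where k: "continuous_map ?II X k" "\<And>t. k (0, t) = q t" "\<And>t. k (1, t) = q' t"
      "\<And>s. s \<in> {0..1} \<Longrightarrow> k (s, 0) = x \<and> k (s, 1) = x"
    using assms(2) unfolding loop_homotopy_iff homotopic_with_def by auto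
  define H where "H z = (if snd z \<le> 1/2 then h (fst z, 2 * snd z) else k (fst z, 2 * snd z - 1))"
    for z :: "real \<times> real"
  have II: "?II = top_of_set ({0..1} \<times> {0..1})"
    by (simp add: prod_topology_subtopology euclidean_product_topology subtopology_subtopology Times_Int_Times)
  have "continuous_map ?II X H"
    unfolding H_def
  proof (rule continuous_map_cases_le)
    show "continuous_map ?II euclideanreal snd" "continuous_map ?II euclideanreal (\<lambda>z. 1/2)"
      unfolding II by (auto intro!: continuous_intros)
    have 1: "continuous_map (subtopology ?II {z \<in> topspace ?II. snd z \<le> 1/2}) ?II
        (\<lambda>z. (fst z, 2 * snd z))"
      unfolding II by (auto simp: continuous_map_in_subtopology subtopology_subtopology intro!: continuous_intros)
    show "continuous_map (subtopology ?II {z \<in> topspace ?II. snd z \<le> 1/2}) X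
        (\<lambda>z. h (fst z, 2 * snd z))"
      using continuous_map_compose[OF 1 h(1)] by (simp add: o_def)
    have 2: "continuous_map (subtopology ?II {z \<in> topspace ?II. 1/2 \<le> snd z}) ?II
        (\<lambda>z. (fst z, 2 * snd z - 1))"
      unfolding II by (auto simp: continuous_map_in_subtopology subtopology_subtopology intro!: continuous_intros)
    show "continuous_map (subtopology ?II {z \<in> topspace ?II. 1/2 \<le> snd z}) X
        (\<lambda>z. k (fst z, 2 * snd z - 1))"
      using continuous_map_compose[OF 2 k(1)] by (simp add: o_def)
    show "h (fst z, 2 * snd z) = k (fst z, 2 * snd z - 1)"
      if "z \<in> topspace ?II" "snd z = 1/2" for z
    proof -
      have "2 * snd z = 1" "2 * snd z - 1 = 0" "fst z \<in> {0..1}" using that by (auto simp: II)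
      then show ?thesis by (simp only: h(4) k(4))
    qed
  qed
  then show ?thesis
    unfolding loop_homotopy_iff homotopic_with_def
    by (intro exI[of _ H]) (auto simp: H_def loop_join_def h k)
qed

abbreviation loop_class :: "'a topology \<Rightarrow> 'a \<Rightarrow> (real \<Rightarrow> 'a) \<Rightarrow> (real \<Rightarrow> 'a) set" where
  "loop_class X x p \<equiv> loop_homotopy X x `` {p}"

lemma loop_class_eq:
  "p \<in> loops X x \<Longrightarrow> q \<in> loops X x \<Longrightarrow>
     loop_class X x p = loop_class X x q \<longleftrightarrow> (p, q) \<in> loop_homotopy X x"
  using eq_equiv_class_iff[OF equiv_loop_homotopy] .

lemma carrier_fundamental_group:
  "P \<in> carrier (fundamental_group X x) \<longleftrightarrow> (\<exists>p\<in>loops X x. P = loop_class X x p)"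
  by (auto simp: fundamental_group_def quotient_def)

lemma mult_loop_class:
  assumes "p \<in> loops X x" "q \<in> loops X x"
  shows "loop_class X x p \<otimes>\<^bsub>fundamental_group X x\<^esub> loop_class X x q = loop_class X x (loop_join p q)"
proof -
  have eq: "loop_class X x (loop_join p' q') = loop_class X x (loop_join p q)"
    if "(p, p') \<in> loop_homotopy X x" "(q, q') \<in> loop_homotopy X x" for p' q'
    using equiv_class_eq[OF equiv_loop_homotopy loop_join_cong[OF that]] by simp
  have self: "p \<in> loop_class X x p" "q \<in> loop_class X x q"
    using equiv_class_self[OF equiv_loop_homotopy] assms by auto
  have "(\<Union>p'\<in>loop_class X x p. \<Union>q'\<in>loop_class X x q. loop_class X x (loop_join p' q')) =
      (\<Union>p'\<in>loop_class X x p. \<Union>q'\<in>loop_class X x q. loop_class X x (loop_join p q))"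
    by (rule SUP_cong[OF refl], rule SUP_cong[OF refl], rule eq) (simp_all only: Image_singleton_iff)
  also have "\<dots> = loop_class X x (loop_join p q)"
    using self by (metis SUP_const empty_iff)
  finally show ?thesis by (simp add: fundamental_group_def)
qed

lemma one_fundamental_group: "\<one>\<^bsub>fundamental_group X x\<^esub> = loop_class X x (\<lambda>t. x)"
  by (simp add: fundamental_group_def)

lemma const_loop: "x \<in> topspace X \<Longrightarrow> (\<lambda>t. x) \<in> loops X x"
  by (simp add: loops_def)

lemma reverse_loop:
  assumes "p \<in> loops X x" shows "(\<lambda>t. p (1 - t)) \<in> loops X x"
proof -
  have "pathin X (p \<circ> (\<lambda>t. 1 - t))"
    by (rule pathin_compose_unit) (use assms in \<open>auto simp: loops_def intro!: continuous_intros\<close>)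
  then show ?thesis using assms by (simp add: loops_def o_def)
qed

lemma reverse_loop_join:
  assumes "p \<in> loops X x"
  shows "(loop_join (\<lambda>t. p (1 - t)) p, \<lambda>t. x) \<in> loop_homotopy X x"
proof (rule homotopic_reparametrisations[where p = p
      and \<phi> = "\<lambda>t. if t \<le> 1/2 then 1 - 2 * t else 2 * t - 1" and \<psi> = "\<lambda>t. 1"])
  show "continuous_on {0..1} (\<lambda>t::real. if t \<le> 1/2 then 1 - 2 * t else 2 * t - 1)"
    by (rule continuous_on_unit_cases) (auto intro!: continuous_intros)
qed (use assms in \<open>auto simp: loops_def loop_join_def\<close>)

lemma const_loop_join:
  assumes "p \<in> loops X x"
  shows "(loop_join (\<lambda>t. x) p, p) \<in> loop_homotopy X x"
proof (rule homotopic_reparametrisations[where p = p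
      and \<phi> = "\<lambda>t. if t \<le> 1/2 then 0 else 2 * t - 1" and \<psi> = "\<lambda>t. t"])
  show "continuous_on {0..1} (\<lambda>t::real. if t \<le> 1/2 then 0 else 2 * t - 1)"
    by (rule continuous_on_unit_cases) (auto intro!: continuous_intros)
qed (use assms in \<open>auto simp: loops_def loop_join_def\<close>)

lemma loop_join_assoc:
  assumes p: "p \<in> loops X x" and q: "q \<in> loops X x" and r: "r \<in> loops X x"
  shows "(loop_join (loop_join p q) r, loop_join p (loop_join q r)) \<in> loop_homotopy X x"
\<comment> \<open>The map \<phi> sends [0,1/4], [1/4,1/2] and [1/2,1] affinely onto [0,1/2],
  [1/2,3/4] and [3/4,1], that is, the intervals of p, q, r in the left bracketing onto those in the
  right bracketing.\<close>
proof (rule homotopic_reparametrisations[where p = "loop_join p (loop_join q r)"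
      and \<phi> = "\<lambda>t. if t \<le> 1/2 then (if t \<le> 1/4 then 2 * t else t + 1/4) else t / 2 + 1 / 2" and \<psi> = "\<lambda>t. t"])
  have "continuous_on {0..1/2} (\<lambda>t::real. if t \<le> 1/4 then 2 * t else t + 1/4)"
  proof -
    have "continuous_on ({0..1/4} \<union> {1/4..1/2}) (\<lambda>t::real. if t \<le> 1/4 then 2 * t else t + 1/4)"
      by (rule continuous_on_cases) (auto intro!: continuous_intros simp: antisym)
    moreover have "{0..1/4} \<union> {1/4..1/2} = {0..1/2::real}" by auto
    ultimately show ?thesis by simp
  qed
  then show "continuous_on {0..1::real} (\<lambda>t. if t \<le> 1/2 then (if t \<le> 1/4 then 2 * t else t + 1/4) else t / 2 + 1 / 2)"
    by (intro continuous_on_unit_cases) (auto intro!: continuous_intros)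
  show "pathin X (loop_join p (loop_join q r))"
    using loop_join_loops[OF p loop_join_loops[OF q r]] by (simp add: loops_def)
  fix t :: real assume t: "t \<in> {0..1}"
  show "loop_join (loop_join p q) r t = loop_join p (loop_join q r)
      (if t \<le> 1/2 then (if t \<le> 1/4 then 2 * t else t + 1/4) else t / 2 + 1 / 2)"
    using t p q r by (auto simp: loop_join_def loops_def algebra_simps)
qed (use assms in \<open>auto simp: loop_join_def loops_def\<close>)

lemma group_fundamental_group:
  assumes x: "x \<in> topspace X" shows "group (fundamental_group X x)"
proof (rule groupI)
  let ?G = "fundamental_group X x"
  show "\<one>\<^bsub>?G\<^esub> \<in> carrier ?G"
    using const_loop[OF x] by (auto simp: one_fundamental_group carrier_fundamental_group)
  show "P \<otimes>\<^bsub>?G\<^esub> Q \<in> carrier ?G" if "P \<in> carrier ?G" "Q \<in> carrier ?G" for P Q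
    using that loop_join_loops by (fastforce simp: carrier_fundamental_group mult_loop_class)
  show "P \<otimes>\<^bsub>?G\<^esub> Q \<otimes>\<^bsub>?G\<^esub> R = P \<otimes>\<^bsub>?G\<^esub> (Q \<otimes>\<^bsub>?G\<^esub> R)"
    if PQR: "P \<in> carrier ?G" "Q \<in> carrier ?G" "R \<in> carrier ?G" for P Q R
  proof -
    obtain p q r where "p \<in> loops X x" "q \<in> loops X x" "r \<in> loops X x"
      "P = loop_class X x p" "Q = loop_class X x q" "R = loop_class X x r"
      using PQR unfolding carrier_fundamental_group by blast
    then show ?thesis
      using loop_class_eq[of "loop_join (loop_join p q) r" X x "loop_join p (loop_join q r)"]
      by (simp add: mult_loop_class loop_join_loops loop_join_assoc)
  qed
  show "\<one>\<^bsub>?G\<^esub> \<otimes>\<^bsub>?G\<^esub> P = P" if P: "P \<in> carrier ?G" for P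
  proof -
    obtain p where p: "p \<in> loops X x" "P = loop_class X x p"
      using P by (auto simp: carrier_fundamental_group)
    then have "loop_class X x (loop_join (\<lambda>t. x) p) = loop_class X x p"
      by (intro equiv_class_eq[OF equiv_loop_homotopy] const_loop_join)
    then show ?thesis
      using p const_loop[OF x] by (simp add: one_fundamental_group mult_loop_class)
  qed
  show "\<exists>Q\<in>carrier ?G. Q \<otimes>\<^bsub>?G\<^esub> P = \<one>\<^bsub>?G\<^esub>" if P: "P \<in> carrier ?G" for P
  proof -
    obtain p where p: "p \<in> loops X x" "P = loop_class X x p"
      using P by (auto simp: carrier_fundamental_group)
    show ?thesis
    proof
      show "loop_class X x (\<lambda>t. p (1 - t)) \<in> carrier ?G"
        using reverse_loop[OF p(1)] by (auto simp: carrier_fundamental_group)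
      show "loop_class X x (\<lambda>t. p (1 - t)) \<otimes>\<^bsub>?G\<^esub> P = \<one>\<^bsub>?G\<^esub>"
        using p reverse_loop[OF p(1)] by (simp add: one_fundamental_group mult_loop_class
            loop_join_loops loop_class_eq const_loop x reverse_loop_join)
    qed
  qed
qed

text \<open>An infimum of a nonempty family in the well-ordered type \<open>enat\<close> is
  attained. The family cannot be empty here, because its infimum would then be infinite.\<close>

lemma number_of_generators_le:
  assumes "number_of_generators G \<le> enat k"
  obtains S where "S \<subseteq> carrier G" "finite S" "generate G S = carrier G" "card S \<le> k"
proof -
  let ?F = "{S. S \<subseteq> carrier G \<and> finite S \<and> generate G S = carrier G}"
  have "?F \<noteq> {}"
  proof
    assume e: "?F = {}"
    have "number_of_generators G = \<infinity>"
      unfolding number_of_generators_def e by (simp add: top_enat_def)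
    then show False using assms by simp
  qed
  then obtain S0 where "S0 \<in> ?F" by blast
  then have "(INF S\<in>?F. enat (card S)) \<in> (\<lambda>S. enat (card S)) ` ?F"
    by (intro wellorder_InfI[OF imageI])
  then show thesis
    using assms that unfolding number_of_generators_def image_iff by auto
qed

section \<open>Periods of maps into a torus\<close>

text \<open>Stated for any space \<open>Y\<close> over the torus, since it is applied both to the
  hypersurface with its embedding and to a component of the complement with its inclusion.\<close>

definition periods :: "'a::euclidean_space set \<Rightarrow> 'b topology \<Rightarrow> ('b \<Rightarrow> 'a set) \<Rightarrow> 'b \<Rightarrow> 'a set" where
  "periods L Y F y = {g 1 - g 0 |p g. p \<in> loops Y y \<and> continuous_on {0..1} g \<and>
     (\<forall>t\<in>{0..1}. torus_proj L (g t) = F (p t))}"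

text \<open>The displacement does not depend on the lift, because two lifts differ by a constant. It
  makes sense for paths that are not closed, and this is what allows coordinates to be integrated
  from a base point.\<close>

definition period :: "'a::euclidean_space set \<Rightarrow> ('b \<Rightarrow> 'a set) \<Rightarrow> (real \<Rightarrow> 'b) \<Rightarrow> 'a" where
  "period L F p = (SOME v. \<exists>g. continuous_on {0..1} g \<and>
     (\<forall>t\<in>{0..1}. torus_proj L (g t) = F (p t)) \<and> v = g 1 - g 0)"

context lattice_basis
begin

lemma path_lift:
  assumes "pathin Y p" "continuous_map Y (torus L) F" "torus_proj L a = F (p 0)"
  obtains g where "continuous_on {0..1} g" "\<And>t. t \<in> {0..1} \<Longrightarrow> torus_proj L (g t) = F (p t)" "g 0 = a"
proof -
  have c: "contractible {0..1::real}" by (simp add: convex_imp_contractible)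
  have "continuous_map (top_of_set {0..1}) (torus L) (F \<circ> p)"
    using assms(1,2) continuous_map_compose unfolding pathin_def by blast
  then obtain g where g: "continuous_on {0..1} g" "\<And>t. t \<in> {0..1} \<Longrightarrow> torus_proj L (g t) = (F \<circ> p) t"
    using lift_exists[OF c] by blast
  have "a - g 0 \<in> L" using assms(3) g(2)[of 0] by (simp add: torus_proj_eq[symmetric])
  then show thesis
    using g by (intro that[of "\<lambda>t. g t + (a - g 0)"]) (auto intro!: continuous_intros simp del: add_diff_eq simp: proj_shift)
qed

lemma period_eq:
  assumes "continuous_on {0..1} g" "\<And>t. t \<in> {0..1} \<Longrightarrow> torus_proj L (g t) = F (p t)"
  shows "period L F p = g 1 - g 0"
  unfolding period_def
proof (rule some_equality)
  show "\<exists>g'. continuous_on {0..1} g' \<and> (\<forall>t\<in>{0..1}. torus_proj L (g' t) = F (p t)) \<and>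
      g 1 - g 0 = g' 1 - g' 0"
    using assms by blast
  fix v assume "\<exists>g'. continuous_on {0..1} g' \<and> (\<forall>t\<in>{0..1}. torus_proj L (g' t) = F (p t)) \<and>
      v = g' 1 - g' 0"
  then obtain h where h: "continuous_on {0..1} h" "\<forall>t\<in>{0..1}. torus_proj L (h t) = F (p t)"
      "v = h 1 - h 0" by blast
  have "g 1 - h 1 = g 0 - h 0"
    by (rule lift_unique[of "{0..1::real}"]) (use assms h in auto)
  then have "g 1 = g 0 - h 0 + h 1" by (simp add: diff_eq_eq)
  then show "v = g 1 - g 0" using h(3) by simp
qed

lemma periods_eq:
  assumes "continuous_map Y (torus L) F"
  shows "periods L Y F y = period L F ` loops Y y"
proof
  show "periods L Y F y \<subseteq> period L F ` loops Y y"
  proof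
    fix v assume "v \<in> periods L Y F y"
    then obtain p g where "p \<in> loops Y y" "continuous_on {0..1} g"
        "\<forall>t\<in>{0..1}. torus_proj L (g t) = F (p t)" "v = g 1 - g 0"
      unfolding periods_def by blast
    then show "v \<in> period L F ` loops Y y" using period_eq[of g F p] by (intro image_eqI[of _ _ p]) auto
  qed
  show "period L F ` loops Y y \<subseteq> periods L Y F y"
  proof clarify
    fix p assume p: "p \<in> loops Y y"
    then have "F (p 0) \<in> topspace (torus L)"
      using assms by (auto simp: loops_def pathin_def continuous_map_def)
    then obtain a where "torus_proj L a = F (p 0)" by (auto simp: topspace_torus)
    then obtain g where "continuous_on {0..1} g" "\<And>t. t \<in> {0..1} \<Longrightarrow> torus_proj L (g t) = F (p t)"
      using p path_lift[OF _ assms] by (metis (no_types, lifting) loops_def mem_Collect_eq)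
    then show "period L F p \<in> periods L Y F y"
      unfolding periods_def using p period_eq[of g F p] by blast
  qed
qed

lemma lift_join:
  assumes "continuous_on {0..1} g" "\<And>t. t \<in> {0..1} \<Longrightarrow> torus_proj L (g t) = F (p t)"
    and "continuous_on {0..1} h" "\<And>t. t \<in> {0..1} \<Longrightarrow> torus_proj L (h t) = F (q t)"
    and "g 1 = h 0"
  shows "continuous_on {0..1} (loop_join g h)"
    and "\<And>t. t \<in> {0..1} \<Longrightarrow> torus_proj L (loop_join g h t) = F (loop_join p q t)"
proof -
  show "continuous_on {0..1} (loop_join g h)"
    unfolding loop_join_def
  proof (rule continuous_on_unit_cases)
    show "continuous_on {0..1/2} (\<lambda>t. g (2 * t))"
      by (rule continuous_on_compose2[OF assms(1)]) (auto intro!: continuous_intros)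
    show "continuous_on {1/2..1} (\<lambda>t. h (2 * t - 1))"
      by (rule continuous_on_compose2[OF assms(3)]) (auto intro!: continuous_intros)
  qed (use assms(5) in simp)
  show "torus_proj L (loop_join g h t) = F (loop_join p q t)" if "t \<in> {0..1}" for t
    using that assms(2)[of "2 * t"] assms(4)[of "2 * t - 1"] by (auto simp: loop_join_def)
qed

lemma period_join:
  assumes F: "continuous_map Y (torus L) F" and p: "pathin Y p" and q: "pathin Y q" and pq: "p 1 = q 0"
  shows "period L F (loop_join p q) = period L F p + period L F q"
proof -
  have "F (p 0) \<in> topspace (torus L)"
    using F p by (auto simp: pathin_def continuous_map_def)
  then obtain a where a: "torus_proj L a = F (p 0)" by (auto simp: topspace_torus)
  obtain g where g: "continuous_on {0..1} g" "\<And>t. t \<in> {0..1} \<Longrightarrow> torus_proj L (g t) = F (p t)"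
    by (rule path_lift[OF p F a]) (rule that)
  have q0: "torus_proj L (g 1) = F (q 0)" using g(2)[of 1] pq by simp
  obtain h where h: "continuous_on {0..1} h" "\<And>t. t \<in> {0..1} \<Longrightarrow> torus_proj L (h t) = F (q t)"
      "h 0 = g 1"
    by (rule path_lift[OF q F q0]) (rule that)
  have "period L F (loop_join p q) = loop_join g h 1 - loop_join g h 0"
    by (rule period_eq) (use lift_join[where F = F, OF g(1) _ h(1), of p q] g(2) h(2,3) in auto)
  then show ?thesis
    using period_eq[of g F p] g period_eq[of h F q] h by (simp add: loop_join_def)
qed

text \<open>The homotopy is lifted over the whole square at once. Its two sides t = 0 and t = 1 are
  mapped to one point, so uniqueness of lifts makes the lift constant along them, and the
  displacements of the two end paths agree.\<close>

lemma period_homotopic: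
  assumes F: "continuous_map Y (torus L) F" and pq: "(p, q) \<in> loop_homotopy Y y"
  shows "period L F p = period L F q"
proof -
  let ?I = "top_of_set {0..1::real}"
  obtain h where h: "continuous_map (prod_topology ?I ?I) Y h" "\<And>t. h (0, t) = p t" "\<And>t. h (1, t) = q t"
      "\<And>s. s \<in> {0..1} \<Longrightarrow> h (s, 0) = y \<and> h (s, 1) = y"
    using pq unfolding loop_homotopy_iff homotopic_with_def by auto
  have "continuous_map (top_of_set ({0..1::real} \<times> {0..1::real})) (torus L) (F \<circ> h)"
    using continuous_map_compose[OF h(1) F]
    by (simp add: prod_topology_subtopology euclidean_product_topology subtopology_subtopology Times_Int_Times)
  moreover have "contractible ({0..1::real} \<times> {0..1::real})"
    by (intro convex_imp_contractible convex_Times) auto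
  ultimately obtain G where G: "continuous_on ({0..1} \<times> {0..1}) G"
      "\<And>z. z \<in> {0..1} \<times> {0..1} \<Longrightarrow> torus_proj L (G z) = (F \<circ> h) z"
    using lift_exists by blast
  have slice: "continuous_on {0..1} (\<lambda>t. G (s, t))" "continuous_on {0..1} (\<lambda>s'. G (s', s))"
    if "s \<in> {0..1}" for s
    using that by (auto intro!: continuous_on_compose2[OF G(1)] continuous_intros)
  have const: "G (0, t) = G (1, t)" if "t = 0 \<or> t = 1" for t
  proof -
    have "G (0, t) - G (0, t) = G (1, t) - G (0, t)"
    proof (rule lift_unique[of "{0..1::real}" "\<lambda>s. G (s, t)" "\<lambda>s. G (0, t)"])
      show "torus_proj L (G (s, t)) = torus_proj L (G (0, t))" if "s \<in> {0..1}" for s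
        using that \<open>t = 0 \<or> t = 1\<close> G(2)[of "(s, t)"] G(2)[of "(0, t)"] h(4)[of s] h(4)[of 0] by auto
    qed (use that slice in auto)
    then show ?thesis by simp
  qed
  have "period L F p = G (0, 1) - G (0, 0)"
    by (rule period_eq) (use slice[of 0] G(2) h in auto)
  moreover have "period L F q = G (1, 1) - G (1, 0)"
    by (rule period_eq) (use slice[of 1] G(2) h in auto)
  ultimately show ?thesis using const by simp
qed

lemma period_const: "period L F (\<lambda>t. y) = 0" if y: "F y \<in> topspace (torus L)"
proof -
  obtain a where "torus_proj L a = F y" using y by (auto simp: topspace_torus)
  then show ?thesis using period_eq[of "\<lambda>t. a" F "\<lambda>t. y"] by simp
qed

text \<open>By homotopy invariance and additivity under joining, \<open>period\<close> descends to a
  homomorphism from the fundamental group to a vector space. Its image lies in the span of the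
  images of any generating set.\<close>

lemma dim_periods_le:
  assumes F: "continuous_map Y (torus L) F" and y: "y \<in> topspace Y"
    and k: "number_of_generators (fundamental_group Y y) \<le> enat k"
  shows "dim (periods L Y F y) \<le> k"
proof -
  let ?G = "fundamental_group Y y"
  interpret group ?G by (rule group_fundamental_group[OF y])
  obtain S where S: "S \<subseteq> carrier ?G" "finite S" "generate ?G S = carrier ?G" "card S \<le> k"
    using number_of_generators_le[OF k] .
  define per where "per P = period L F (SOME p. p \<in> P)" for P
  have per: "per (loop_class Y y p) = period L F p" if "p \<in> loops Y y" for p
  proof -
    have "p \<in> loop_class Y y p" using equiv_class_self[OF equiv_loop_homotopy that] .
    then have "(SOME q. q \<in> loop_class Y y p) \<in> loop_class Y y p" by (rule someI[of "\<lambda>q. q \<in> loop_class Y y p"])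
    then show ?thesis unfolding per_def
      using period_homotopic[OF F] by auto
  qed
  have per_mult: "per (P \<otimes>\<^bsub>?G\<^esub> Q) = per P + per Q" if PQ: "P \<in> carrier ?G" "Q \<in> carrier ?G" for P Q
  proof -
    obtain p q where "p \<in> loops Y y" "P = loop_class Y y p" "q \<in> loops Y y" "Q = loop_class Y y q"
      using PQ by (auto simp: carrier_fundamental_group)
    then show ?thesis
      using period_join[OF F, of p q]
      by (simp add: mult_loop_class per loop_join_loops) (simp add: loops_def)
  qed
  have "F y \<in> topspace (torus L)" using F y by (auto simp: continuous_map_def)
  then have per_one: "per \<one>\<^bsub>?G\<^esub> = 0"
    by (simp add: one_fundamental_group per const_loop y period_const)
  have per_inv: "per (inv\<^bsub>?G\<^esub> P) = - per P" if "P \<in> carrier ?G" for P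
    using per_mult[of "inv\<^bsub>?G\<^esub> P" P] that per_one by (simp add: eq_neg_iff_add_eq_0)
  have gen: "P \<in> carrier ?G \<and> per P \<in> span (per ` S)" if "P \<in> generate ?G S" for P
    using that
  proof (induction rule: generate.induct)
    case one then show ?case by (simp add: per_one span_zero)
  next
    case (incl h) then show ?case using S(1) by (auto intro: span_base)
  next
    case (inv h)
    then have "h \<in> carrier ?G" using S(1) by auto
    then show ?case using inv by (auto simp: per_inv intro: span_neg span_base)
  next
    case (eng h1 h2) then show ?case by (auto simp: per_mult intro: span_add)
  qed
  have "periods L Y F y \<subseteq> span (per ` S)"
    unfolding periods_eq[OF F]
  proof clarify
    fix p assume p: "p \<in> loops Y y"
    then have "loop_class Y y p \<in> generate ?G S" by (auto simp: S(3) carrier_fundamental_group)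
    then show "period L F p \<in> span (per ` S)" using gen per[OF p] by force
  qed
  then have "dim (periods L Y F y) \<le> card (per ` S)"
    by (rule dim_le_card) (simp add: S(2))
  then show ?thesis using card_image_le[OF S(2), of per] S(4) by linarith
qed

end

section \<open>The maximum principle for minimal immersions\<close>

text \<open>Were \<open>D\<close> positive, the first derivative, zero at 0, would be positive just
  to the right, and the mean value theorem would give values above the maximum.\<close>

lemma second_derivative_test_real:
  fixes \<phi> :: "real \<Rightarrow> real"
  assumes e: "e > 0" and d1: "\<And>t. \<bar>t\<bar> < e \<Longrightarrow> (\<phi> has_real_derivative \<phi>' t) (at t)"
    and d2: "(\<phi>' has_real_derivative D) (at 0)"
    and max: "\<And>t. \<bar>t\<bar> < e \<Longrightarrow> \<phi> t \<le> \<phi> 0"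
  shows "\<phi>' 0 = 0" and "D \<le> 0"
proof -
  show z: "\<phi>' 0 = 0"
    using DERIV_local_max[OF d1[of 0] e] max e by auto
  show "D \<le> 0"
  proof (rule ccontr)
    assume "\<not> D \<le> 0"
    then obtain d where d: "d > 0" "\<And>h. 0 < h \<Longrightarrow> h < d \<Longrightarrow> \<phi>' 0 < \<phi>' h"
      using DERIV_pos_inc_right[OF d2] by auto
    define s where "s = min d e / 2"
    have s: "0 < s" "s < d" "s < e" using d(1) e by (auto simp: s_def)
    have "\<exists>z. 0 < z \<and> z < s \<and> \<phi> s - \<phi> 0 = (s - 0) * \<phi>' z"
      by (rule MVT2) (use s d1 in auto)
    then obtain c where "0 < c" "c < s" "\<phi> s - \<phi> 0 = s * \<phi>' c" by auto
    moreover have "s * \<phi>' c > 0" using d(2)[of c] z calculation s by auto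
    ultimately show False using max[of s] s by auto
  qed
qed

text \<open>Restriction to the line through \<open>y\<close> in direction \<open>w\<close> reduces
  to one variable. The function is split so that \<open>h\<close> can be a barrier with explicit
  derivatives, while \<open>u\<close> carries the Frechet derivatives of the immersion.\<close>

lemma second_derivative_test:
  fixes u h :: "'a::euclidean_space \<Rightarrow> real"
  assumes U: "open U" "y \<in> U" and u: "C_on 2 U u"
    and h: "\<And>x. (h has_derivative h' x) (at x)"
    and h2: "\<And>w. ((\<lambda>t. h' (y + t *\<^sub>R w) w) has_real_derivative h'' w) (at 0)"
    and max: "\<And>x. x \<in> U \<Longrightarrow> u x + h x \<le> u y + h y"
  shows "frechet_derivative u (at y) w + h' y w = 0"
    and "frechet_derivative (\<lambda>x. frechet_derivative u (at x) w) (at y) w + h'' w \<le> 0"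
proof -
  obtain r where r: "r > 0" "ball y r \<subseteq> U" using U by (auto simp: open_contains_ball)
  \<comment> \<open>Small enough for the segment to stay in the ball; the summand 1 covers the
    direction w = 0.\<close>
  define e where "e = r / (norm w + 1)"
  have e: "e > 0" using r by (auto simp: e_def intro!: divide_pos_pos add_nonneg_pos)
  have inU: "y + t *\<^sub>R w \<in> U" if "\<bar>t\<bar> < e" for t
  proof -
    have "norm (t *\<^sub>R w) \<le> \<bar>t\<bar> * (norm w + 1)" by (simp add: mult_left_mono)
    also have "\<dots> < e * (norm w + 1)" using that by (intro mult_strict_right_mono add_nonneg_pos) auto
    also have "\<dots> = r" by (simp add: e_def add_nonneg_eq_0_iff)
    finally show ?thesis using r(2) by (auto simp: dist_norm subset_iff)
  qed
  have u1: "u differentiable (at x)" if "x \<in> U" for x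
    using u that by (simp add: numeral_2_eq_2)
  have u2: "(\<lambda>x. frechet_derivative u (at x) w) differentiable (at y)"
    using u U(2) by (simp add: numeral_2_eq_2)
  have line: "((\<lambda>t. y + t *\<^sub>R w) has_derivative (\<lambda>t. t *\<^sub>R w)) (at t)" for t
    by (auto intro!: derivative_eq_intros)
  let ?f = "\<lambda>t. u (y + t *\<^sub>R w) + h (y + t *\<^sub>R w)"
  let ?f' = "\<lambda>t. frechet_derivative u (at (y + t *\<^sub>R w)) w + h' (y + t *\<^sub>R w) w"
  have d1: "(?f has_real_derivative ?f' t) (at t)" if t: "\<bar>t\<bar> < e" for t
  proof -
    have du: "(u has_derivative frechet_derivative u (at (y + t *\<^sub>R w))) (at (y + t *\<^sub>R w))"
      using u1[OF inU[OF t]] by (simp add: frechet_derivative_works)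
    have "(?f has_derivative (\<lambda>s. frechet_derivative u (at (y + t *\<^sub>R w)) (s *\<^sub>R w)
        + h' (y + t *\<^sub>R w) (s *\<^sub>R w))) (at t)"
      by (intro has_derivative_add has_derivative_compose[OF line] du h)
    moreover have "linear (frechet_derivative u (at (y + t *\<^sub>R w)))" "linear (h' (y + t *\<^sub>R w))"
      using du h has_derivative_linear by auto
    then have "(\<lambda>s. frechet_derivative u (at (y + t *\<^sub>R w)) (s *\<^sub>R w) + h' (y + t *\<^sub>R w) (s *\<^sub>R w)) = (*) (?f' t)"
      by (auto simp: fun_eq_iff linear_scale algebra_simps)
    ultimately show ?thesis by (simp only: has_field_derivative_def)
  qed
  have d2: "(?f' has_real_derivative
      (frechet_derivative (\<lambda>x. frechet_derivative u (at x) w) (at y) w + h'' w)) (at 0)"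
  proof (rule DERIV_add[OF _ h2])
    let ?g = "\<lambda>x. frechet_derivative u (at x) w"
    have "(?g has_derivative frechet_derivative ?g (at y)) (at (y + 0 *\<^sub>R w))"
      using u2 by (simp add: frechet_derivative_works)
    then have "((\<lambda>t. ?g (y + t *\<^sub>R w)) has_derivative (\<lambda>s. frechet_derivative ?g (at y) (s *\<^sub>R w))) (at 0)"
      by (rule has_derivative_compose[OF line])
    moreover have "linear (frechet_derivative ?g (at y))" by (rule linear_frechet_derivative[OF u2])
    then have "(\<lambda>s. frechet_derivative ?g (at y) (s *\<^sub>R w)) = (*) (frechet_derivative ?g (at y) w)"
      by (auto simp: fun_eq_iff linear_scale)
    ultimately show "((\<lambda>t. ?g (y + t *\<^sub>R w)) has_real_derivative frechet_derivative ?g (at y) w) (at 0)"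
      by (simp only: has_field_derivative_def)
  qed
  have m: "?f t \<le> ?f 0" if "\<bar>t\<bar> < e" for t
    using max[OF inU[OF that]] by simp
  show "frechet_derivative u (at y) w + h' y w = 0"
    using second_derivative_test_real(1)[OF e d1 d2 m] by simp
  show "frechet_derivative (\<lambda>x. frechet_derivative u (at x) w) (at y) w + h'' w \<le> 0"
    using second_derivative_test_real(2)[OF e d1 d2 m] .
qed

text \<open>The range of \<open>T\<close> has the dimension of the source, so there is a linear
  isometry onto it; following it by a left inverse of \<open>T\<close> gives \<open>P\<close>. The
  vectors \<open>P e\<close> for basis vectors \<open>e\<close> form an orthonormal frame of the
  metric pulled back by \<open>T\<close>.\<close>

lemma isometric_frame:
  fixes T :: "'a::euclidean_space \<Rightarrow> 'f::euclidean_space"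
  assumes "linear T" "inj T"
  obtains P :: "'a \<Rightarrow> 'a" where "linear P" "\<And>e. norm (T (P e)) = norm e"
proof -
  have "dim (UNIV :: 'a set) = dim (range T)"
    using dim_image_eq[OF assms(1), of UNIV] assms(2) by simp
  then obtain f :: "'a \<Rightarrow> 'f" where f: "linear f" "f ` UNIV = range T" "\<And>x. norm (f x) = norm x"
    using isometry_subspaces[of "UNIV :: 'a set" "range T"] linear_subspace_image[OF assms(1) subspace_UNIV]
    by auto
  obtain g where g: "linear g" "g \<circ> T = id"
    using linear_injective_left_inverse[OF assms] by blast
  show thesis
  proof
    show "linear (g \<circ> f)" by (rule linear_compose[OF f(1) g(1)])
    fix e
    obtain x where x: "f e = T x" using f(2) by blast
    then have "T (g (f e)) = f e" using g(2) by (metis comp_apply id_apply)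
    then show "norm (T ((g \<circ> f) e)) = norm e" by (simp add: f(3))
  qed
qed

text \<open>In terms of a frame orthonormal for the induced metric, minimality says that the trace of the
  second derivative is tangent to the image.\<close>

definition minimal_at :: "('a::euclidean_space \<Rightarrow> 'f::euclidean_space) \<Rightarrow> 'a \<Rightarrow> bool" where
  "minimal_at F y \<longleftrightarrow>
     (\<forall>P :: 'a \<Rightarrow> 'a. linear P \<longrightarrow> (\<forall>e. norm (frechet_derivative F (at y) (P e)) = norm e) \<longrightarrow>
        (\<Sum>e\<in>Basis. frechet_derivative (\<lambda>z. frechet_derivative F (at z) (P e)) (at y) (P e))
          \<in> range (frechet_derivative F (at y)))"

lemma frechet_derivative_inner:
  assumes "F differentiable (at x)"
  shows "frechet_derivative (\<lambda>x. l \<bullet> F x) (at x) = (\<lambda>w. l \<bullet> frechet_derivative F (at x) w)"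
proof -
  have "(F has_derivative frechet_derivative F (at x)) (at x)"
    using assms by (simp add: frechet_derivative_works)
  then have "((\<lambda>x. l \<bullet> F x) has_derivative (\<lambda>w. l \<bullet> frechet_derivative F (at x) w)) (at x)"
    by (rule has_derivative_inner_right)
  then show ?thesis by (rule frechet_derivative_at[symmetric])
qed

text \<open>At an interior maximum of the perturbed coordinate the gradient condition expresses
  \<open>l\<close> on tangent vectors through z = y - q, and the second-order condition is summed
  over an orthonormal frame. Minimality makes the trace of the second derivative tangent, so the
  gradient condition evaluates it; then \<epsilon> cancels. What remains bounds \<alpha> by
  quantities depending on neither \<epsilon> nor \<alpha>, because \<kappa> = 1 + 2 \<alpha> s(y)
  lies between 0 and 2.\<close>

lemma barrier_estimate:
  fixes F :: "'a::euclidean_space \<Rightarrow> 'f::euclidean_space" and l :: 'f and q :: 'a and R \<alpha> \<epsilon> c C Q :: real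
  defines "s \<equiv> \<lambda>x. R\<^sup>2 - (x - q) \<bullet> (x - q)"
  assumes U: "open U" "y \<in> U" and F: "C_on 2 U F" and inj: "inj (frechet_derivative F (at y))"
    and min: "minimal_at F y"
    and c: "c > 0" "\<And>v. c * norm v \<le> norm (frechet_derivative F (at y) v)"
    and C: "C > 0" "\<And>v. norm (frechet_derivative F (at y) v) \<le> C * norm v"
    and Q: "Q > 0" "\<And>v. norm (frechet_derivative (\<lambda>z. frechet_derivative F (at z) v) (at y) v) \<le> Q * (norm v)\<^sup>2"
    and \<epsilon>: "\<epsilon> > 0" and s: "0 \<le> 1 + 2 * \<alpha> * s y" "1 + 2 * \<alpha> * s y \<le> 2" and \<alpha>: "\<alpha> \<ge> 0"
    and max: "\<And>x. x \<in> U \<Longrightarrow> l \<bullet> F x + \<epsilon> * (s x + \<alpha> * (s x)\<^sup>2) \<le> l \<bullet> F y + \<epsilon> * (s y + \<alpha> * (s y)\<^sup>2)"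
  shows "4 * \<alpha> * ((norm (y - q))\<^sup>2 / C\<^sup>2) \<le>
    2 * (DIM('a) / c\<^sup>2 + norm (y - q) * (DIM('a) * Q / c ^ 3))"
proof -
  let ?D = "frechet_derivative F (at y)"
  let ?D2 = "\<lambda>w. frechet_derivative (\<lambda>z. frechet_derivative F (at z) w) (at y) w"
  define \<kappa> where "\<kappa> = 1 + 2 * \<alpha> * s y"
  define z where "z = y - q"
  have diff: "F differentiable (at x)" if "x \<in> U" for x
    using F that by (simp add: numeral_2_eq_2)
  have diff2: "(\<lambda>x. frechet_derivative F (at x) w) differentiable (at y)" for w
    using F U(2) by (simp add: numeral_2_eq_2)
  have lin: "linear ?D" by (rule linear_frechet_derivative[OF diff[OF U(2)]])
  have u: "C_on 2 U (\<lambda>x. l \<bullet> F x)"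
    by (rule C_on_bounded_linear_compose[OF U(1) bounded_linear_inner_right F])
  define h where "h x = \<epsilon> * (s x + \<alpha> * (s x)\<^sup>2)" for x
  define h' where "h' x w = \<epsilon> * ((1 + 2 * \<alpha> * s x) * (- 2 * ((x - q) \<bullet> w)))" for x w
  \<comment> \<open>Second derivative of the barrier along \<open>w\<close>: the favourable term
    with factor 8 \<alpha> comes from the square of the first derivative of s, the other one from
    its constant second derivative.\<close>
  define h'' where "h'' w = \<epsilon> * (8 * \<alpha> * (z \<bullet> w)\<^sup>2 - 2 * \<kappa> * (w \<bullet> w))" for w
  have ds: "(s has_derivative (\<lambda>w. - 2 * ((x - q) \<bullet> w))) (at x)" for x
    unfolding s_def by (auto intro!: derivative_eq_intros simp: inner_commute)
  have dh: "(h has_derivative h' x) (at x)" for x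
    unfolding h_def h'_def
    by (rule derivative_eq_intros refl ds | simp add: algebra_simps)+
  have dh2: "((\<lambda>t. h' (y + t *\<^sub>R w) w) has_real_derivative h'' w) (at 0)" for w
  proof -
    have "h' (y + t *\<^sub>R w) w = \<epsilon> * ((1 + 2 * \<alpha> * (R\<^sup>2 - (z \<bullet> z + 2 * t * (z \<bullet> w) + t\<^sup>2 * (w \<bullet> w))))
        * (- 2 * (z \<bullet> w + t * (w \<bullet> w))))" for t
    proof -
      have "y + t *\<^sub>R w - q = z + t *\<^sub>R w" by (simp add: z_def)
      then show ?thesis
        unfolding h'_def s_def
        by (simp add: inner_add_left inner_add_right inner_commute power2_eq_square algebra_simps)
    qed
    moreover have "((\<lambda>t. \<epsilon> * ((1 + 2 * \<alpha> * (R\<^sup>2 - (z \<bullet> z + 2 * t * (z \<bullet> w) + t\<^sup>2 * (w \<bullet> w))))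
        * (- 2 * (z \<bullet> w + t * (w \<bullet> w))))) has_real_derivative h'' w) (at 0)"
      unfolding h''_def \<kappa>_def s_def z_def
      by (auto intro!: derivative_eq_intros simp: power2_eq_square algebra_simps)
    ultimately show ?thesis by simp
  qed
  have fu: "frechet_derivative (\<lambda>x. l \<bullet> F x) (at x) w = l \<bullet> frechet_derivative F (at x) w" if "x \<in> U" for x w
    by (simp add: frechet_derivative_inner[OF diff[OF that]])
  have fu2: "frechet_derivative (\<lambda>x. frechet_derivative (\<lambda>x. l \<bullet> F x) (at x) w) (at y) w = l \<bullet> ?D2 w" for w
  proof -
    have "frechet_derivative (\<lambda>x. frechet_derivative (\<lambda>x. l \<bullet> F x) (at x) w) (at y) =
        frechet_derivative (\<lambda>x. l \<bullet> frechet_derivative F (at x) w) (at y)"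
      by (rule frechet_derivative_cong_open[OF U]) (simp add: fu)
    then show ?thesis by (simp add: frechet_derivative_inner[OF diff2])
  qed
  have max': "l \<bullet> F x + h x \<le> l \<bullet> F y + h y" if "x \<in> U" for x
    using max[OF that] by (simp add: h_def)
  have g1: "l \<bullet> ?D w = 2 * \<epsilon> * \<kappa> * (z \<bullet> w)" for w
    using second_derivative_test(1)[OF U u dh dh2 max', of w] fu[OF U(2)]
    by (simp add: h'_def \<kappa>_def z_def)
  have g2: "l \<bullet> ?D2 w + h'' w \<le> 0" for w
    using second_derivative_test(2)[OF U u dh dh2 max', of w] by (simp add: fu2)
  obtain P :: "'a \<Rightarrow> 'a" where P: "linear P" "\<And>e. norm (?D (P e)) = norm e"
    by (rule isometric_frame[OF lin inj]) (rule that)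
  \<comment> \<open>Minimality is used here: the traced second derivative is the image of a
    parameter vector \<beta>, to which the gradient condition \<open>g1\<close> applies.\<close>
  obtain \<beta> where \<beta>: "(\<Sum>e\<in>Basis. ?D2 (P e)) = ?D \<beta>"
    using min P unfolding minimal_at_def by blast
  have Pe: "norm (P e) \<le> 1 / c" if "e \<in> Basis" for e
    using c(2)[of "P e"] P(2)[of e] that c(1) by (simp add: field_simps)
  have Pe2: "(norm (P e))\<^sup>2 \<le> 1 / c\<^sup>2" if "e \<in> Basis" for e
    using power_mono[OF Pe[OF that] norm_ge_zero, of 2] by (simp add: power_divide)
  have nb: "norm \<beta> \<le> DIM('a) * Q / c ^ 3"
  proof -
    have "c * norm \<beta> \<le> norm (\<Sum>e\<in>Basis. ?D2 (P e))" using c(2)[of \<beta>] \<beta> by simp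
    also have "\<dots> \<le> (\<Sum>e\<in>(Basis::'a set). Q * (1 / c\<^sup>2))"
    proof (rule order_trans[OF norm_sum], rule sum_mono)
      fix e :: 'a assume "e \<in> Basis"
      then show "norm (?D2 (P e)) \<le> Q * (1 / c\<^sup>2)"
        using Q(2)[of "P e"] mult_left_mono[OF Pe2, of e Q] Q(1) by linarith
    qed
    finally show ?thesis using c(1) by (simp add: field_simps power3_eq_cube power2_eq_square)
  qed
  define T where "T = (\<Sum>e\<in>(Basis::'a set). (z \<bullet> P e) *\<^sub>R e)"
  have Te: "T \<bullet> e = z \<bullet> P e" if "e \<in> Basis" for e
    using that unfolding T_def by (simp add: inner_sum_left inner_Basis if_distrib cong: if_cong)
  have TT: "T \<bullet> T = (\<Sum>e\<in>Basis. (z \<bullet> P e)\<^sup>2)"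
    unfolding euclidean_inner[of T T] by (simp add: Te power2_eq_square)
  \<comment> \<open>\<open>T\<close> is the adjoint of \<open>P\<close> applied to z. Writing z = P
    x, the isometry property gives |x| at most C |z|, and |z| squared equals the inner product of x
    and \<open>T\<close>; Cauchy-Schwarz then bounds \<open>T\<close> from below.\<close>
  have lower: "(norm z)\<^sup>2 / C\<^sup>2 \<le> (\<Sum>e\<in>Basis. (z \<bullet> P e)\<^sup>2)"
  proof -
    have "inj P"
    proof (rule injI)
      fix a b assume "P a = P b"
      then have "norm (?D (P (a - b))) = 0" by (simp add: linear_diff[OF P(1)] linear_0[OF lin])
      then show "a = b" using P(2) by simp
    qed
    then obtain x where x: "z = P x" using linear_inj_imp_surj[OF P(1)] by (metis surjD)
    have nx: "norm x \<le> C * norm z" using C(2)[of z] P(2)[of x] x by simp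
    have "(norm z)\<^sup>2 = z \<bullet> P (\<Sum>e\<in>Basis. (x \<bullet> e) *\<^sub>R e)"
      by (simp add: euclidean_representation x power2_norm_eq_inner)
    also have "\<dots> = x \<bullet> T"
      by (simp add: linear_sum[OF P(1)] linear_scale[OF P(1)] inner_sum_right T_def mult.commute)
    also have "\<dots> \<le> norm x * norm T" by (rule norm_cauchy_schwarz)
    also have "\<dots> \<le> (C * norm z) * norm T" using nx by (intro mult_right_mono) auto
    finally have "norm z * norm z \<le> norm z * (C * norm T)" by (simp add: power2_eq_square mult_ac)
    then have "norm z \<le> C * norm T"
      using C(1) by (cases "norm z = 0") auto
    then have "(norm z)\<^sup>2 \<le> C\<^sup>2 * (norm T)\<^sup>2"
      using power_mono[of "norm z" "C * norm T" 2] by (simp add: power_mult_distrib)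
    then show ?thesis using C(1) TT by (simp add: field_simps power2_norm_eq_inner)
  qed
  have "l \<bullet> ?D \<beta> + (\<Sum>e\<in>Basis. h'' (P e)) \<le> 0"
    unfolding \<beta>[symmetric] inner_sum_right sum.distrib[symmetric] using g2 by (intro sum_nonpos) auto
  moreover have "(\<Sum>e\<in>Basis. h'' (P e)) =
      \<epsilon> * (8 * \<alpha> * (\<Sum>e\<in>Basis. (z \<bullet> P e)\<^sup>2) - 2 * \<kappa> * (\<Sum>e\<in>Basis. (norm (P e))\<^sup>2))"
    unfolding h''_def by (simp add: sum_distrib_left sum_subtractf power2_norm_eq_inner right_diff_distrib)
  ultimately have "\<epsilon> * (2 * \<kappa> * (z \<bullet> \<beta>) + (8 * \<alpha> * (\<Sum>e\<in>Basis. (z \<bullet> P e)\<^sup>2) - 2 * \<kappa> * (\<Sum>e\<in>Basis. (norm (P e))\<^sup>2))) \<le> 0"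
    by (simp add: g1 algebra_simps)
  then have "2 * \<kappa> * (z \<bullet> \<beta>) + (8 * \<alpha> * (\<Sum>e\<in>Basis. (z \<bullet> P e)\<^sup>2) - 2 * \<kappa> * (\<Sum>e\<in>Basis. (norm (P e))\<^sup>2)) \<le> 0"
    using \<epsilon> by (simp add: mult_le_0_iff)
  then have "4 * \<alpha> * (\<Sum>e\<in>Basis. (z \<bullet> P e)\<^sup>2) \<le> \<kappa> * ((\<Sum>e\<in>Basis. (norm (P e))\<^sup>2) - z \<bullet> \<beta>)"
    by (simp add: algebra_simps)
  also have "\<dots> \<le> \<kappa> * (DIM('a) / c\<^sup>2 + norm z * (DIM('a) * Q / c ^ 3))"
  proof (rule mult_left_mono)
    have "(\<Sum>e\<in>(Basis::'a set). (norm (P e))\<^sup>2) \<le> (\<Sum>e\<in>(Basis::'a set). 1 / c\<^sup>2)"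
      by (intro sum_mono Pe2)
    moreover have "- (z \<bullet> \<beta>) \<le> norm z * norm \<beta>"
      using norm_cauchy_schwarz[of "- z" \<beta>] by simp
    moreover have "norm z * norm \<beta> \<le> norm z * (DIM('a) * Q / c ^ 3)"
      by (intro mult_left_mono nb) auto
    ultimately show "(\<Sum>e\<in>Basis. (norm (P e))\<^sup>2) - z \<bullet> \<beta> \<le> DIM('a) / c\<^sup>2 + norm z * (DIM('a) * Q / c ^ 3)"
      by simp
  qed (use s in \<open>simp add: \<kappa>_def\<close>)
  also have "\<dots> \<le> 2 * (DIM('a) / c\<^sup>2 + norm z * (DIM('a) * Q / c ^ 3))"
    using s(2) c(1) Q(1) by (intro mult_right_mono) (auto simp: \<kappa>_def)
  finally have "4 * \<alpha> * (\<Sum>e\<in>Basis. (z \<bullet> P e)\<^sup>2) \<le> 2 * (DIM('a) / c\<^sup>2 + norm z * (DIM('a) * Q / c ^ 3))" .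
  moreover have "4 * \<alpha> * ((norm z)\<^sup>2 / C\<^sup>2) \<le> 4 * \<alpha> * (\<Sum>e\<in>Basis. (z \<bullet> P e)\<^sup>2)"
    using lower \<alpha> by (intro mult_left_mono) auto
  ultimately show ?thesis by (simp add: z_def)
qed

lemma linear_expand:
  assumes "linear (T :: 'a::euclidean_space \<Rightarrow> 'f::real_vector)"
  shows "T v = (\<Sum>b\<in>Basis. (v \<bullet> b) *\<^sub>R T b)"
proof -
  have "T v = T (\<Sum>b\<in>Basis. (v \<bullet> b) *\<^sub>R b)" by (simp only: euclidean_representation)
  then show ?thesis by (simp only: linear_sum[OF assms] linear_scale[OF assms])
qed

lemma norm_linear_le:
  assumes "linear (T :: 'a::euclidean_space \<Rightarrow> 'f::real_normed_vector)"
  shows "norm (T v) \<le> (\<Sum>b\<in>Basis. norm (T b)) * norm v"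
proof -
  have "norm (T v) \<le> (\<Sum>b\<in>Basis. norm ((v \<bullet> b) *\<^sub>R T b))"
    unfolding linear_expand[OF assms, of v] by (rule norm_sum)
  also have "\<dots> \<le> (\<Sum>b\<in>(Basis::'a set). norm v * norm (T b))"
    by (intro sum_mono) (auto intro!: mult_right_mono Basis_le_norm)
  finally show ?thesis by (simp add: sum_distrib_left mult.commute)
qed

text \<open>Linearity of the first derivative in \<open>v\<close> holds at each point separately, so
  the expansion must be made on a neighbourhood before differentiating again. It reduces bounds on
  second derivatives to finitely many basis directions.\<close>

lemma second_frechet_derivative_expand:
  fixes F :: "'a::euclidean_space \<Rightarrow> 'f::euclidean_space"
  assumes U: "open U" "y \<in> U" and F: "C_on 2 U F"
  shows "frechet_derivative (\<lambda>z. frechet_derivative F (at z) v) (at y) w =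
    (\<Sum>b\<in>Basis. (v \<bullet> b) *\<^sub>R frechet_derivative (\<lambda>z. frechet_derivative F (at z) b) (at y) w)"
proof -
  have diff: "F differentiable (at x)" if "x \<in> U" for x
    using F that by (simp add: numeral_2_eq_2)
  have diff2: "(\<lambda>x. frechet_derivative F (at x) b) differentiable (at y)" for b
    using F U(2) by (simp add: numeral_2_eq_2)
  have "frechet_derivative (\<lambda>z. frechet_derivative F (at z) v) (at y) =
      frechet_derivative (\<lambda>z. \<Sum>b\<in>Basis. (v \<bullet> b) *\<^sub>R frechet_derivative F (at z) b) (at y)"
    by (rule frechet_derivative_cong_open[OF U])
      (rule linear_expand[OF linear_frechet_derivative[OF diff]])
  moreover have "((\<lambda>z. \<Sum>b\<in>Basis. (v \<bullet> b) *\<^sub>R frechet_derivative F (at z) b) has_derivative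
      (\<lambda>w. \<Sum>b\<in>Basis. (v \<bullet> b) *\<^sub>R frechet_derivative (\<lambda>z. frechet_derivative F (at z) b) (at y) w)) (at y)"
    using diff2 by (intro has_derivative_sum has_derivative_scaleR_right)
      (simp add: frechet_derivative_works)
  ultimately show ?thesis
    by (simp add: frechet_derivative_at[symmetric])
qed

lemma derivative_bounds:
  fixes F :: "'a::euclidean_space \<Rightarrow> 'f::euclidean_space"
  assumes U: "open U" and F: "C_on 2 U F" and inj: "\<And>y. y \<in> U \<Longrightarrow> inj (frechet_derivative F (at y))"
    and K: "compact K" "K \<subseteq> U" "K \<noteq> {}"
  obtains c C Q where "c > 0" "C > 0" "Q > 0"
    "\<And>y v. y \<in> K \<Longrightarrow> c * norm v \<le> norm (frechet_derivative F (at y) v)"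
    "\<And>y v. y \<in> K \<Longrightarrow> norm (frechet_derivative F (at y) v) \<le> C * norm v"
    "\<And>y v. y \<in> K \<Longrightarrow>
       norm (frechet_derivative (\<lambda>z. frechet_derivative F (at z) v) (at y) v) \<le> Q * (norm v)\<^sup>2"
proof -
  let ?D = "\<lambda>y. frechet_derivative F (at y)"
  let ?D2 = "\<lambda>b y. frechet_derivative (\<lambda>z. frechet_derivative F (at z) b) (at y)"
  have diff: "F differentiable (at x)" if "x \<in> U" for x
    using F that by (simp add: numeral_2_eq_2)
  have diff2: "(\<lambda>x. ?D x b) differentiable (at y)" if "y \<in> U" for b y
    using F that by (simp add: numeral_2_eq_2)
  have lin: "linear (?D y)" if "y \<in> U" for y by (rule linear_frechet_derivative[OF diff[OF that]])
  have lin2: "linear (?D2 b y)" if "y \<in> U" for y b by (rule linear_frechet_derivative[OF diff2[OF that]])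
  have cD: "continuous_on U (\<lambda>y. ?D y b)" for b
    using C_on_SucD[of 1 U F] F C_on_continuous[of 1 U "\<lambda>y. ?D y b"] by (simp add: numeral_2_eq_2)
  have cD2: "continuous_on U (\<lambda>y. ?D2 b y a)" for a b
    using F by (simp add: numeral_2_eq_2)
  have bound: "\<exists>M>0. \<forall>y\<in>K. g y \<le> M" if g: "continuous_on K g" for g :: "'a \<Rightarrow> real"
  proof -
    obtain M where "\<forall>y\<in>K. norm (g y) \<le> M"
      using compact_imp_bounded[OF compact_continuous_image[OF g K(1)]] by (auto simp: bounded_iff)
    then have "\<forall>y\<in>K. g y \<le> \<bar>M\<bar> + 1" by fastforce
    then show ?thesis by (intro exI[of _ "\<bar>M\<bar> + 1"]) auto
  qed
  have "continuous_on K (\<lambda>y. \<Sum>b\<in>Basis. norm (?D y b))"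
    by (intro continuous_intros continuous_on_subset[OF cD K(2)])
  from bound[OF this] obtain C where C: "C > 0" "\<And>y. y \<in> K \<Longrightarrow> (\<Sum>b\<in>Basis. norm (?D y b)) \<le> C"
    by blast
  have "continuous_on K (\<lambda>y. \<Sum>b\<in>Basis. \<Sum>a\<in>Basis. norm (?D2 b y a))"
    by (intro continuous_intros continuous_on_subset[OF cD2 K(2)])
  from bound[OF this] obtain Q where
    Q: "Q > 0" "\<And>y. y \<in> K \<Longrightarrow> (\<Sum>b\<in>Basis. \<Sum>a\<in>Basis. norm (?D2 b y a)) \<le> Q"
    by blast
  obtain c where c: "c > 0" "\<And>y v. y \<in> K \<Longrightarrow> norm v = 1 \<Longrightarrow> c \<le> norm (?D y v)"
  proof -
    let ?S = "K \<times> sphere (0::'a) 1"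
    \<comment> \<open>Continuity of the derivative is known only for fixed directions. The expansion
      in \<open>Basis\<close> makes its norm jointly continuous in point and direction, so it has a
      minimum on the compact set, positive by injectivity.\<close>
    let ?g = "\<lambda>z. norm (\<Sum>b\<in>Basis. (snd z \<bullet> b) *\<^sub>R ?D (fst z) b)"
    have "compact ?S" "?S \<noteq> {}" using K by (auto intro: compact_Times)
    moreover have "continuous_on ?S ?g"
      by (intro continuous_intros continuous_on_compose2[OF continuous_on_subset[OF cD K(2)]]) auto
    ultimately have "\<exists>z\<in>?S. \<forall>x\<in>?S. ?g z \<le> ?g x" by (rule continuous_attains_inf)
    then obtain z where z: "z \<in> ?S" "\<And>x. x \<in> ?S \<Longrightarrow> ?g z \<le> ?g x" by blast
    have g: "?g (y, v) = norm (?D y v)" if "y \<in> K" for y v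
      using linear_expand[OF lin, of y v] that K(2) by auto
    show thesis
    proof
      have "snd z \<noteq> 0" using z(1) by auto
      then have "?D (fst z) (snd z) \<noteq> 0"
        using inj[of "fst z"] linear_0[OF lin, of "fst z"] z(1) K(2) by (auto simp: inj_def)
      then show "?g z > 0" using g[of "fst z" "snd z"] z(1) by auto
      show "?g z \<le> norm (?D y v)" if "y \<in> K" "norm v = 1" for y v
        using z(2)[of "(y, v)"] g[of y v] that by auto
    qed
  qed
  show thesis
  proof (rule that[OF c(1) C(1) Q(1)])
    fix y v assume y: "y \<in> K"
    then have yU: "y \<in> U" using K(2) by auto
    show "norm (?D y v) \<le> C * norm v"
      using norm_linear_le[OF lin[OF yU], of v] mult_right_mono[OF C(2)[OF y], of "norm v"] by simp
    show "c * norm v \<le> norm (?D y v)"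
    proof (cases "v = 0")
      case False
      then have "c \<le> norm (?D y (v /\<^sub>R norm v))" using c(2)[OF y, of "v /\<^sub>R norm v"] by simp
      then show ?thesis using False by (simp add: linear_scale[OF lin[OF yU]] field_simps)
    qed simp
    have "norm (?D2 v y v) \<le> (\<Sum>b\<in>Basis. norm ((v \<bullet> b) *\<^sub>R ?D2 b y v))"
      unfolding second_frechet_derivative_expand[OF U yU F, of v v] by (rule norm_sum)
    also have "\<dots> \<le> (\<Sum>b\<in>Basis. norm v * ((\<Sum>a\<in>Basis. norm (?D2 b y a)) * norm v))"
      unfolding norm_scaleR
      by (intro sum_mono mult_mono norm_linear_le[OF lin2[OF yU]]) (auto simp: Basis_le_norm)
    also have "\<dots> = (\<Sum>b\<in>Basis. \<Sum>a\<in>Basis. norm (?D2 b y a)) * (norm v)\<^sup>2"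
      by (simp add: sum_distrib_left sum_distrib_right power2_eq_square mult_ac)
    also have "\<dots> \<le> Q * (norm v)\<^sup>2" using Q(2)[OF y] by (intro mult_right_mono) auto
    finally show "norm (?D2 v y v) \<le> Q * (norm v)\<^sup>2" .
  qed
qed

text \<open>Hopf's argument: if the set where the maximum is attained were not a neighbourhood of \<open>y0\<close>, a
  ball in its complement would touch it at a single point \<open>p\<close>, and adding a small multiple of a
  barrier \<open>s + \<alpha> s\<^sup>2\<close> with \<open>s = R\<^sup>2 - \<bar>x - q\<bar>\<^sup>2\<close> would create an interior maximum near \<open>p\<close>, which
  the barrier estimate forbids for large \<open>\<alpha>\<close>.\<close>

theorem strong_maximum_principle:
  fixes F :: "'a::euclidean_space \<Rightarrow> 'f::euclidean_space"
  assumes U: "open U" "y0 \<in> U" and F: "C_on 2 U F"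
    and inj: "\<And>y. y \<in> U \<Longrightarrow> inj (frechet_derivative F (at y))"
    and min: "\<And>y. y \<in> U \<Longrightarrow> minimal_at F y"
    and max: "\<And>y. y \<in> U \<Longrightarrow> l \<bullet> F y \<le> l \<bullet> F y0"
  obtains r where "r > 0" "ball y0 r \<subseteq> U" "\<And>y. y \<in> ball y0 r \<Longrightarrow> l \<bullet> F y = l \<bullet> F y0"
proof -
  define M where "M = l \<bullet> F y0"
  have cF: "continuous_on U F" by (rule C_on_continuous[OF F])
  \<comment> \<open>The factor 2 leaves room for the contact point: it is no farther from
    \<open>y\<close> than \<open>y0\<close> is, hence at distance less than 2 r from
    \<open>y0\<close>.\<close>
  obtain r where r: "r > 0" "cball y0 (2 * r) \<subseteq> U"
  proof -
    obtain e where "e > 0" "cball y0 e \<subseteq> U" using U open_contains_cball by blast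
    then show thesis using that[of "e / 2"] by simp
  qed
  have "l \<bullet> F y = M" if q0: "y \<in> ball y0 r" for y
  proof (rule ccontr)
    assume ne: "l \<bullet> F y \<noteq> M"
    let ?K = "cball y0 (2 * r)"
    define S where "S = {x \<in> ?K. l \<bullet> F x = M}"
    have cl: "continuous_on ?K (\<lambda>x. l \<bullet> F x)"
      by (intro continuous_intros continuous_on_subset[OF cF r(2)])
    have "closed S" unfolding S_def
      using continuous_closed_preimage_constant[OF cl, of M] by simp
    moreover have y0S: "y0 \<in> S" using r by (simp add: S_def M_def)
    ultimately obtain p where p: "p \<in> S" "\<And>x. x \<in> S \<Longrightarrow> dist y p \<le> dist y x"
      using distance_attains_inf[of S y] by blast
    \<comment> \<open>The ball around \<open>y\<close> through \<open>p\<close> might touch the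
      maximum set at several points. The ball of half the radius centred at the midpoint touches it
      only at \<open>p\<close>.\<close>
    define q where "q = midpoint y p"
    define R where "R = dist y p / 2"
    have "y \<noteq> p" using ne p(1) by (auto simp: S_def)
    then have R: "R > 0" by (simp add: R_def)
    have dqp: "dist q p = R" and dyq: "dist y q = R"
      by (auto simp: q_def R_def dist_midpoint)
    have pr: "dist y0 p < 2 * r"
      using p(2)[OF y0S] q0 dist_triangle[of y0 p y] by (simp add: dist_commute)
    have touch: "x = p" if x: "x \<in> S" "dist q x \<le> R" for x
    proof (rule ccontr)
      assume xp: "x \<noteq> p"
      have "2 * R \<le> dist y x" using p(2)[OF x(1)] by (simp add: R_def)
      moreover have "dist y x \<le> dist y q + dist q x" by (rule dist_triangle)
      ultimately have e: "dist q x = R" "dist y x = 2 * R" using x(2) dyq by auto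
      \<comment> \<open>Equality holds in the triangle inequality for y, q, x, so x is the
        reflection of y in q, which is \<open>p\<close>.\<close>
      have "q - y = x - q"
      proof -
        have "norm (q - y) = R" "norm (x - q) = R" using dyq e(1) by (auto simp: dist_norm norm_minus_commute)
        moreover have "norm ((q - y) + (x - q)) = 2 * R" using e(2) by (simp add: dist_norm norm_minus_commute)
        ultimately have "norm ((q - y) + (x - q)) = norm (q - y) + norm (x - q)" by simp
        then have "norm (q - y) *\<^sub>R (x - q) = norm (x - q) *\<^sub>R (q - y)"
          by (rule norm_triangle_eq[THEN iffD1])
        then show ?thesis using \<open>norm (q - y) = R\<close> \<open>norm (x - q) = R\<close> R by simp
      qed
      moreover have "q + q = y + p" by (simp add: q_def midpoint_def flip: scaleR_add_left)
      then have "p = q + q - y" by simp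
      then have "q - y = p - q" by simp
      ultimately show False using xp by simp
    qed
    obtain c C Q where b: "c > 0" "C > 0" "Q > 0"
      "\<And>y v. y \<in> ?K \<Longrightarrow> c * norm v \<le> norm (frechet_derivative F (at y) v)"
      "\<And>y v. y \<in> ?K \<Longrightarrow> norm (frechet_derivative F (at y) v) \<le> C * norm v"
      "\<And>y v. y \<in> ?K \<Longrightarrow>
         norm (frechet_derivative (\<lambda>z. frechet_derivative F (at z) v) (at y) v) \<le> Q * (norm v)\<^sup>2"
      using derivative_bounds[OF U(1) F inj compact_cball r(2)] r(1) by auto
    \<comment> \<open>Right-hand side of the barrier estimate for points at distance at most 3 R / 2
      from \<open>q\<close>. The choice of \<alpha> makes its left-hand side at distance R / 2 equal
      to ?B + 1, which the estimate excludes.\<close>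
    let ?B = "2 * (DIM('a) / c\<^sup>2 + (3 * R / 2) * (DIM('a) * Q / c ^ 3))"
    define \<alpha> where "\<alpha> = C\<^sup>2 / R\<^sup>2 * (?B + 1)"
    have Bpos: "?B \<ge> 0" using b R by (intro mult_nonneg_nonneg add_nonneg_nonneg) auto
    have \<alpha>: "\<alpha> > 0" using Bpos b(2) R unfolding \<alpha>_def by (intro mult_pos_pos add_nonneg_pos) auto
    \<comment> \<open>The bound R / 2 keeps distances to \<open>q\<close> between R / 2 and 3 R / 2;
      the bound 1 / (6 \<alpha> R) gives 2 \<alpha> |s| at most 5/6, so the barrier has the sign of
      s; the last bound keeps the ball inside \<open>?K\<close>.\<close>
    define \<delta> where "\<delta> = min (R / 2) (min (1 / (6 * \<alpha> * R)) ((2 * r - dist y0 p) / 2))"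
    have \<delta>: "\<delta> > 0" "\<delta> \<le> R / 2" "\<delta> \<le> 1 / (6 * \<alpha> * R)" "\<delta> < 2 * r - dist y0 p"
    proof -
      have "\<delta> \<le> (2 * r - dist y0 p) / 2" unfolding \<delta>_def by (simp only: min.coboundedI2 min.cobounded2)
      then show "\<delta> < 2 * r - dist y0 p" using pr by argo
      show "\<delta> > 0" using R \<alpha> pr by (simp add: \<delta>_def)
      show "\<delta> \<le> R / 2" "\<delta> \<le> 1 / (6 * \<alpha> * R)"
        unfolding \<delta>_def by (simp_all only: min.coboundedI2 min.cobounded1 min.cobounded2)
    qed
    have sub: "cball p \<delta> \<subseteq> ?K"
    proof
      fix x assume "x \<in> cball p \<delta>"
      then show "x \<in> ?K" using dist_triangle[of y0 x p] \<delta>(4) by auto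
    qed
    define s where "s x = R\<^sup>2 - (x - q) \<bullet> (x - q)" for x
    have s: "s x = (R - dist q x) * (R + dist q x)" for x
      by (simp add: s_def dist_norm norm_minus_commute power2_norm_eq_inner[symmetric] power2_eq_square algebra_simps)
    have near: "R / 2 \<le> dist q x" "dist q x \<le> 3 * R / 2" "\<bar>2 * \<alpha> * s x\<bar> \<le> 1" if "x \<in> cball p \<delta>" for x
    proof -
      have d: "\<bar>R - dist q x\<bar> \<le> \<delta>"
        using that dist_triangle[of q x p] dist_triangle[of q p x] dqp by (auto simp: dist_commute)
      then show 1: "R / 2 \<le> dist q x" "dist q x \<le> 3 * R / 2" using \<delta>(2) by auto
      have "\<bar>s x\<bar> \<le> \<delta> * (5 * R / 2)"
        unfolding s abs_mult using d 1 R by (intro mult_mono) auto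
      also have "\<dots> \<le> 1 / (6 * \<alpha> * R) * (5 * R / 2)" using \<delta>(3) R by (intro mult_right_mono) auto
      finally have "2 * \<alpha> * \<bar>s x\<bar> \<le> 2 * \<alpha> * (1 / (6 * \<alpha> * R) * (5 * R / 2))" using \<alpha> by (intro mult_left_mono) auto
      also have "\<dots> = 5 / 6" using \<alpha> R by (simp add: field_simps)
      finally show "\<bar>2 * \<alpha> * s x\<bar> \<le> 1" using \<alpha> by (simp add: abs_mult)
    qed
    define h where "h x = s x + \<alpha> * (s x)\<^sup>2" for x
    have h: "h x = s x * (1 + \<alpha> * s x)" for x by (simp add: h_def power2_eq_square algebra_simps)
    have hneg: "h x < 0" if "x \<in> cball p \<delta>" "dist q x > R" for x
    proof -
      have "s x < 0" unfolding s using that(2) R by (intro mult_neg_pos) auto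
      moreover have "1 + \<alpha> * s x > 0" using near(3)[OF that(1)] by (simp add: abs_le_iff)
      ultimately show ?thesis unfolding h by (rule mult_neg_pos)
    qed
    have hp: "h p = 0" by (simp add: h s dqp)
    have ch: "continuous_on A h" for A unfolding h_def s_def by (intro continuous_intros)
    have leM: "l \<bullet> F x \<le> M" if "x \<in> ?K" for x using max[of x] that r(2) by (auto simp: M_def)
    \<comment> \<open>On the part of the sphere inside the ball around \<open>q\<close> the
      coordinate stays below M by a uniform gap, since \<open>p\<close> is the only contact point,
      and small \<epsilon> respects the gap. On the rest the barrier is negative, so any positive
      \<epsilon> works.\<close>
    obtain \<epsilon> where \<epsilon>: "\<epsilon> > 0" "\<And>x. x \<in> sphere p \<delta> \<Longrightarrow> l \<bullet> F x + \<epsilon> * h x < M"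
    proof -
      let ?A = "sphere p \<delta> \<inter> cball q R"
      have A: "compact ?A" by (intro compact_Int) auto
      have Asub: "?A \<subseteq> ?K" using sub by auto
      have lt: "l \<bullet> F x < M" if "x \<in> ?A" for x
      proof -
        have "x \<notin> S" using touch[of x] that \<delta>(1) by auto
        then show ?thesis using leM[of x] that Asub by (auto simp: S_def)
      qed
      have "\<exists>\<epsilon>>0. \<forall>x\<in>?A. l \<bullet> F x + \<epsilon> * h x < M"
      proof (cases "?A = {}")
        case True then show ?thesis by (intro exI[of _ 1]) auto
      next
        case False
        obtain a where a: "a \<in> ?A" "\<And>x. x \<in> ?A \<Longrightarrow> l \<bullet> F x \<le> l \<bullet> F a"
          using continuous_attains_sup[OF A False continuous_on_subset[OF cl Asub]] by blast
        obtain d where d: "d \<in> ?A" "\<And>x. x \<in> ?A \<Longrightarrow> h x \<le> h d"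
          using continuous_attains_sup[OF A False ch] by blast
        define \<epsilon> where "\<epsilon> = (M - l \<bullet> F a) / (2 * (\<bar>h d\<bar> + 1))"
        have e: "\<epsilon> > 0" unfolding \<epsilon>_def using lt[OF a(1)] by (intro divide_pos_pos) auto
        have "l \<bullet> F x + \<epsilon> * h x < M" if x: "x \<in> ?A" for x
        proof -
          have "\<epsilon> * h x \<le> \<epsilon> * (\<bar>h d\<bar> + 1)" using d(2)[OF x] e by (intro mult_left_mono) auto
          also have "\<dots> = (M - l \<bullet> F a) / 2" by (simp add: \<epsilon>_def field_simps)
          finally show ?thesis using a(2)[OF x] lt[OF a(1)] by argo
        qed
        then show ?thesis using e by blast
      qed
      then obtain \<epsilon> where e: "\<epsilon> > 0" "\<forall>x\<in>?A. l \<bullet> F x + \<epsilon> * h x < M" by blast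
      show thesis
      proof (rule that[OF e(1)])
        fix x assume x: "x \<in> sphere p \<delta>"
        show "l \<bullet> F x + \<epsilon> * h x < M"
        proof (cases "dist q x \<le> R")
          case True then show ?thesis using e(2) x by auto
        next
          case False
          then have "\<epsilon> * h x < 0" using hneg[of x] x e(1) by (simp add: mult_pos_neg)
          then show ?thesis using leM[of x] x sub by (auto simp: subset_iff)
        qed
      qed
    qed
    have "continuous_on (cball p \<delta>) (\<lambda>x. l \<bullet> F x + \<epsilon> * h x)"
      by (intro continuous_intros continuous_on_subset[OF cF] ch) (use sub r(2) in auto)
    moreover have "cball p \<delta> \<noteq> {}" using \<delta>(1) by simp
    ultimately obtain y1 where y1: "y1 \<in> cball p \<delta>"
        "\<And>x. x \<in> cball p \<delta> \<Longrightarrow> l \<bullet> F x + \<epsilon> * h x \<le> l \<bullet> F y1 + \<epsilon> * h y1"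
      using continuous_attains_sup[OF compact_cball] by blast
    \<comment> \<open>The barrier vanishes at \<open>p\<close>, where the coordinate is M, so the
      maximum over the closed ball is at least M and cannot lie on the sphere.\<close>
    have "M \<le> l \<bullet> F y1 + \<epsilon> * h y1" using y1(2)[of p] \<delta>(1) p(1) hp by (simp add: S_def)
    then have y1b: "y1 \<in> ball p \<delta>" using \<epsilon>(2)[of y1] y1(1) by (cases "dist p y1 = \<delta>") auto
    have y1K: "y1 \<in> ?K" and y1U: "y1 \<in> U" using y1(1) sub r(2) by auto
    have n: "norm (y1 - q) = dist q y1" by (simp add: dist_norm norm_minus_commute)
    have "4 * \<alpha> * ((norm (y1 - q))\<^sup>2 / C\<^sup>2) \<le>
        2 * (DIM('a) / c\<^sup>2 + norm (y1 - q) * (DIM('a) * Q / c ^ 3))"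
    proof (rule barrier_estimate[where U = "ball p \<delta>" and F = F and l = l and R = R and \<epsilon> = \<epsilon>])
      show "C_on 2 (ball p \<delta>) F" by (rule C_on_subset[OF F]) (use sub r(2) ball_subset_cball in blast)
      show "l \<bullet> F x + \<epsilon> * (R\<^sup>2 - (x - q) \<bullet> (x - q) + \<alpha> * (R\<^sup>2 - (x - q) \<bullet> (x - q))\<^sup>2)
         \<le> l \<bullet> F y1 + \<epsilon> * (R\<^sup>2 - (y1 - q) \<bullet> (y1 - q) + \<alpha> * (R\<^sup>2 - (y1 - q) \<bullet> (y1 - q))\<^sup>2)"
        if "x \<in> ball p \<delta>" for x
        using y1(2)[of x] that by (simp add: h_def s_def)
      show "0 \<le> 1 + 2 * \<alpha> * (R\<^sup>2 - (y1 - q) \<bullet> (y1 - q))" "1 + 2 * \<alpha> * (R\<^sup>2 - (y1 - q) \<bullet> (y1 - q)) \<le> 2"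
        using near(3)[OF y1(1)] by (auto simp: s_def abs_le_iff)
    qed (use y1b b(1-3) b(4-6)[OF y1K] inj[OF y1U] min[OF y1U] \<epsilon>(1) \<alpha> in auto)
    also have "\<dots> \<le> ?B"
      using near(2)[OF y1(1)] b by (intro mult_left_mono add_left_mono mult_right_mono) (auto simp: n)
    finally have "4 * \<alpha> * ((norm (y1 - q))\<^sup>2 / C\<^sup>2) \<le> ?B" .
    moreover have "4 * \<alpha> * ((R / 2)\<^sup>2 / C\<^sup>2) \<le> 4 * \<alpha> * ((norm (y1 - q))\<^sup>2 / C\<^sup>2)"
      using near(1)[OF y1(1)] \<alpha> R by (intro mult_left_mono divide_right_mono power_mono) (auto simp: n)
    moreover have "4 * \<alpha> * ((R / 2)\<^sup>2 / C\<^sup>2) = ?B + 1"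
      using R b(2) unfolding \<alpha>_def by (simp add: power_divide)
    ultimately show False by linarith
  qed
  then have "\<And>y. y \<in> ball y0 r \<Longrightarrow> l \<bullet> F y = l \<bullet> F y0" unfolding M_def .
  moreover have "ball y0 r \<subseteq> U" using r by (auto simp: subset_iff)
  ultimately show thesis using that r(1) by blast
qed

section \<open>From vanishing mean curvature to the frame formulation of minimality\<close>

lemma sum_Basis_vec: "(\<Sum>e\<in>(Basis :: (real^'n) set). f e) = (\<Sum>i\<in>UNIV. f (axis i 1))"
proof (rule sum.reindex_cong[of "\<lambda>i. axis i 1"])
  show "inj (\<lambda>i. axis i 1 :: real^'n)" by (auto simp: inj_def axis_eq_axis)
  show "(Basis :: (real^'n) set) = range (\<lambda>i. axis i 1)" by (auto simp: Basis_vec_def)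
qed simp

lemma linear_expand_vec:
  assumes "linear (T :: real^'n \<Rightarrow> 'f::real_vector)"
  shows "T v = (\<Sum>i\<in>UNIV. v $ i *\<^sub>R T (axis i 1))"
  by (subst linear_expand[OF assms], subst sum_Basis_vec) (simp add: inner_axis)

lemma hyperplane_eq_range:
  fixes T :: "real^'n \<Rightarrow> real^'m"
  assumes "linear T" "inj T" "CARD('m) = CARD('n) + 1" "\<nu> \<noteq> 0" "\<And>u. T u \<bullet> \<nu> = 0"
  shows "range T = {w. \<nu> \<bullet> w = 0}"
proof (rule subspace_dim_equal)
  show "subspace (range T)" by (rule linear_subspace_image[OF assms(1) subspace_UNIV])
  show "subspace {w. \<nu> \<bullet> w = 0}" by (rule subspace_hyperplane)
  show "range T \<subseteq> {w. \<nu> \<bullet> w = 0}" using assms(5) by (auto simp: inner_commute)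
  have "dim (range T) = CARD('n)"
    using dim_image_eq[OF assms(1), of UNIV] assms(2) by simp
  then show "dim {w. \<nu> \<bullet> w = 0} \<le> dim (range T)"
    using dim_hyperplane[OF assms(4)] assms(3) by simp
qed

lemma normal_exists:
  fixes T :: "real^'n \<Rightarrow> real^'m"
  assumes "linear T" "CARD('m) = CARD('n) + 1"
  obtains \<nu> where "norm \<nu> = 1" "\<And>u. T u \<bullet> \<nu> = 0"
proof -
  have "dim (range T) < DIM(real^'m)"
    using dim_image_le[OF assms(1), of UNIV] assms(2) by simp
  then obtain x where x: "x \<noteq> 0" "\<And>y. y \<in> span (range T) \<Longrightarrow> orthogonal x y"
    using orthogonal_to_subspace_exists by blast
  show thesis
  proof
    show "norm (x /\<^sub>R norm x) = 1" using x(1) by simp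
    show "T u \<bullet> (x /\<^sub>R norm x) = 0" for u
      using x(2)[of "T u"] by (simp add: span_base orthogonal_def inner_commute)
  qed
qed

text \<open>For an orthonormal frame \<open>P\<close> with matrix P and Gram matrix G of the first
  fundamental form, P^T G P is the identity, so the inverse of G is P P^T. By cyclicity of the trace
  the mean curvature becomes the normal component of the summed second derivatives. As the normal
  space is a line, vanishing of that component means tangency.\<close>

lemma minimal_at_if_mean_curvature_zero:
  fixes F :: "real^'n \<Rightarrow> real^'m"
  assumes card: "CARD('m) = CARD('n) + 1" and U: "open U" "y \<in> U" and F: "C_on 2 U F"
    and inj: "inj (frechet_derivative F (at y))"
    and H: "\<And>\<nu>. unit_normal F y \<nu> \<Longrightarrow> mean_curvature F \<nu> y = 0"
  shows "minimal_at F y"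
  unfolding minimal_at_def
proof (intro allI impI)
  fix P :: "real^'n \<Rightarrow> real^'n"
  let ?D = "frechet_derivative F (at y)"
  let ?D2 = "\<lambda>v. frechet_derivative (\<lambda>z. frechet_derivative F (at z) v) (at y)"
  assume P: "linear P" and iso: "\<forall>e. norm (?D (P e)) = norm e"
  have "F differentiable (at y)" using F U(2) by (simp add: numeral_2_eq_2)
  then have lin: "linear ?D" by (rule linear_frechet_derivative)
  have "(\<lambda>x. frechet_derivative F (at x) v) differentiable (at y)" for v
    using F U(2) by (simp add: numeral_2_eq_2)
  then have lin2: "linear (?D2 v)" for v by (rule linear_frechet_derivative)
  obtain \<nu> where \<nu>: "norm \<nu> = 1" "\<And>u. ?D u \<bullet> \<nu> = 0" using normal_exists[OF lin card] by blast
  have iso2: "?D (P a) \<bullet> ?D (P b) = a \<bullet> b" for a b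
  proof -
    have "?D (P a) + ?D (P b) = ?D (P (a + b))"
      by (simp add: linear_add[OF P] linear_add[OF lin])
    then show ?thesis using iso by (simp add: dot_norm)
  qed
  define G where "G = (\<chi> i j. first_fundamental_form F y (axis i 1) (axis j 1))"
  define S where "S = (\<chi> i j. second_fundamental_form F \<nu> y (axis i 1) (axis j 1))"
  let ?P = "matrix P" and ?A = "transpose (matrix P)"
  have sand: "(?A ** (M ** ?P)) $ a $ b = (\<Sum>i\<in>UNIV. \<Sum>j\<in>UNIV. P (axis a 1) $ i * P (axis b 1) $ j * M $ i $ j)"
    for M :: "real^'n^'n" and a b
    by (simp add: matrix_matrix_mult_def transpose_def matrix_def sum_distrib_left mult_ac)
  have AGP: "?A ** (G ** ?P) = mat 1"
  proof -
    have "(?A ** (G ** ?P)) $ a $ b = ?D (P (axis a 1)) \<bullet> ?D (P (axis b 1))" for a b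
      unfolding sand linear_expand_vec[OF lin, of "P (axis a 1)"] linear_expand_vec[OF lin, of "P (axis b 1)"]
      by (simp add: G_def first_fundamental_form_def inner_sum_left inner_sum_right sum_distrib_left mult_ac)
        (rule sum.swap)
    then show ?thesis
      by (simp add: iso2 vec_eq_iff mat_def inner_axis) (simp add: axis_def)
  qed
  have "(G ** ?P) ** ?A = mat 1" using AGP matrix_left_right_inverse by blast
  then have GPA: "G ** (?P ** ?A) = mat 1" by (simp add: matrix_mul_assoc)
  then have "(?P ** ?A) ** G = mat 1" using matrix_left_right_inverse by blast
  then have "invertible G" using GPA unfolding invertible_def by blast
  then have "matrix_inv G = matrix_inv G ** (G ** (?P ** ?A))" by (simp add: GPA)
  also have "\<dots> = ?P ** ?A"
    by (simp add: matrix_mul_assoc matrix_inv_left[OF \<open>invertible G\<close>])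
  finally have inv: "matrix_inv G = ?P ** ?A" .
  have "unit_normal F y \<nu>" using \<nu> by (simp add: unit_normal_def)
  then have "0 = trace (matrix_inv G ** S)"
    using H unfolding mean_curvature_def G_def S_def by simp
  also have "\<dots> = trace (?A ** (S ** ?P))"
    unfolding inv by (subst matrix_mul_assoc[symmetric], subst trace_mul_sym) (simp add: matrix_mul_assoc)
  also have "\<dots> = (\<Sum>a\<in>UNIV. ?D2 (P (axis a 1)) (P (axis a 1)) \<bullet> \<nu>)"
    unfolding trace_def
  proof (rule sum.cong[OF refl])
    fix a :: 'n
    let ?v = "P (axis a 1)"
    have "?D2 ?v ?v = (\<Sum>j\<in>UNIV. ?v $ j *\<^sub>R ?D2 (axis j 1) ?v)"
      by (subst second_frechet_derivative_expand[OF U F], subst sum_Basis_vec) (simp add: inner_axis)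
    also have "\<dots> = (\<Sum>j\<in>UNIV. \<Sum>i\<in>UNIV. (?v $ i * ?v $ j) *\<^sub>R ?D2 (axis j 1) (axis i 1))"
      by (subst linear_expand_vec[OF lin2]) (simp add: scaleR_sum_right mult_ac)
    finally show "(?A ** (S ** ?P)) $ a $ a = ?D2 ?v ?v \<bullet> \<nu>"
      unfolding sand by (simp add: inner_sum_left S_def second_fundamental_form_def) (rule sum.swap)
  qed
  also have "\<dots> = (\<Sum>e\<in>Basis. ?D2 (P e) (P e)) \<bullet> \<nu>"
    by (simp add: sum_Basis_vec inner_sum_left)
  finally have "\<nu> \<bullet> (\<Sum>e\<in>Basis. ?D2 (P e) (P e)) = 0" by (simp add: inner_commute)
  moreover have "range ?D = {w. \<nu> \<bullet> w = 0}"
    by (rule hyperplane_eq_range[OF lin inj card]) (use \<nu> in auto)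
  ultimately show "(\<Sum>e\<in>Basis. ?D2 (P e) (P e)) \<in> range ?D" by simp
qed

section \<open>Local parametrisations of immersions into a torus\<close>

lemma chart_inverse_simps:
  assumes "is_chart X c"
  shows "inj_on (snd c) (fst c)"
    and "p \<in> fst c \<Longrightarrow> inv_into (fst c) (snd c) (snd c p) = p"
    and "y \<in> snd c ` fst c \<Longrightarrow> snd c (inv_into (fst c) (snd c) y) = y"
    and "y \<in> snd c ` fst c \<Longrightarrow> inv_into (fst c) (snd c) y \<in> fst c"
    and "fst c \<subseteq> topspace X"
proof -
  have o: "openin X (fst c)" using assms by (simp add: is_chart_def)
  then show s: "fst c \<subseteq> topspace X" by (rule openin_subset)
  then have t: "topspace (subtopology X (fst c)) = fst c" by auto
  show i: "inj_on (snd c) (fst c)"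
    using assms t homeomorphic_imp_injective_map[of "subtopology X (fst c)" _ "snd c"]
    unfolding is_chart_def by auto
  show "p \<in> fst c \<Longrightarrow> inv_into (fst c) (snd c) (snd c p) = p" using i by simp
  show "y \<in> snd c ` fst c \<Longrightarrow> snd c (inv_into (fst c) (snd c) y) = y" by (simp add: f_inv_into_f)
  show "y \<in> snd c ` fst c \<Longrightarrow> inv_into (fst c) (snd c) y \<in> fst c" by (simp add: inv_into_into)
qed

lemma open_chart_image:
  assumes c: "is_chart X c" and W: "openin X W" "W \<subseteq> fst c"
  shows "open (snd c ` W)"
proof -
  have o: "open (snd c ` fst c)" and h: "homeomorphic_map (subtopology X (fst c)) (top_of_set (snd c ` fst c)) (snd c)"
    using c by (auto simp: is_chart_def)
  have "openin (subtopology X (fst c)) W" using W by (auto simp: openin_subtopology intro: exI[of _ W])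
  then have "openin (top_of_set (snd c ` fst c)) (snd c ` W)"
    using homeomorphic_imp_open_map[OF h] by (simp add: open_map_def)
  then show ?thesis using o by (metis openin_open_eq)
qed

lemma continuous_chart:
  assumes "is_chart X c" shows "continuous_map (subtopology X (fst c)) euclidean (snd c)"
  using assms homeomorphic_imp_continuous_map unfolding is_chart_def
  by (metis continuous_map_in_subtopology)

lemma continuous_chart_inverse:
  assumes c: "is_chart X c"
  shows "continuous_map (top_of_set (snd c ` fst c)) X (inv_into (fst c) (snd c))"
  unfolding continuous_map_def
proof (intro conjI allI impI)
  show "inv_into (fst c) (snd c) \<in> topspace (top_of_set (snd c ` fst c)) \<rightarrow> topspace X"
    using chart_inverse_simps(4,5)[OF c] by auto
  fix W assume W: "openin X W"
  have "openin X (W \<inter> fst c)" using W c by (auto simp: is_chart_def)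
  then have "open (snd c ` (W \<inter> fst c))" by (rule open_chart_image[OF c]) auto
  moreover have "{y \<in> snd c ` fst c. inv_into (fst c) (snd c) y \<in> W} = snd c ` (W \<inter> fst c)"
    using chart_inverse_simps(2)[OF c] by auto
  ultimately show "openin (top_of_set (snd c ` fst c))
      {y \<in> topspace (top_of_set (snd c ` fst c)). inv_into (fst c) (snd c) y \<in> W}"
    by (auto intro: open_subset)
qed

lemma openin_chart_inverse_image:
  assumes c: "is_chart X c" and V: "open V" "V \<subseteq> snd c ` fst c"
  shows "openin X (inv_into (fst c) (snd c) ` V)"
proof -
  have "openin (subtopology X (fst c)) {p \<in> topspace (subtopology X (fst c)). snd c p \<in> V}"
    using continuous_chart[OF c] V(1) openin_continuous_map_preimage by fastforce
  moreover have "{p \<in> topspace (subtopology X (fst c)). snd c p \<in> V} = inv_into (fst c) (snd c) ` V"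
  proof
    show "{p \<in> topspace (subtopology X (fst c)). snd c p \<in> V} \<subseteq> inv_into (fst c) (snd c) ` V"
    proof
      fix p assume "p \<in> {p \<in> topspace (subtopology X (fst c)). snd c p \<in> V}"
      then show "p \<in> inv_into (fst c) (snd c) ` V"
        using chart_inverse_simps(2)[OF c, of p] by (intro image_eqI[of _ _ "snd c p"]) auto
    qed
    show "inv_into (fst c) (snd c) ` V \<subseteq> {p \<in> topspace (subtopology X (fst c)). snd c p \<in> V}"
    proof clarify
      fix y assume y: "y \<in> V"
      then have "y \<in> snd c ` fst c" using V(2) by blast
      then show "inv_into (fst c) (snd c) y \<in> topspace (subtopology X (fst c)) \<and>
          snd c (inv_into (fst c) (snd c) y) \<in> V"
        using chart_inverse_simps(3,4)[OF c, of y] chart_inverse_simps(5)[OF c] y by auto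
    qed
  qed
  ultimately show ?thesis using c unfolding is_chart_def by (metis openin_trans_full)
qed

lemma open_local_dom:
  assumes c: "is_chart X c" and f: "continuous_map X Y f" and d: "openin Y (fst d)"
  shows "open (local_dom c d f)" and "openin X (fst c \<inter> f -` fst d)"
proof -
  have "openin X {p \<in> topspace X. f p \<in> fst d}"
    using f d openin_continuous_map_preimage by blast
  then have "openin X (fst c \<inter> {p \<in> topspace X. f p \<in> fst d})"
    using c by (auto simp: is_chart_def)
  moreover have "fst c \<inter> {p \<in> topspace X. f p \<in> fst d} = fst c \<inter> f -` fst d"
    using chart_inverse_simps(5)[OF c] by auto
  ultimately show o: "openin X (fst c \<inter> f -` fst d)" by simp
  show "open (local_dom c d f)" unfolding local_dom_def by (rule open_chart_image[OF c o]) auto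
qed

lemma is_chart_torus:
  assumes "full_lattice L" "d \<in> torus_atlas L" shows "is_chart (torus L) d"
proof -
  obtain B where "lattice_basis L B" using full_lattice_obtain[OF assms(1)] .
  then interpret lattice_basis L B .
  obtain V where V: "open V" "inj_on (torus_proj L) V" "d = (torus_proj L ` V, inv_into V (torus_proj L))"
    using assms(2) by (auto simp: torus_atlas_def)
  have im: "snd d ` fst d = V" using V(2,3) by (force simp: image_iff)
  have o: "openin (torus L) (fst d)" using V by (simp add: openin_proj_image)
  have "homeomorphic_maps (subtopology (torus L) (fst d)) (top_of_set V) (snd d) (torus_proj L)"
    unfolding homeomorphic_maps_def
  proof (intro conjI ballI)
    show "continuous_map (subtopology (torus L) (fst d)) (top_of_set V) (snd d)"
      unfolding continuous_map_in_subtopology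
    proof
      show "continuous_map (subtopology (torus L) (fst d)) euclidean (snd d)"
        unfolding continuous_map_def
      proof (intro conjI allI impI)
        fix W :: "'a set" assume "openin euclidean W"
        then have "openin (torus L) (torus_proj L ` (V \<inter> W))" using V(1) by (simp add: openin_proj_image open_Int)
        moreover have "{s \<in> topspace (subtopology (torus L) (fst d)). snd d s \<in> W} = torus_proj L ` (V \<inter> W)"
          using V(2,3) openin_subset[OF o] by (auto simp: topspace_torus)
        ultimately show "openin (subtopology (torus L) (fst d)) {s \<in> topspace (subtopology (torus L) (fst d)). snd d s \<in> W}"
          using V(3) by (auto simp: openin_subtopology intro!: exI[of _ "torus_proj L ` (V \<inter> W)"])
      qed auto
      show "snd d \<in> topspace (subtopology (torus L) (fst d)) \<rightarrow> V" using im by auto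
    qed
    show "continuous_map (top_of_set V) (subtopology (torus L) (fst d)) (torus_proj L)"
      using V(3) proj_continuous_on[OF continuous_on_id, of V] by (auto simp: continuous_map_in_subtopology)
  qed (use V in auto)
  then have "homeomorphic_map (subtopology (torus L) (fst d)) (top_of_set V) (snd d)"
    using homeomorphic_maps_imp_map by blast
  then show ?thesis using o V(1) im by (simp add: is_chart_def)
qed

lemma torus_chart_proj:
  assumes "d \<in> torus_atlas L" "s \<in> fst d" shows "torus_proj L (snd d s) = s"
  using assms by (auto simp: torus_atlas_def f_inv_into_f)

lemma torus_chart_through:
  assumes "full_lattice L"
  obtains d where "d \<in> torus_atlas L" "torus_proj L x \<in> fst d" "snd d (torus_proj L x) = x"
proof -
  obtain B where "lattice_basis L B" using full_lattice_obtain[OF assms] .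
  then interpret lattice_basis L B .
  obtain r where r: "r > 0" "inj_on (torus_proj L) (ball x r)" using inj_on_ball by blast
  show thesis
    by (rule that[of "(torus_proj L ` ball x r, inv_into (ball x r) (torus_proj L))"])
      (use r in \<open>auto simp: torus_atlas_def\<close>)
qed

text \<open>Replaces a pair of charts by the data the geometry needs: a homeomorphism \<phi> from an
  open parameter set onto an open piece of \<open>X\<close>, and an immersion \<open>F\<close> into
  Euclidean space that lifts f along \<phi>.\<close>

definition local_param :: "'b topology \<Rightarrow> 'a::euclidean_space set \<Rightarrow> ('b \<Rightarrow> 'a set) \<Rightarrow>
    'e::euclidean_space set \<Rightarrow> ('e \<Rightarrow> 'b) \<Rightarrow> ('e \<Rightarrow> 'a) \<Rightarrow> bool" where
  "local_param X L f U \<phi> F \<longleftrightarrow> open U \<and> continuous_map (top_of_set U) X \<phi> \<and> inj_on \<phi> U \<and>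
     (\<forall>V. open V \<and> V \<subseteq> U \<longrightarrow> openin X (\<phi> ` V)) \<and> smooth_on U F \<and>
     (\<forall>y\<in>U. inj (frechet_derivative F (at y))) \<and> (\<forall>y\<in>U. torus_proj L (F y) = f (\<phi> y))"

text \<open>Charts of the torus are local inverses of the projection, so a coordinate representation
  of f is itself a lift.\<close>

lemma local_param_chart:
  assumes A: "smooth_atlas X A" and L: "full_lattice L"
    and f: "smooth_embedding X A (torus L) (torus_atlas L) f" and c: "c \<in> A" and d: "d \<in> torus_atlas L"
  shows "local_param X L f (local_dom c d f) (inv_into (fst c) (snd c)) (local_rep c d f)"
    and "inv_into (fst c) (snd c) ` local_dom c d f = fst c \<inter> f -` fst d"
proof -
  let ?\<phi> = "inv_into (fst c) (snd c)"
  have ch: "is_chart X c" using A c by (simp add: smooth_atlas_def)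
  have dch: "is_chart (torus L) d" by (rule is_chart_torus[OF L d])
  have cont: "continuous_map X (torus L) f" using f by (simp add: smooth_embedding_def smooth_map_def)
  have sub: "local_dom c d f \<subseteq> snd c ` fst c" by (auto simp: local_dom_def)
  show im: "?\<phi> ` local_dom c d f = fst c \<inter> f -` fst d"
    using chart_inverse_simps(2)[OF ch] by (force simp: local_dom_def image_iff)
  show "local_param X L f (local_dom c d f) ?\<phi> (local_rep c d f)"
    unfolding local_param_def
  proof (intro conjI allI impI ballI)
    show "open (local_dom c d f)" by (rule open_local_dom[OF ch cont]) (use dch in \<open>simp add: is_chart_def\<close>)
    show "continuous_map (top_of_set (local_dom c d f)) X ?\<phi>"
      using continuous_map_from_subtopology_mono[OF continuous_chart_inverse[OF ch] sub] .
    show "inj_on ?\<phi> (local_dom c d f)" by (rule inj_on_inv_into[OF sub])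
    show "openin X (?\<phi> ` V)" if "open V \<and> V \<subseteq> local_dom c d f" for V
      by (rule openin_chart_inverse_image[OF ch]) (use that sub in auto)
    show "smooth_on (local_dom c d f) (local_rep c d f)"
      using f c d by (simp add: smooth_embedding_def smooth_map_def)
    show "inj (frechet_derivative (local_rep c d f) (at y))" if "y \<in> local_dom c d f" for y
      using f c d that by (simp add: smooth_embedding_def)
    show "torus_proj L (local_rep c d f y) = f (?\<phi> y)" if "y \<in> local_dom c d f" for y
    proof -
      have "f (?\<phi> y) \<in> fst d" using im that by blast
      then show ?thesis by (simp add: local_rep_def torus_chart_proj[OF d])
    qed
  qed
qed

lemma local_param_continuous:
  assumes "local_param X L f U \<phi> F" shows "continuous_on U F"
  using assms C_on_continuous[of 0 U F] by (simp add: local_param_def smooth_on_def)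

lemma local_param_differentiable:
  assumes "local_param X L f U \<phi> F" "y \<in> U" shows "F differentiable (at y)"
proof -
  have "C_on (Suc 0) U F" using assms(1) unfolding local_param_def smooth_on_def by blast
  then show ?thesis using assms(2) by simp
qed

lemma minimal_param_exists:
  fixes X :: "'b topology" and A :: "('b, real^'n) chart set" and L :: "(real^'m) set"
  assumes A: "smooth_atlas X A" and L: "full_lattice L" and f: "minimal_embedding X A L f"
    and p: "p \<in> topspace X"
  obtains U \<phi> and F :: "real^'n \<Rightarrow> real^'m" and y
  where "local_param X L f U \<phi> F" "y \<in> U" "\<phi> y = p" "\<And>y. y \<in> U \<Longrightarrow> minimal_at F y"
proof -
  have emb: "smooth_embedding X A (torus L) (torus_atlas L) f" and card: "CARD('m) = CARD('n) + 1"
    using f by (auto simp: minimal_embedding_def)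
  have "p \<in> (\<Union>c\<in>A. fst c)" using A p by (simp add: smooth_atlas_def)
  then obtain c where c: "c \<in> A" "p \<in> fst c" by blast
  have "f p \<in> topspace (torus L)"
    using emb p by (auto simp: smooth_embedding_def smooth_map_def continuous_map_def)
  then obtain x where x: "f p = torus_proj L x" by (auto simp: topspace_torus)
  obtain d where d: "d \<in> torus_atlas L" "f p \<in> fst d"
    using torus_chart_through[OF L, of x] unfolding x by metis
  have lp: "local_param X L f (local_dom c d f) (inv_into (fst c) (snd c)) (local_rep c d f)"
    using local_param_chart[OF A L emb c(1) d(1)] by blast
  have "p \<in> inv_into (fst c) (snd c) ` local_dom c d f"
    unfolding local_param_chart(2)[OF A L emb c(1) d(1)] using c d by auto
  then obtain y where "y \<in> local_dom c d f" "inv_into (fst c) (snd c) y = p" by blast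
  moreover have "minimal_at (local_rep c d f) y" if "y \<in> local_dom c d f" for y
  proof (rule minimal_at_if_mean_curvature_zero[OF card _ that])
    show "open (local_dom c d f)" "C_on 2 (local_dom c d f) (local_rep c d f)"
      "inj (frechet_derivative (local_rep c d f) (at y))"
      using lp that by (auto simp: local_param_def smooth_on_def)
    show "mean_curvature (local_rep c d f) \<nu> y = 0" if "unit_normal (local_rep c d f) y \<nu>" for \<nu>
      using f c(1) d(1) \<open>y \<in> local_dom c d f\<close> that unfolding minimal_embedding_def by blast
  qed
  ultimately show thesis using that lp by blast
qed

lemma local_param_nhd:
  assumes "local_param X L f U \<phi> F" "openin X W" "y \<in> U" "\<phi> y \<in> W"
  obtains r where "r > 0" "ball y r \<subseteq> U" "\<phi> ` ball y r \<subseteq> W" "openin X (\<phi> ` ball y r)"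
proof -
  have "openin (top_of_set U) {z \<in> topspace (top_of_set U). \<phi> z \<in> W}"
    by (rule openin_continuous_map_preimage[OF _ assms(2)]) (use assms(1) in \<open>simp add: local_param_def\<close>)
  then have "open {z \<in> U. \<phi> z \<in> W}" using assms(1) unfolding local_param_def by (simp add: openin_open_eq)
  then obtain r where r: "r > 0" "ball y r \<subseteq> {z \<in> U. \<phi> z \<in> W}"
    using assms(3,4) open_contains_ball by blast
  show thesis
  proof (rule that[OF r(1)])
    show "ball y r \<subseteq> U" "\<phi> ` ball y r \<subseteq> W" using r(2) by auto
    then show "openin X (\<phi> ` ball y r)" using assms(1) unfolding local_param_def by auto
  qed
qed

text \<open>Small balls of parameters are convex and have open images. Together with connectedness
  of \<open>X\<close> this supplies the paths from the base point along which coordinates are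
  integrated.\<close>

lemma locally_path_connected_if_params:
  fixes X :: "'b topology"
  assumes "\<And>p. p \<in> topspace X \<Longrightarrow>
    \<exists>U (\<phi> :: 'e::euclidean_space \<Rightarrow> 'b) F y. local_param X L f U \<phi> F \<and> y \<in> U \<and> \<phi> y = p"
  shows "locally_path_connected_space X"
  unfolding locally_path_connected_space_def neighbourhood_base_of
proof (intro allI impI, elim conjE)
  fix W p assume W: "openin X W" "p \<in> W"
  then have "p \<in> topspace X" using openin_subset by blast
  then obtain U F y and \<phi> :: "'e \<Rightarrow> 'b" where lp: "local_param X L f U \<phi> F" and y: "y \<in> U" "\<phi> y = p"
    using assms by blast
  obtain r where r: "r > 0" "ball y r \<subseteq> U" "\<phi> ` ball y r \<subseteq> W" "openin X (\<phi> ` ball y r)"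
    using local_param_nhd[OF lp W(1) y(1)] y(2) W(2) by metis
  have "path_connectedin (top_of_set U) (ball y r)"
    using r(2) by (simp add: path_connectedin_subtopology path_connectedin_euclidean convex_imp_path_connected)
  then have "path_connectedin X (\<phi> ` ball y r)"
    by (rule path_connectedin_continuous_map_image[rotated]) (use lp in \<open>simp add: local_param_def\<close>)
  moreover have "p \<in> \<phi> ` ball y r" using r(1) y(2) by auto
  ultimately show "\<exists>U V. openin X U \<and> path_connectedin X V \<and> p \<in> U \<and> U \<subseteq> V \<and> V \<subseteq> W"
    using r by blast
qed

section \<open>Coordinates killed by the periods are constant\<close>

lemma local_param_ball:
  assumes "local_param X L f U \<phi> F" "y \<in> U"
  obtains r where "r > 0" "ball y r \<subseteq> U"
  using assms openE[of U y] unfolding local_param_def by metis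

context lattice_basis
begin

lemma period_reverse:
  assumes F: "continuous_map Y (torus L) F" and p: "pathin Y p"
  shows "pathin Y (\<lambda>t. p (1 - t))" and "period L F (\<lambda>t. p (1 - t)) = - period L F p"
proof -
  have "pathin Y (p \<circ> (\<lambda>t. 1 - t))"
    by (rule pathin_compose_unit[OF p]) (auto intro!: continuous_intros)
  then show "pathin Y (\<lambda>t. p (1 - t))" by (simp add: o_def)
  have "F (p 0) \<in> topspace (torus L)"
    using F p by (auto simp: pathin_def continuous_map_def)
  then obtain a where a: "torus_proj L a = F (p 0)" by (auto simp: topspace_torus)
  obtain g where g: "continuous_on {0..1} g" "\<And>t. t \<in> {0..1} \<Longrightarrow> torus_proj L (g t) = F (p t)"
    by (rule path_lift[OF p F a]) (rule that)
  have "period L F (\<lambda>t. p (1 - t)) = g (1 - 1) - g (1 - 0)"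
    by (rule period_eq[of "\<lambda>t. g (1 - t)"])
      (auto intro!: continuous_on_compose2[OF g(1)] continuous_intros simp: g(2))
  then show "period L F (\<lambda>t. p (1 - t)) = - period L F p"
    using period_eq[of g F p] g by simp
qed

text \<open>Running \<open>p\<close> and returning along \<open>q\<close> gives a loop. This is what
  makes integration along paths well defined modulo periods.\<close>

lemma period_difference_in_periods:
  assumes F: "continuous_map Y (torus L) F" and p: "pathin Y p" "p 0 = y" and q: "pathin Y q" "q 0 = y"
    and e: "p 1 = q 1"
  shows "period L F p - period L F q \<in> periods L Y F y"
proof -
  note r = period_reverse[OF F q(1)]
  have "loop_join p (\<lambda>t. q (1 - t)) \<in> loops Y y"
    using pathin_join[OF p(1) r(1)] p q e by (simp add: loops_def loop_join_def)
  moreover have "period L F (loop_join p (\<lambda>t. q (1 - t))) = period L F p - period L F q"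
    using period_join[OF F p(1) r(1)] e r(2) by simp
  ultimately show ?thesis unfolding periods_eq[OF F] by (metis imageI)
qed

text \<open>Inside a parametrised ball \<open>F\<close> lifts the image of the segment, so
  integrating along it just subtracts values of \<open>F\<close>.\<close>

lemma period_segment:
  assumes lp: "local_param X L f U \<phi> F" and b: "ball y0 r \<subseteq> U" and y: "y \<in> ball y0 r"
  defines "\<gamma> \<equiv> \<lambda>t. \<phi> (y0 + t *\<^sub>R (y - y0))"
  shows "pathin X \<gamma>" "\<gamma> 0 = \<phi> y0" "\<gamma> 1 = \<phi> y" "period L f \<gamma> = F y - F y0"
proof -
  have r: "r > 0" using y by (metis ball_eq_empty empty_iff not_le)
  have seg: "y0 + t *\<^sub>R (y - y0) \<in> U" if "t \<in> {0..1}" for t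
  proof -
    have "y0 + t *\<^sub>R (y - y0) = (1 - t) *\<^sub>R y0 + t *\<^sub>R y" by (simp add: algebra_simps)
    then have "y0 + t *\<^sub>R (y - y0) \<in> ball y0 r"
      using convexD[OF convex_ball, of y0 y0 r y "1 - t" t] that y r by simp
    then show ?thesis using b by blast
  qed
  have m: "continuous_map (top_of_set {0..1}) (top_of_set U) (\<lambda>t. y0 + t *\<^sub>R (y - y0))"
    unfolding continuous_map_in_subtopology using seg by (auto intro!: continuous_intros)
  show "pathin X \<gamma>"
    unfolding pathin_def \<gamma>_def
    using continuous_map_compose[OF m, of X \<phi>] lp by (simp add: local_param_def o_def)
  show "\<gamma> 0 = \<phi> y0" "\<gamma> 1 = \<phi> y" by (simp_all add: \<gamma>_def)
  have "period L f \<gamma> = F (y0 + 1 *\<^sub>R (y - y0)) - F (y0 + 0 *\<^sub>R (y - y0))"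
  proof (rule period_eq[of "\<lambda>t. F (y0 + t *\<^sub>R (y - y0))"])
    show "continuous_on {0..1} (\<lambda>t. F (y0 + t *\<^sub>R (y - y0)))"
      by (rule continuous_on_compose2[OF local_param_continuous[OF lp]])
        (use seg in \<open>auto intro!: continuous_intros\<close>)
    show "torus_proj L (F (y0 + t *\<^sub>R (y - y0))) = f (\<gamma> t)" if "t \<in> {0..1}" for t
      using lp seg[OF that] by (simp add: local_param_def \<gamma>_def)
  qed
  then show "period L f \<gamma> = F y - F y0" by simp
qed

text \<open>The function \<open>u\<close> pairs \<open>l\<close> with the displacement along any
  path from \<open>x0\<close>; two paths to the same point differ by a period, which
  \<open>l\<close> annihilates. On parametrised balls \<open>u\<close> is l applied to
  \<open>F\<close> up to a constant, so the strong maximum principle makes the set of maximum points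
  open, and connectedness does the rest. The conclusion is phrased for tangent vectors, ready to be
  compared with the span of the periods.\<close>

theorem coordinate_constant:
  fixes X :: "'b topology" and f :: "'b \<Rightarrow> 'a set" and l :: 'a and G :: "'e::euclidean_space \<Rightarrow> 'a"
  assumes X: "compact_space X" "connected_space X" "x0 \<in> topspace X"
    and f: "continuous_map X (torus L) f"
    and params: "\<And>p. p \<in> topspace X \<Longrightarrow> \<exists>U (\<phi> :: 'e \<Rightarrow> 'b) F y.
      local_param X L f U \<phi> F \<and> y \<in> U \<and> \<phi> y = p \<and> (\<forall>y\<in>U. minimal_at F y)"
    and l: "\<And>v. v \<in> periods L X f x0 \<Longrightarrow> l \<bullet> v = 0"
    and G: "local_param X L f V \<psi> G" and z: "z \<in> V"
  shows "l \<bullet> frechet_derivative G (at z) w = 0"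
proof -
  have "locally_path_connected_space X"
    by (rule locally_path_connected_if_params) (use params in blast)
  then have pc: "path_connected_space X" using X(2) path_connected_eq_connected_space by blast
  define u where "u p = l \<bullet> period L f (SOME \<gamma>. pathin X \<gamma> \<and> \<gamma> 0 = x0 \<and> \<gamma> 1 = p)" for p
  have u: "u (\<gamma> 1) = l \<bullet> period L f \<gamma>" if \<gamma>: "pathin X \<gamma>" "\<gamma> 0 = x0" for \<gamma>
  proof -
    let ?g = "SOME \<gamma>'. pathin X \<gamma>' \<and> \<gamma>' 0 = x0 \<and> \<gamma>' 1 = \<gamma> 1"
    have "pathin X ?g \<and> ?g 0 = x0 \<and> ?g 1 = \<gamma> 1"
      by (rule someI[of "\<lambda>\<gamma>'. pathin X \<gamma>' \<and> \<gamma>' 0 = x0 \<and> \<gamma>' 1 = \<gamma> 1" \<gamma>]) (use \<gamma> in simp)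
    then have "period L f ?g - period L f \<gamma> \<in> periods L X f x0"
      by (intro period_difference_in_periods[OF f]) (use \<gamma> in auto)
    from l[OF this] show ?thesis by (simp add: u_def inner_diff_right)
  qed
  \<comment> \<open>A path to the centre of the ball is prolonged by the segment to y, and
    additivity of periods separates the two contributions.\<close>
  have local_u: "u (\<phi> y) = u (\<phi> y0) + l \<bullet> (F y - F y0)"
    if lp: "local_param X L f U \<phi> F" and b: "ball y0 r \<subseteq> U" and y: "y \<in> ball y0 r"
    for U F y y0 r and \<phi> :: "'e \<Rightarrow> 'b"
  proof -
    note seg = period_segment[OF lp b y]
    have "\<phi> y0 \<in> topspace X"
      using seg(1,2) path_start_in_topspace by metis
    then obtain \<gamma> where \<gamma>: "pathin X \<gamma>" "\<gamma> 0 = x0" "\<gamma> 1 = \<phi> y0"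
      using pc X(3) unfolding path_connected_space_def by blast
    have j: "\<gamma> 1 = \<phi> (y0 + 0 *\<^sub>R (y - y0))" using \<gamma>(3) by simp
    have "u (loop_join \<gamma> (\<lambda>t. \<phi> (y0 + t *\<^sub>R (y - y0))) 1) =
        l \<bullet> period L f (loop_join \<gamma> (\<lambda>t. \<phi> (y0 + t *\<^sub>R (y - y0))))"
      by (rule u[OF pathin_join[OF \<gamma>(1) seg(1) j]]) (simp add: loop_join_def \<gamma>(2))
    then have "u (\<phi> y) = l \<bullet> (period L f \<gamma> + (F y - F y0))"
      using period_join[OF f \<gamma>(1) seg(1) j] seg(4) by (simp add: loop_join_def)
    then show ?thesis using u[OF \<gamma>(1,2)] \<gamma>(3) by (simp add: inner_add_right)
  qed
  have cu: "continuous_map X euclideanreal u"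
    unfolding continuous_map_def
  proof (intro conjI allI impI)
    fix W :: "real set" assume W: "openin euclidean W"
    show "openin X {p \<in> topspace X. u p \<in> W}"
    proof (subst openin_subopen, intro ballI)
      fix p assume p: "p \<in> {p \<in> topspace X. u p \<in> W}"
      then obtain U F y0 and \<phi> :: "'e \<Rightarrow> 'b" where lp: "local_param X L f U \<phi> F" and y0: "y0 \<in> U" "\<phi> y0 = p"
        using params by blast
      obtain r where r: "r > 0" "ball y0 r \<subseteq> U"
        using local_param_ball[OF lp y0(1)] .
      let ?g = "\<lambda>y. u (\<phi> y0) + l \<bullet> (F y - F y0)"
      have "continuous_on (ball y0 r) ?g"
        by (intro continuous_intros continuous_on_subset[OF local_param_continuous[OF lp] r(2)])
      then have o: "open (ball y0 r \<inter> ?g -` W)"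
        using W continuous_open_preimage[OF _ open_ball] by auto
      show "\<exists>T. openin X T \<and> p \<in> T \<and> T \<subseteq> {p \<in> topspace X. u p \<in> W}"
      proof (intro exI conjI)
        show op: "openin X (\<phi> ` (ball y0 r \<inter> ?g -` W))"
          using lp o r(2) by (auto simp: local_param_def)
        show "p \<in> \<phi> ` (ball y0 r \<inter> ?g -` W)"
          using r(1) y0 p by (intro image_eqI[of _ _ y0]) auto
        show "\<phi> ` (ball y0 r \<inter> ?g -` W) \<subseteq> {p \<in> topspace X. u p \<in> W}"
        proof clarify
          fix y assume y: "y \<in> ball y0 r" "?g y \<in> W"
          then show "\<phi> y \<in> topspace X \<and> u (\<phi> y) \<in> W"
            using local_u[OF lp r(2) y(1)] openin_subset[OF op] by auto
        qed
      qed
    qed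
  qed auto
  have "compactin euclideanreal (u ` topspace X)"
    by (rule image_compactin[OF _ cu]) (use X(1) in \<open>simp add: compact_space_def\<close>)
  then have "compact (u ` topspace X)" by (simp add: compactin_euclidean_iff)
  then have "\<exists>s\<in>u ` topspace X. \<forall>t\<in>u ` topspace X. t \<le> s"
    by (rule compact_attains_sup) (use X(3) in blast)
  then obtain p0 where p0: "p0 \<in> topspace X" "\<And>p. p \<in> topspace X \<Longrightarrow> u p \<le> u p0"
    by blast
  define S where "S = {p \<in> topspace X. u p = u p0}"
  have "closedin X S"
    using closedin_continuous_map_preimage[OF cu, of "{u p0}"] by (simp add: S_def)
  moreover have "openin X S"
  proof (subst openin_subopen, intro ballI)
    fix p assume p: "p \<in> S"
    then obtain U F y0 and \<phi> :: "'e \<Rightarrow> 'b" where lp: "local_param X L f U \<phi> F"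
      and y0: "y0 \<in> U" "\<phi> y0 = p" and min: "\<forall>y\<in>U. minimal_at F y"
      using params unfolding S_def by blast
    have U: "open U" "C_on 2 U F" "\<And>y. y \<in> U \<Longrightarrow> inj (frechet_derivative F (at y))"
      using lp by (auto simp: local_param_def smooth_on_def)
    obtain r where r: "r > 0" "ball y0 r \<subseteq> U" using U(1) y0(1) open_contains_ball by blast
    have top: "\<phi> y \<in> topspace X" if "y \<in> U" for y
      using lp that by (auto simp: local_param_def continuous_map_def)
    have "y0 \<in> ball y0 r" "C_on 2 (ball y0 r) F" using r(1) C_on_subset[OF U(2) r(2)] by auto
    moreover have "inj (frechet_derivative F (at y))" "minimal_at F y" if "y \<in> ball y0 r" for y
      using U(3) min that r(2) by auto
    moreover have "l \<bullet> F y \<le> l \<bullet> F y0" if "y \<in> ball y0 r" for y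
      using local_u[OF lp r(2) that] p0(2)[OF top, of y] that r(2) p y0(2)
      by (auto simp: S_def inner_diff_right)
    ultimately obtain s where s: "s > 0" "ball y0 s \<subseteq> ball y0 r" "\<And>y. y \<in> ball y0 s \<Longrightarrow> l \<bullet> F y = l \<bullet> F y0"
      using strong_maximum_principle[of "ball y0 r" y0 F l, OF open_ball] by metis
    have "\<phi> ` ball y0 s \<subseteq> S"
    proof clarify
      fix y assume y: "y \<in> ball y0 s"
      then have "y \<in> ball y0 r" "y \<in> U" using s(2) r(2) by blast+
      then show "\<phi> y \<in> S"
        using local_u[OF lp r(2), of y] s(3)[OF y] top[of y] p y0(2) by (auto simp: S_def inner_diff_right)
    qed
    moreover have "openin X (\<phi> ` ball y0 s)" using lp s(2) r(2) by (auto simp: local_param_def)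
    moreover have "p \<in> \<phi> ` ball y0 s" using s(1) y0(2) by auto
    ultimately show "\<exists>T. openin X T \<and> p \<in> T \<and> T \<subseteq> S" by blast
  qed
  ultimately have "S = topspace X"
    using X(2) p0(1) unfolding connected_space_clopen_in S_def by blast
  then have uconst: "u p = u p0" if "p \<in> topspace X" for p using that by (auto simp: S_def)
  obtain r where r: "r > 0" "ball z r \<subseteq> V" using local_param_ball[OF G z] .
  have const: "l \<bullet> G y = l \<bullet> G z" if "y \<in> ball z r" for y
  proof -
    have "\<psi> y \<in> topspace X" "\<psi> z \<in> topspace X"
      using G that r z by (auto simp: local_param_def continuous_map_def)
    then show ?thesis using local_u[OF G r(2) that] uconst by (simp add: inner_diff_right)
  qed
  have "z \<in> ball z r" using r(1) by (simp only: centre_in_ball)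
  then have "frechet_derivative (\<lambda>y. l \<bullet> G y) (at z) = frechet_derivative (\<lambda>y. l \<bullet> G z) (at z)"
    using const by (rule frechet_derivative_cong_open[OF open_ball])
  then have "frechet_derivative (\<lambda>y. l \<bullet> G y) (at z) w = 0" by (simp add: frechet_derivative_const)
  then show ?thesis using frechet_derivative_inner[OF local_param_differentiable[OF G z]] by metis
qed

end

section \<open>Compact quotients of Euclidean space\<close>

definition int_span :: "'a::real_vector set \<Rightarrow> 'a set" where
  "int_span B = {v. \<exists>m::'a \<Rightarrow> int. v = (\<Sum>b\<in>B. of_int (m b) *\<^sub>R b)}"

lemma int_span_subset_span: "int_span B \<subseteq> span B"
  unfolding int_span_def by (auto intro: span_sum span_scale span_base)

lemma int_span_insert:
  assumes "finite B" "b \<notin> B"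
  shows "v \<in> int_span (insert b B) \<longleftrightarrow> (\<exists>n::int. v - of_int n *\<^sub>R b \<in> int_span B)"
proof
  assume "v \<in> int_span (insert b B)"
  then obtain m :: "'a \<Rightarrow> int" where "v = (\<Sum>x\<in>insert b B. of_int (m x) *\<^sub>R x)"
    unfolding int_span_def by blast
  then have "v - of_int (m b) *\<^sub>R b = (\<Sum>x\<in>B. of_int (m x) *\<^sub>R x)" using assms by simp
  then show "\<exists>n::int. v - of_int n *\<^sub>R b \<in> int_span B" unfolding int_span_def by blast
next
  assume "\<exists>n::int. v - of_int n *\<^sub>R b \<in> int_span B"
  then obtain n :: int and m :: "'a \<Rightarrow> int" where "v - of_int n *\<^sub>R b = (\<Sum>x\<in>B. of_int (m x) *\<^sub>R x)"
    unfolding int_span_def by blast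
  then have "v = of_int n *\<^sub>R b + (\<Sum>x\<in>B. of_int (m x) *\<^sub>R x)" by (simp add: algebra_simps)
  also have "(\<Sum>x\<in>B. of_int (m x) *\<^sub>R x) = (\<Sum>x\<in>B. of_int ((m(b := n)) x) *\<^sub>R x)"
    using assms(2) by (intro sum.cong) auto
  finally have "v = (\<Sum>x\<in>insert b B. of_int ((m(b := n)) x) *\<^sub>R x)" using assms by simp
  then show "v \<in> int_span (insert b B)" unfolding int_span_def by blast
qed

lemma int_span_diff: "u \<in> int_span B \<Longrightarrow> v \<in> int_span B \<Longrightarrow> u - v \<in> int_span B"
proof -
  assume "u \<in> int_span B" "v \<in> int_span B"
  then obtain m n :: "'a \<Rightarrow> int" where
    "u = (\<Sum>b\<in>B. of_int (m b) *\<^sub>R b)" "v = (\<Sum>b\<in>B. of_int (n b) *\<^sub>R b)"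
    unfolding int_span_def by blast
  then have "u - v = (\<Sum>b\<in>B. of_int (m b - n b) *\<^sub>R b)"
    by (simp add: sum_subtractf algebra_simps)
  then show ?thesis unfolding int_span_def by (intro CollectI exI[of _ "\<lambda>b. m b - n b"])
qed

lemma int_multiple_mem:
  assumes "0 \<in> H" "\<And>u v. u \<in> H \<Longrightarrow> v \<in> H \<Longrightarrow> u - v \<in> H" "v \<in> H"
  shows "of_int n *\<^sub>R v \<in> (H :: 'a::real_vector set)"
proof -
  have neg: "- v \<in> H" if "v \<in> H" for v using assms(2)[OF assms(1) that] by simp
  have pos: "of_nat k *\<^sub>R v \<in> H" for k
  proof (induction k)
    case (Suc k)
    then have "of_nat k *\<^sub>R v - (- v) \<in> H" using assms neg by blast
    then show ?case by (simp add: algebra_simps)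
  qed (simp add: assms)
  show ?thesis
  proof (cases n rule: int_cases2)
    case (nonneg k)
    then show ?thesis using pos[of k] by simp
  next
    case (nonpos k)
    then show ?thesis using neg[OF pos[of k]] by simp
  qed
qed

text \<open>A subgroup \<open>H\<close> of the lattice is built from its intersection with the sublattice spanned by
  all but one basis vector \<open>b\<close> and an element whose \<open>b\<close>-coordinate is the smallest positive one.\<close>

lemma subgroup_int_basis:
  fixes B :: "'a::real_vector set"
  assumes "finite B" "independent B" "H \<subseteq> int_span B" "0 \<in> H"
    "\<And>u v. u \<in> H \<Longrightarrow> v \<in> H \<Longrightarrow> u - v \<in> H"
  shows "\<exists>C. finite C \<and> independent C \<and> H = int_span C"
  using assms
proof (induction B arbitrary: H rule: finite_induct)
  case empty
  then have "H = int_span {}" by (auto simp: int_span_def)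
  then show ?case using independent_empty by blast
next
  case (insert b B)
  have indB: "independent B" and bB: "b \<notin> span B"
    using insert.prems(1) insert.hyps by (auto simp: independent_insert)
  let ?H = "H \<inter> int_span B"
  have "0 \<in> int_span B" unfolding int_span_def by (intro CollectI exI[of _ "\<lambda>_. 0"]) simp
  then obtain C where C: "finite C" "independent C" "?H = int_span C"
    using insert.IH[of ?H] indB insert.prems int_span_diff by blast
  define N where "N = {n::int. \<exists>h\<in>H. h - of_int n *\<^sub>R b \<in> int_span B}"
  have N: "\<exists>n\<in>N. h - of_int n *\<^sub>R b \<in> int_span B" if "h \<in> H" for h
    using insert.prems(2) that int_span_insert[OF insert.hyps(1,2)] unfolding N_def by blast
  have Ndiff: "m - n \<in> N" if mn: "m \<in> N" "n \<in> N" for m n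
  proof -
    obtain g h where gh: "g \<in> H" "g - of_int m *\<^sub>R b \<in> int_span B" "h \<in> H" "h - of_int n *\<^sub>R b \<in> int_span B"
      using mn unfolding N_def by blast
    have "(g - h) - of_int (m - n) *\<^sub>R b \<in> int_span B"
      using int_span_diff[OF gh(2,4)] by (simp add: algebra_simps)
    then show ?thesis using insert.prems(4)[OF gh(1,3)] unfolding N_def by blast
  qed
  show ?case
  proof (cases "N \<subseteq> {0}")
    case True
    then have "H = ?H" using N by fastforce
    then show ?thesis using C by metis
  next
    case False
    then obtain n0 where "n0 \<in> N" "n0 \<noteq> 0" by blast
    then have "\<exists>d. d \<in> N \<and> d > 0"
      using Ndiff[of n0 n0] Ndiff[of 0 n0] by (cases "n0 > 0") (auto intro: exI[of _ "- n0"])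
    then have "\<exists>k. int k \<in> N \<and> k > 0" by (metis of_nat_0_less_iff zero_less_imp_eq_int)
    define k where "k = (LEAST k. int k \<in> N \<and> k > 0)"
    have k: "int k \<in> N" "k > 0" and kmin: "\<And>j. int j \<in> N \<Longrightarrow> j > 0 \<Longrightarrow> k \<le> j"
      using LeastI_ex[OF \<open>\<exists>k. int k \<in> N \<and> k > 0\<close>] Least_le[of "\<lambda>k. int k \<in> N \<and> k > 0"]
      unfolding k_def by auto
    have dvd: "int k dvd n" if n: "n \<in> N" for n
    proof -
      have zero: "0 \<in> N" using Ndiff[OF k(1) k(1)] by simp
      have neg: "- m \<in> N" if "m \<in> N" for m using Ndiff[OF zero that] by simp
      have pos: "int k * int j \<in> N" for j
      proof (induction j)
        case (Suc j)
        from Ndiff[OF this neg[OF k(1)]] show ?case by (simp add: algebra_simps)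
      qed (simp add: zero)
      have mult: "int k * q \<in> N" for q
        using pos neg[OF pos] by (cases q rule: int_cases2) auto
      have "n mod int k \<in> N"
        using Ndiff[OF n mult[of "n div int k"]] by (simp add: minus_mult_div_eq_mod)
      moreover have "0 \<le> n mod int k" "n mod int k < int k" using k(2) by auto
      ultimately have "n mod int k = 0" using kmin[of "nat (n mod int k)"] by (cases "n mod int k = 0") auto
      then show ?thesis by auto
    qed
    obtain h0 where h0: "h0 \<in> H" "h0 - of_int (int k) *\<^sub>R b \<in> int_span B"
      using k(1) unfolding N_def by blast
    have CB: "span C \<subseteq> span B"
    proof (rule span_minimal)
      show "C \<subseteq> span B"
      proof
        fix c assume c: "c \<in> C"
        have "c = (\<Sum>x\<in>C. of_int (if x = c then 1 else 0) *\<^sub>R x)"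
          using C(1) c by (simp add: if_distrib[of of_int] if_distrib[of "\<lambda>r. r *\<^sub>R _"] cong: if_cong)
        then have "c \<in> int_span C"
          unfolding int_span_def by (intro CollectI exI[of _ "\<lambda>x. if x = c then 1 else 0"])
        then show "c \<in> span B" using C(3) int_span_subset_span by blast
      qed
    qed simp
    have h0B: "h0 \<notin> span B"
    proof
      assume "h0 \<in> span B"
      then have "real k *\<^sub>R b \<in> span B"
        using span_diff[OF _ subsetD[OF int_span_subset_span h0(2)], of h0] by simp
      from span_scale[OF this, of "1 / real k"] show False using bB k(2) by simp
    qed
    then have h0C: "h0 \<notin> span C" "h0 \<notin> C" using CB span_base by blast+
    have "independent (insert h0 C)" using C(2) h0C by (simp add: independent_insert)
    moreover have "H = int_span (insert h0 C)"
    proof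
      show "H \<subseteq> int_span (insert h0 C)"
      proof
        fix h assume h: "h \<in> H"
        obtain n where n: "n \<in> N" "h - of_int n *\<^sub>R b \<in> int_span B" using N[OF h] by blast
        obtain q where q: "n = int k * q" using dvd[OF n(1)] by blast
        have "of_int q *\<^sub>R h0 \<in> H" by (rule int_multiple_mem[OF insert.prems(3,4) h0(1)])
        then have 1: "h - of_int q *\<^sub>R h0 \<in> H" using insert.prems(4) h by blast
        have "of_int q *\<^sub>R (h0 - of_int (int k) *\<^sub>R b) \<in> int_span B"
          by (rule int_multiple_mem[OF \<open>0 \<in> int_span B\<close> int_span_diff h0(2)])
        from int_span_diff[OF n(2) this] have "h - of_int q *\<^sub>R h0 \<in> int_span B"
          by (simp add: q algebra_simps)
        then show "h \<in> int_span (insert h0 C)"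
          using 1 C(3) int_span_insert[OF C(1) h0C(2)] by blast
      qed
      show "int_span (insert h0 C) \<subseteq> H"
      proof
        fix h assume "h \<in> int_span (insert h0 C)"
        then obtain q :: int where q: "h - of_int q *\<^sub>R h0 \<in> H"
          using C(3) int_span_insert[OF C(1) h0C(2)] by blast
        have "of_int (- q) *\<^sub>R h0 \<in> H" by (rule int_multiple_mem[OF insert.prems(3,4) h0(1)])
        from insert.prems(4)[OF q this] show "h \<in> H" by simp
      qed
    qed
    ultimately show ?thesis using C(1) by blast
  qed
qed

text \<open>If the basis \<open>C\<close> did not span, some nonzero x would be orthogonal to
  \<Lambda>. The functional with vector x would then descend to a continuous function on the compact
  quotient, yet it is unbounded.\<close>

lemma full_lattice_if_compact_quotient:
  fixes \<sigma> :: "'a::euclidean_space \<Rightarrow> 'b"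
  assumes \<sigma>: "quotient_map euclidean X \<sigma>" and X: "compact_space X"
    and ker: "\<And>v w. \<sigma> v = \<sigma> w \<longleftrightarrow> v - w \<in> \<Lambda>"
    and C: "finite C" "independent C" "\<Lambda> = int_span C"
  shows "full_lattice \<Lambda>"
proof -
  have "span C = UNIV"
  proof (rule ccontr)
    assume ne: "span C \<noteq> UNIV"
    have "dim (span C) \<noteq> DIM('a)" using ne by (metis dim_eq_full span_span)
    then have "dim (span C) < DIM('a)" using dim_subset_UNIV[of "span C"] by linarith
    then obtain x where x: "x \<noteq> 0" "\<And>y. y \<in> span (span C) \<Longrightarrow> orthogonal x y"
      using orthogonal_to_subspace_exists by blast
    define v where "v p = x \<bullet> (SOME w. \<sigma> w = p)" for p
    have v: "v (\<sigma> w) = x \<bullet> w" for w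
    proof -
      have "\<sigma> (SOME w'. \<sigma> w' = \<sigma> w) = \<sigma> w" by (rule someI[of "\<lambda>w'. \<sigma> w' = \<sigma> w"]) simp
      then have "(SOME w'. \<sigma> w' = \<sigma> w) - w \<in> span (span C)"
        using ker C(3) int_span_subset_span[of C] by (auto simp: span_base)
      from x(2)[OF this] show ?thesis by (simp add: v_def orthogonal_def inner_diff_right)
    qed
    have "continuous_map X euclideanreal v"
      by (rule continuous_compose_quotient_map[OF \<sigma>]) (auto simp: o_def v intro!: continuous_intros)
    then have "compactin euclideanreal (v ` topspace X)"
      by (rule image_compactin[rotated]) (use X in \<open>simp add: compact_space_def\<close>)
    then have "bounded (v ` topspace X)" by (simp add: compactin_euclidean_iff compact_imp_bounded)
    then obtain b where b: "\<And>p. p \<in> topspace X \<Longrightarrow> \<bar>v p\<bar> \<le> b" by (auto simp: bounded_iff)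
    let ?w = "((b + 1) / (x \<bullet> x)) *\<^sub>R x"
    have "\<sigma> ?w \<in> topspace X" using quotient_imp_surjective_map[OF \<sigma>] by auto
    then have "\<bar>v (\<sigma> ?w)\<bar> \<le> b" by (rule b)
    then show False using v[of ?w] x(1) by simp
  qed
  then show ?thesis unfolding full_lattice_def using C(2,3) by (auto simp: int_span_def)
qed

text \<open>Both \<sigma> and the torus projection are quotient maps of the same space with the same
  fibres, so the induced bijection is a homeomorphism.\<close>

lemma flat_torus_homeomorphism:
  fixes \<sigma> :: "'a::euclidean_space \<Rightarrow> 'b"
  assumes \<sigma>: "quotient_map euclidean X \<sigma>" and L: "full_lattice \<Lambda>"
    and ker: "\<And>v w. \<sigma> v = \<sigma> w \<longleftrightarrow> v - w \<in> \<Lambda>"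
  obtains h where "homeomorphic_map X (torus \<Lambda>) h" "\<And>w. h (\<sigma> w) = torus_proj \<Lambda> w"
proof -
  obtain B where "lattice_basis \<Lambda> B" using full_lattice_obtain[OF L] .
  then interpret lattice_basis \<Lambda> B .
  define h where "h p = torus_proj \<Lambda> (SOME w. \<sigma> w = p)" for p
  have h: "h (\<sigma> w) = torus_proj \<Lambda> w" for w
  proof -
    have "\<sigma> (SOME w'. \<sigma> w' = \<sigma> w) = \<sigma> w" by (rule someI[of "\<lambda>w'. \<sigma> w' = \<sigma> w"]) simp
    then show ?thesis by (simp add: h_def torus_proj_eq ker)
  qed
  have "quotient_map X (torus \<Lambda>) h"
  proof (rule quotient_map_from_composition[OF quotient_imp_continuous_map[OF \<sigma>]])
    show "quotient_map euclidean (torus \<Lambda>) (h \<circ> \<sigma>)"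
      using quotient_proj by (simp add: o_def h)
    show "continuous_map X (torus \<Lambda>) h"
      by (rule continuous_compose_quotient_map[OF \<sigma>]) (simp add: o_def h continuous_proj)
  qed
  moreover have "inj_on h (topspace X)"
  proof (rule inj_onI)
    fix p q assume "p \<in> topspace X" "q \<in> topspace X" "h p = h q"
    moreover have "p \<in> range \<sigma>" "q \<in> range \<sigma>"
      using quotient_imp_surjective_map[OF \<sigma>] calculation(1,2) by auto
    then obtain v w where "p = \<sigma> v" "q = \<sigma> w" by blast
    ultimately show "p = q" by (simp add: h torus_proj_eq ker)
  qed
  ultimately show thesis using that h by (simp add: homeomorphic_map_def)
qed

section \<open>Hypersurfaces whose periods do not span\<close>

locale minimal_hypersurface = lattice_basis L B
  for L :: "(real^'m) set" and B +
  fixes X :: "'b topology" and A :: "('b, real^'n) chart set" and f :: "'b \<Rightarrow> (real^'m) set" and x0 :: 'b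
  assumes full: "full_lattice L" and manifold: "smooth_manifold X A"
    and compact: "compact_space X" and connected: "connected_space X" and x0: "x0 \<in> topspace X"
    and minimal: "minimal_embedding X A L f"
begin

definition period_span :: "(real^'m) set" where "period_span = span (periods L X f x0)"

lemma card_m: "CARD('m) = CARD('n) + 1"
  and embedding: "smooth_embedding X A (torus L) (torus_atlas L) f"
  using minimal by (auto simp: minimal_embedding_def)

lemma atlas: "smooth_atlas X A" and Hausdorff: "Hausdorff_space X"
  using manifold by (auto simp: smooth_manifold_def)

lemma continuous_f: "continuous_map X (torus L) f"
  and homeomorphic_f: "homeomorphic_map X (subtopology (torus L) (f ` topspace X)) f"
  using embedding by (auto simp: smooth_embedding_def smooth_map_def embedding_map_def)

lemma inj_f: "inj_on f (topspace X)"
  by (rule homeomorphic_imp_injective_map[OF homeomorphic_f])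

lemma param_exists:
  assumes "p \<in> topspace X"
  obtains U \<phi> and F :: "real^'n \<Rightarrow> real^'m" and y
  where "local_param X L f U \<phi> F" "y \<in> U" "\<phi> y = p" "\<forall>y\<in>U. minimal_at F y"
  using minimal_param_exists[OF atlas full minimal assms] by metis

lemma decompose:
  obtains a b where "a \<in> period_span" "\<forall>w\<in>period_span. b \<bullet> w = 0" "v = a + b"
  using orthogonal_subspace_decomp_exists[of "periods L X f x0" v]
  unfolding period_span_def orthogonal_def by metis

lemma param_topspace: "local_param X L f U \<phi> F \<Longrightarrow> y \<in> U \<Longrightarrow> \<phi> y \<in> topspace X"
  by (auto simp: local_param_def continuous_map_def)

lemma param_linear:
  assumes "local_param X L f U \<phi> F" "y \<in> U" shows "linear (frechet_derivative F (at y))"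
  by (rule linear_frechet_derivative[OF local_param_differentiable[OF assms]])

lemma inj_on_param:
  assumes lp: "local_param X L f U \<phi> F" shows "inj_on F U"
proof (rule inj_onI)
  fix y z assume yz: "y \<in> U" "z \<in> U" "F y = F z"
  then have "f (\<phi> y) = f (\<phi> z)" using lp by (metis local_param_def)
  then have "\<phi> y = \<phi> z" using inj_f param_topspace[OF lp] yz by (auto dest: inj_onD)
  then show "y = z" using lp yz by (auto simp: local_param_def dest: inj_onD)
qed

text \<open>The component of a tangent vector orthogonal to the periods is the vector of a
  coordinate that must be constant, so this component is orthogonal to itself. All tangent spaces
  therefore lie in one fixed subspace.\<close>

lemma derivative_in_period_span:
  fixes G :: "real^'n \<Rightarrow> real^'m"
  assumes G: "local_param X L f V \<psi> G" "z \<in> V"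
  shows "frechet_derivative G (at z) w \<in> period_span"
proof -
  obtain a b where ab: "a \<in> period_span" "\<forall>w\<in>period_span. b \<bullet> w = 0"
      "frechet_derivative G (at z) w = a + b"
    using decompose .
  have "b \<bullet> frechet_derivative G (at z) w = 0"
  proof (rule coordinate_constant[OF compact connected x0 continuous_f _ _ G])
    show "\<exists>U (\<phi> :: real^'n \<Rightarrow> 'b) F y. local_param X L f U \<phi> F \<and> y \<in> U \<and> \<phi> y = p \<and> (\<forall>y\<in>U. minimal_at F y)"
      if p: "p \<in> topspace X" for p
      by (rule param_exists[OF p]) blast
    show "b \<bullet> v = 0" if "v \<in> periods L X f x0" for v
      using ab(2) that by (simp add: period_span_def span_base)
  qed
  then have "b \<bullet> b = 0" using ab(1,2) by (simp add: ab(3) inner_add_right)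
  then show ?thesis using ab by simp
qed

text \<open>A single tangent space already has dimension \<open>CARD('n)\<close>. With fewer
  generators than that this contradicts \<open>dim_periods_le\<close>.\<close>

lemma dim_period_span: "dim (periods L X f x0) \<ge> CARD('n)"
proof -
  obtain U \<phi> and F :: "real^'n \<Rightarrow> real^'m" and y where F: "local_param X L f U \<phi> F" "y \<in> U" "\<phi> y = x0"
    and "\<forall>y\<in>U. minimal_at F y"
    using param_exists[OF x0] .
  have "CARD('n) = dim (range (frechet_derivative F (at y)))"
    using dim_image_eq[OF param_linear[OF F(1,2)], of UNIV] F(1,2) by (simp add: local_param_def)
  also have "\<dots> \<le> dim period_span"
    by (rule dim_subset) (use derivative_in_period_span[OF F(1,2)] in blast)
  finally show ?thesis by (simp add: period_span_def)
qed

text \<open>Integrated form of the tangency: the part of the displacement orthogonal to the period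
  span has zero derivative on a convex ball.\<close>

lemma displacement:
  fixes F :: "real^'n \<Rightarrow> real^'m"
  assumes lp: "local_param X L f U \<phi> F" and b: "ball y0 r \<subseteq> U" and y: "y \<in> ball y0 r"
  shows "F y - F y0 \<in> period_span"
proof -
  obtain a b where ab: "a \<in> period_span" "\<forall>w\<in>period_span. b \<bullet> w = 0"
      "F y - F y0 = a + b"
    using decompose .
  have "((\<lambda>z. b \<bullet> F z) has_derivative (\<lambda>h. 0)) (at z within ball y0 r)" if z: "z \<in> ball y0 r" for z
  proof -
    have zU: "z \<in> U" using z \<open>ball y0 r \<subseteq> U\<close> by blast
    have "(F has_derivative frechet_derivative F (at z)) (at z)"
      using local_param_differentiable[OF lp zU] by (simp add: frechet_derivative_works)
    then have "((\<lambda>z. b \<bullet> F z) has_derivative (\<lambda>h. b \<bullet> frechet_derivative F (at z) h)) (at z)"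
      by (rule has_derivative_inner_right)
    then show ?thesis
      using ab(2) derivative_in_period_span[OF lp zU] by (simp add: has_derivative_at_withinI)
  qed
  then obtain c where c: "\<forall>z\<in>ball y0 r. b \<bullet> F z = c"
    using has_derivative_zero_constant[OF convex_ball] by blast
  have "y0 \<in> ball y0 r" using y by (metis ball_eq_empty centre_in_ball empty_iff not_le)
  then have "b \<bullet> (F y - F y0) = 0" using c y by (simp add: inner_diff_right)
  then have "b \<bullet> b = 0" using ab(1,2) by (simp add: ab(3) inner_add_right)
  then show ?thesis using ab by simp
qed

end

text \<open>Because the range of \<open>J\<close> is the period span, that span has dimension
  \<open>CARD('n)\<close> here. \<open>J\<close> identifies it isometrically with the model space;
  \<open>K\<close> is defined on the whole ambient space but inverts \<open>J\<close> only on the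
  span. The point \<open>a\<close> lifts the image of the base point, so a + J w runs through the
  candidate hyperplane.\<close>

locale flat_hypersurface = minimal_hypersurface L B X A f x0
  for L :: "(real^'m) set" and B and X :: "'b topology" and A :: "('b, real^'n) chart set" and f x0 +
  fixes J :: "real^'n \<Rightarrow> real^'m" and K :: "real^'m \<Rightarrow> real^'n" and a :: "real^'m"
  assumes linear_J: "linear J" and linear_K: "linear K" and range_J: "range J = period_span"
    and norm_J: "norm (J v) = norm v" and K_J: "K (J v) = v"
    and J_K: "w \<in> period_span \<Longrightarrow> J (K w) = w" and base: "torus_proj L a = f x0"
begin

definition leaf :: "real^'n \<Rightarrow> (real^'m) set" where "leaf w = torus_proj L (a + J w)"

definition leaf_lattice :: "(real^'n) set" where "leaf_lattice = {w. J w \<in> L}"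

text \<open>The covering of \<open>X\<close> by its tangent hyperplane, obtained by pulling
  \<open>leaf\<close> back through f. The value of \<open>inv_into\<close> becomes meaningful once
  \<open>leaf_in_image\<close> shows that the leaf stays inside the image of f.\<close>

definition \<sigma> :: "real^'n \<Rightarrow> 'b" where "\<sigma> w = inv_into (topspace X) f (leaf w)"

lemma leaf_eq: "leaf v = leaf w \<longleftrightarrow> v - w \<in> leaf_lattice"
  by (simp add: leaf_def leaf_lattice_def torus_proj_eq linear_diff[OF linear_J])

lemma continuous_K: "continuous_on UNIV K"
  using linear_K linear_continuous_on linear_conv_bounded_linear by blast

lemma continuous_leaf: "continuous_map euclidean (torus L) leaf"
proof -
  have "continuous_on UNIV (\<lambda>w. a + J w)"
    using linear_J linear_continuous_on linear_conv_bounded_linear by (intro continuous_intros) blast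
  then show ?thesis using proj_continuous_on[of UNIV] by (simp add: leaf_def[abs_def])
qed

text \<open>Displacements of the lift \<open>F\<close> lie in the period span, so \<open>K\<close>
  translates motion in the hypersurface into motion in the leaf coordinate. This transfer drives
  both open-closed arguments below.\<close>

lemma leaf_param:
  fixes F :: "real^'n \<Rightarrow> real^'m"
  assumes lp: "local_param X L f U \<phi> F" and b: "ball y0 r \<subseteq> U" and y: "y \<in> ball y0 r" "z \<in> ball y0 r"
    and w: "leaf w = f (\<phi> z)"
  shows "leaf (w + K (F y - F z)) = f (\<phi> y)"
proof -
  have "(F y - F y0) - (F z - F y0) \<in> period_span"
    unfolding period_span_def
    by (rule span_diff) (use displacement[OF lp b] y in \<open>auto simp: period_span_def\<close>)
  then have "F y - F z \<in> period_span" by simp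
  then have "leaf (w + K (F y - F z)) = torus_proj L ((a + J w) + (F y - F z))"
    by (simp add: leaf_def linear_add[OF linear_J] J_K add_ac)
  moreover have "torus_proj L (a + J w) = torus_proj L (F z)"
    using w lp y b by (auto simp: leaf_def local_param_def)
  then have "torus_proj L ((a + J w) + (F y - F z)) = torus_proj L (F y)"
    by (simp add: torus_proj_eq algebra_simps)
  ultimately show ?thesis using lp y(1) b by (auto simp: local_param_def)
qed

text \<open>\<open>K\<close> is injective on the period span and \<open>F\<close> is injective, so
  the map is injective and continuous between spaces of equal dimension; invariance of domain
  applies.\<close>

lemma open_leaf_coordinates:
  fixes F :: "real^'n \<Rightarrow> real^'m"
  assumes lp: "local_param X L f U \<phi> F" and b: "ball y0 r \<subseteq> U" and V: "open V" "V \<subseteq> ball y0 r"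
  shows "open ((\<lambda>y. w + K (F y - F y0)) ` V)"
proof (rule invariance_of_domain)
  have "continuous_on V F" by (rule continuous_on_subset[OF local_param_continuous[OF lp]]) (use b V in blast)
  then have "continuous_on V (\<lambda>y. F y - F y0)" by (intro continuous_intros)
  then have "continuous_on V (\<lambda>y. K (F y - F y0))" by (rule continuous_on_compose2[OF continuous_K]) simp
  then show "continuous_on V (\<lambda>y. w + K (F y - F y0))" by (intro continuous_intros)
  show "inj_on (\<lambda>y. w + K (F y - F y0)) V"
  proof (rule inj_onI)
    fix y z assume yz: "y \<in> V" "z \<in> V" "w + K (F y - F y0) = w + K (F z - F y0)"
    then have "J (K (F y - F y0)) = J (K (F z - F y0))" by simp
    moreover have "y \<in> ball y0 r" "z \<in> ball y0 r" using yz V(2) by auto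
    ultimately have "F y - F y0 = F z - F y0" by (simp only: J_K[OF displacement[OF lp b]])
    then have "F y = F z" by simp
    then show "y = z" using inj_on_param[OF lp] yz V(2) b by (auto dest: inj_onD)
  qed
qed (rule V(1))

lemma closedin_image_f: "closedin (torus L) (f ` topspace X)"
proof -
  have "compactin X (topspace X)" using compact by (simp only: compact_space_def)
  then have "compactin (torus L) (f ` topspace X)" by (rule image_compactin[OF _ continuous_f])
  then show ?thesis by (rule compactin_imp_closedin[OF Hausdorff_torus])
qed

text \<open>The parameters sent into the image of f form a closed set since that image is compact,
  and an open set since \<open>leaf_param\<close> follows the hypersurface over a whole
  neighbourhood of leaf coordinates. The origin belongs to it.\<close>

lemma leaf_in_image: "leaf w \<in> f ` topspace X"
proof -
  let ?C = "{w. leaf w \<in> f ` topspace X}"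
  have "closed ?C"
    using closedin_continuous_map_preimage[OF continuous_leaf closedin_image_f] by simp
  moreover have "open ?C"
    unfolding open_subopen[of ?C]
  proof (intro ballI)
    fix w assume "w \<in> ?C"
    then obtain p where p: "p \<in> topspace X" "leaf w = f p" by blast
    obtain U \<phi> and F :: "real^'n \<Rightarrow> real^'m" and y0 where lp: "local_param X L f U \<phi> F" and y0: "y0 \<in> U" "\<phi> y0 = p"
      and "\<forall>y\<in>U. minimal_at F y"
      using param_exists[OF p(1)] .
    obtain r where r: "r > 0" "ball y0 r \<subseteq> U" using local_param_ball[OF lp y0(1)] .
    show "\<exists>T. open T \<and> w \<in> T \<and> T \<subseteq> ?C"
    proof (intro exI conjI)
      show "open ((\<lambda>y. w + K (F y - F y0)) ` ball y0 r)"
        by (rule open_leaf_coordinates[OF lp r(2)]) auto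
      show "w \<in> (\<lambda>y. w + K (F y - F y0)) ` ball y0 r"
        using r(1) by (intro image_eqI[of _ _ y0]) (simp_all add: linear_0[OF linear_K])
      show "(\<lambda>y. w + K (F y - F y0)) ` ball y0 r \<subseteq> ?C"
      proof clarify
        fix y assume y: "y \<in> ball y0 r"
        have "leaf (w + K (F y - F y0)) = f (\<phi> y)"
          by (rule leaf_param[OF lp r(2) y]) (use r(1) p y0 in auto)
        then show "leaf (w + K (F y - F y0)) \<in> f ` topspace X"
          using param_topspace[OF lp] y r(2) by auto
      qed
    qed
  qed
  moreover have "0 \<in> ?C" using x0 base by (simp add: leaf_def linear_0[OF linear_J])
  ultimately have "?C = UNIV" using clopen[of ?C] by blast
  then show ?thesis by blast
qed

lemma f_\<sigma>: "f (\<sigma> w) = leaf w"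
  unfolding \<sigma>_def by (rule f_inv_into_f[OF leaf_in_image])

lemma \<sigma>_topspace: "\<sigma> w \<in> topspace X"
  unfolding \<sigma>_def by (rule inv_into_into[OF leaf_in_image])

lemma \<sigma>_eqI:
  assumes "p \<in> topspace X" "leaf w = f p" shows "\<sigma> w = p"
  unfolding \<sigma>_def assms(2) by (rule inv_into_f_f[OF inj_f assms(1)])

lemma \<sigma>_eq: "\<sigma> v = \<sigma> w \<longleftrightarrow> v - w \<in> leaf_lattice"
proof
  assume "\<sigma> v = \<sigma> w"
  then have "leaf v = leaf w" using f_\<sigma>[of v] f_\<sigma>[of w] by simp
  then show "v - w \<in> leaf_lattice" by (simp only: leaf_eq)
next
  assume "v - w \<in> leaf_lattice"
  then have "leaf v = leaf w" by (simp only: leaf_eq)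
  then show "\<sigma> v = \<sigma> w" unfolding \<sigma>_def by (rule arg_cong)
qed

lemma \<sigma>_param:
  fixes F :: "real^'n \<Rightarrow> real^'m"
  assumes lp: "local_param X L f U \<phi> F" and b: "ball y0 r \<subseteq> U" and y: "y \<in> ball y0 r"
    and w: "\<sigma> w = \<phi> y0"
  shows "\<sigma> (w + K (F y - F y0)) = \<phi> y"
proof (rule \<sigma>_eqI)
  have "y0 \<in> ball y0 r" using y by (metis ball_eq_empty centre_in_ball empty_iff not_le)
  then show "leaf (w + K (F y - F y0)) = f (\<phi> y)"
    by (rule leaf_param[OF lp b y]) (use w f_\<sigma>[of w] in simp)
  show "\<phi> y \<in> topspace X" using param_topspace[OF lp] b y by blast
qed

text \<open>The local formula \<open>\<sigma>_param\<close> yields continuity and openness together.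
  For surjectivity the range is open; it is also closed, for if a point near a missed point were
  hit, walking back in the parametrisation would hit the missed point too.\<close>

lemma quotient_\<sigma>: "quotient_map euclidean X \<sigma>"
proof (rule continuous_open_imp_quotient_map)
  show "continuous_map euclidean X \<sigma>"
    unfolding continuous_map_def
  proof (intro conjI allI impI)
    fix W assume W: "openin X W"
    have "open {w. \<sigma> w \<in> W}"
      unfolding open_subopen[of "{w. \<sigma> w \<in> W}"]
    proof (intro ballI)
      fix w assume "w \<in> {w. \<sigma> w \<in> W}"
      then have w: "\<sigma> w \<in> W" by simp
      obtain U \<phi> and F :: "real^'n \<Rightarrow> real^'m" and y0 where lp: "local_param X L f U \<phi> F" and y0: "y0 \<in> U" "\<phi> y0 = \<sigma> w"
        and "\<forall>y\<in>U. minimal_at F y"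
        using param_exists[OF \<sigma>_topspace] .
      have "\<phi> y0 \<in> W" using w y0(2) by simp
      obtain r where r: "r > 0" "ball y0 r \<subseteq> U" "\<phi> ` ball y0 r \<subseteq> W" "openin X (\<phi> ` ball y0 r)"
        using local_param_nhd[OF lp W y0(1) \<open>\<phi> y0 \<in> W\<close>] .
      show "\<exists>T. open T \<and> w \<in> T \<and> T \<subseteq> {w. \<sigma> w \<in> W}"
      proof (intro exI conjI)
        show "open ((\<lambda>y. w + K (F y - F y0)) ` ball y0 r)"
          by (rule open_leaf_coordinates[OF lp r(2)]) auto
        show "w \<in> (\<lambda>y. w + K (F y - F y0)) ` ball y0 r"
          using r(1) by (intro image_eqI[of _ _ y0]) (simp_all add: linear_0[OF linear_K])
        show "(\<lambda>y. w + K (F y - F y0)) ` ball y0 r \<subseteq> {w. \<sigma> w \<in> W}"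
          using \<sigma>_param[OF lp r(2) _ y0(2)[symmetric]] r(3) by auto
      qed
    qed
    then show "openin euclidean {w \<in> topspace euclidean. \<sigma> w \<in> W}" by simp
  qed (simp add: \<sigma>_topspace)
  show open_\<sigma>: "open_map euclidean X \<sigma>"
    unfolding open_map_def
  proof (intro allI impI)
    fix V :: "(real^'n) set" assume "openin euclidean V"
    then have V: "open V" by simp
    show "openin X (\<sigma> ` V)"
    proof (subst openin_subopen, intro ballI)
      fix p assume "p \<in> \<sigma> ` V"
      then obtain w where w: "w \<in> V" "p = \<sigma> w" by blast
      obtain U \<phi> and F :: "real^'n \<Rightarrow> real^'m" and y0 where lp: "local_param X L f U \<phi> F" and y0: "y0 \<in> U" "\<phi> y0 = \<sigma> w"
        and "\<forall>y\<in>U. minimal_at F y"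
        using param_exists[OF \<sigma>_topspace] .
      obtain r where r: "r > 0" "ball y0 r \<subseteq> U" using local_param_ball[OF lp y0(1)] .
      let ?q = "\<lambda>y. w + K (F y - F y0)"
      have "continuous_on (ball y0 r) F" by (rule continuous_on_subset[OF local_param_continuous[OF lp] r(2)])
      then have "continuous_on (ball y0 r) (\<lambda>y. F y - F y0)" by (intro continuous_intros)
      then have "continuous_on (ball y0 r) (\<lambda>y. K (F y - F y0))" by (rule continuous_on_compose2[OF continuous_K]) simp
      then have "continuous_on (ball y0 r) ?q" by (intro continuous_intros)
      then have o: "open (ball y0 r \<inter> ?q -` V)" using V by (intro continuous_open_preimage) auto
      show "\<exists>T. openin X T \<and> p \<in> T \<and> T \<subseteq> \<sigma> ` V"
      proof (intro exI conjI)
        show "openin X (\<phi> ` (ball y0 r \<inter> ?q -` V))"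
          using lp o r(2) by (auto simp: local_param_def)
        show "p \<in> \<phi> ` (ball y0 r \<inter> ?q -` V)"
          using r(1) y0 w by (intro image_eqI[of _ _ y0]) (simp_all add: linear_0[OF linear_K])
        show "\<phi> ` (ball y0 r \<inter> ?q -` V) \<subseteq> \<sigma> ` V"
        proof clarify
          fix y assume y: "y \<in> ball y0 r" "?q y \<in> V"
          have "\<phi> y = \<sigma> (?q y)" using \<sigma>_param[OF lp r(2) y(1) y0(2)[symmetric]] by simp
          then show "\<phi> y \<in> \<sigma> ` V" using y(2) by blast
        qed
      qed
    qed
  qed
  have "openin X (range \<sigma>)" using open_\<sigma> by (simp add: open_map_def)
  moreover have "openin X (topspace X - range \<sigma>)"
  proof (subst openin_subopen, intro ballI)
    fix p assume p: "p \<in> topspace X - range \<sigma>"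
    then have pX: "p \<in> topspace X" by blast
    obtain U \<phi> and F :: "real^'n \<Rightarrow> real^'m" and y0 where lp: "local_param X L f U \<phi> F" and y0: "y0 \<in> U" "\<phi> y0 = p"
      and "\<forall>y\<in>U. minimal_at F y"
      using param_exists[OF pX] .
    obtain r where r: "r > 0" "ball y0 r \<subseteq> U" using local_param_ball[OF lp y0(1)] .
    have "\<phi> y \<notin> range \<sigma>" if y: "y \<in> ball y0 r" for y
    proof
      assume "\<phi> y \<in> range \<sigma>"
      then obtain w where w: "\<phi> y = \<sigma> w" by blast
      have "leaf (w + K (F y0 - F y)) = f (\<phi> y0)"
        by (rule leaf_param[OF lp r(2) _ y]) (use r(1) w f_\<sigma> in auto)
      then have "\<sigma> (w + K (F y0 - F y)) = p" using p y0(2) by (intro \<sigma>_eqI) auto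
      then show False using p by blast
    qed
    moreover have op: "openin X (\<phi> ` ball y0 r)" using lp r(2) by (simp add: local_param_def)
    moreover have "\<phi> y \<in> topspace X" if "y \<in> ball y0 r" for y
      using param_topspace[OF lp] that r(2) by blast
    ultimately have "\<phi> ` ball y0 r \<subseteq> topspace X - range \<sigma>"
      by (intro image_subsetI DiffI)
    moreover have "p \<in> \<phi> ` ball y0 r" using r(1) y0(2) by auto
    ultimately show "\<exists>T. openin X T \<and> p \<in> T \<and> T \<subseteq> topspace X - range \<sigma>"
      using op by blast
  qed
  ultimately have "range \<sigma> = {} \<or> range \<sigma> = topspace X"
    using connected \<sigma>_topspace unfolding connected_space_clopen_in
    by (auto simp: closedin_def)
  then show "\<sigma> ` topspace euclidean = topspace X" by auto
qed

text \<open>\<open>J\<close> embeds \<open>leaf_lattice\<close> as a subgroup of \<open>L\<close>,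
  which gives it a basis independent over the reals; \<open>K\<close> carries this basis back to the
  model space. Compactness of \<open>X\<close> then forces full rank.\<close>

lemma full_lattice_leaf_lattice: "full_lattice leaf_lattice"
proof -
  have zero: "0 \<in> J ` leaf_lattice" by (auto simp: leaf_lattice_def linear_0[OF linear_J] zero_L image_iff intro!: exI[of _ 0])
  have diff: "u - v \<in> J ` leaf_lattice" if uv: "u \<in> J ` leaf_lattice" "v \<in> J ` leaf_lattice" for u v
  proof -
    obtain u' v' where "u = J u'" "v = J v'" "J u' \<in> L" "J v' \<in> L"
      using uv by (auto simp: leaf_lattice_def)
    then have "u - v = J (u' - v')" "J (u' - v') \<in> L" by (auto simp: linear_diff[OF linear_J] diff_L)
    then show ?thesis by (auto simp: leaf_lattice_def)
  qed
  have "J ` leaf_lattice \<subseteq> L" by (auto simp: leaf_lattice_def)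
  also have "L = int_span B" unfolding int_span_def by (rule L_eq)
  finally have "J ` leaf_lattice \<subseteq> int_span B" .
  then obtain C where C: "finite C" "independent C" "J ` leaf_lattice = int_span C"
    using subgroup_int_basis[OF finite_B indep _ zero diff] by blast
  have CP: "C \<subseteq> period_span"
  proof
    fix c assume c: "c \<in> C"
    have "c = (\<Sum>x\<in>C. of_int (if x = c then 1 else 0) *\<^sub>R x)"
      using C(1) c by (simp add: if_distrib[of of_int] if_distrib[of "\<lambda>r. r *\<^sub>R _"] cong: if_cong)
    then have "c \<in> int_span C"
      unfolding int_span_def by (intro CollectI exI[of _ "\<lambda>x. if x = c then 1 else 0"])
    then show "c \<in> period_span" using C(3) range_J by blast
  qed
  have "span C \<subseteq> period_span" unfolding period_span_def
    by (rule span_minimal) (use CP in \<open>auto simp: period_span_def\<close>)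
  then have injK: "inj_on K (span C)" using J_K by (metis inj_on_def subsetD)
  have "leaf_lattice = K ` int_span C" unfolding C(3)[symmetric] by (force simp: K_J image_iff)
  also have "\<dots> = int_span (K ` C)"
  proof -
    have inj: "inj_on K C" by (rule inj_on_subset[OF injK span_superset])
    have "(\<exists>m. v = K (\<Sum>b\<in>C. of_int (m b) *\<^sub>R b)) \<longleftrightarrow> (\<exists>m. v = (\<Sum>b\<in>K ` C. of_int (m b) *\<^sub>R b))"
      (is "(\<exists>m::_ \<Rightarrow> int. ?P m) \<longleftrightarrow> (\<exists>m::_ \<Rightarrow> int. ?Q m)") for v
    proof
      assume "\<exists>m::_ \<Rightarrow> int. ?P m"
      then obtain m :: "real^'m \<Rightarrow> int" where "?P m" by blast
      then have "v = (\<Sum>b\<in>C. of_int (m (inv_into C K (K b))) *\<^sub>R K b)"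
        by (simp add: linear_sum[OF linear_K] linear_scale[OF linear_K] inj)
      then have "?Q (m \<circ> inv_into C K)" by (simp add: sum.reindex[OF inj])
      then show "\<exists>m::_ \<Rightarrow> int. ?Q m" by blast
    next
      assume "\<exists>m::_ \<Rightarrow> int. ?Q m"
      then obtain m :: "real^'n \<Rightarrow> int" where "?Q m" by blast
      then have "?P (m \<circ> K)"
        by (simp add: linear_sum[OF linear_K] linear_scale[OF linear_K] sum.reindex[OF inj])
      then show "\<exists>m::_ \<Rightarrow> int. ?P m" by blast
    qed
    then show ?thesis unfolding int_span_def by (auto simp: image_iff)
  qed
  finally have lat: "leaf_lattice = int_span (K ` C)" .
  have "independent (K ` C)"
    by (rule linear_independent_injective_image[OF linear_K C(2) injK])
  then show ?thesis
    using full_lattice_if_compact_quotient[OF quotient_\<sigma> compact \<sigma>_eq _ _ lat] C(1) by simp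
qed

section \<open>Comparison of the induced metric with the flat metric of the quotient\<close>

lemma norm_K: "w \<in> period_span \<Longrightarrow> norm (K w) = norm w"
  using norm_J[of "K w"] by (simp add: J_K)

lemma inner_K:
  assumes "v \<in> period_span" "w \<in> period_span" shows "K v \<bullet> K w = v \<bullet> w"
proof -
  have "v + w \<in> period_span" using assms span_add unfolding period_span_def by blast
  then show ?thesis
    using norm_K[of v] norm_K[of w] norm_K[of "v + w"] assms
    by (simp add: dot_norm linear_add[OF linear_K])
qed

text \<open>The chart \<open>e\<close> inverts the projection on an open set \<open>V\<close>. As
  long as the leaf coordinate stays in \<open>V\<close> it is the coordinate expression of h, and
  that expression is \<open>K\<close> applied to the lift of f, up to a constant.\<close>

lemma local_rep_flat:
  assumes h: "homeomorphic_map X (torus leaf_lattice) h" "\<And>w. h (\<sigma> w) = torus_proj leaf_lattice w"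
    and c: "c \<in> A" and d: "d \<in> torus_atlas L" and e: "e \<in> torus_atlas leaf_lattice"
    and y0: "y0 \<in> local_dom c d f" "y0 \<in> local_dom c e h"
  obtains r where "r > 0" "ball y0 r \<subseteq> local_dom c d f" "ball y0 r \<subseteq> local_dom c e h"
    "\<forall>y\<in>ball y0 r. local_rep c e h y =
       local_rep c e h y0 + K (local_rep c d f y - local_rep c d f y0)"
proof -
  let ?\<phi> = "inv_into (fst c) (snd c)" and ?F = "local_rep c d f"
  have lp: "local_param X L f (local_dom c d f) ?\<phi> ?F"
    by (rule local_param_chart(1)[OF atlas full embedding c d])
  have ch: "is_chart X c" using atlas c by (simp add: smooth_atlas_def)
  have ech: "is_chart (torus leaf_lattice) e" by (rule is_chart_torus[OF full_lattice_leaf_lattice e])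
  have oh: "open (local_dom c e h)"
    by (rule open_local_dom(1)[OF ch homeomorphic_imp_continuous_map[OF h(1)]])
      (use ech in \<open>simp add: is_chart_def\<close>)
  obtain V where V: "open V" "inj_on (torus_proj leaf_lattice) V"
      "e = (torus_proj leaf_lattice ` V, inv_into V (torus_proj leaf_lattice))"
    using e by (auto simp: torus_atlas_def)
  define w0 where "w0 = local_rep c e h y0"
  have y0e: "h (?\<phi> y0) \<in> fst e"
    using y0(2) chart_inverse_simps(2)[OF ch] by (auto simp: local_dom_def)
  then have w0V: "w0 \<in> V" unfolding w0_def local_rep_def V(3) by (simp add: inv_into_into)
  have "torus_proj leaf_lattice w0 = h (?\<phi> y0)"
    unfolding w0_def local_rep_def using torus_chart_proj[OF e y0e] by simp
  then have "h (\<sigma> w0) = h (?\<phi> y0)" by (simp only: h(2))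
  then have w0: "\<sigma> w0 = ?\<phi> y0"
    by (rule inj_onD[OF homeomorphic_imp_injective_map[OF h(1)] _ \<sigma>_topspace param_topspace[OF lp y0(1)]])
  have o: "open (local_dom c d f \<inter> local_dom c e h)" using lp oh by (auto simp: local_param_def)
  obtain r1 where r1: "r1 > 0" "ball y0 r1 \<subseteq> local_dom c d f \<inter> local_dom c e h"
    using openE[OF o, of y0] y0 by blast
  let ?q = "\<lambda>y. w0 + K (?F y - ?F y0)"
  have "continuous_on (ball y0 r1) ?F"
    by (rule continuous_on_subset[OF local_param_continuous[OF lp]]) (use r1 in blast)
  then have "continuous_on (ball y0 r1) (\<lambda>y. ?F y - ?F y0)" by (intro continuous_intros)
  then have "continuous_on (ball y0 r1) (\<lambda>y. K (?F y - ?F y0))" by (rule continuous_on_compose2[OF continuous_K]) simp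
  then have "continuous_on (ball y0 r1) ?q" by (intro continuous_intros)
  then have o2: "open (ball y0 r1 \<inter> ?q -` V)" using V(1) by (intro continuous_open_preimage) auto
  have "y0 \<in> ball y0 r1 \<inter> ?q -` V" using r1(1) w0V by (simp add: linear_0[OF linear_K])
  then obtain r where r: "r > 0" "ball y0 r \<subseteq> ball y0 r1 \<inter> ?q -` V" using openE[OF o2] by blast
  show thesis
  proof (rule that[OF r(1)])
    show sub: "ball y0 r \<subseteq> local_dom c d f" "ball y0 r \<subseteq> local_dom c e h" using r(2) r1(2) by auto
    show "\<forall>y\<in>ball y0 r. local_rep c e h y = local_rep c e h y0 + K (?F y - ?F y0)"
    proof
      fix y assume y: "y \<in> ball y0 r"
      have "h (?\<phi> y) = torus_proj leaf_lattice (?q y)"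
        using \<sigma>_param[OF lp sub(1) y w0] h(2) by metis
      moreover have "?q y \<in> V" using r(2) y by auto
      ultimately have "snd e (h (?\<phi> y)) = ?q y" using V(2,3) by simp
      then show "local_rep c e h y = local_rep c e h y0 + K (?F y - ?F y0)"
        by (simp add: local_rep_def w0_def)
    qed
  qed
qed

lemma chart_at:
  assumes "c \<in> A" "y \<in> local_dom c e h"
  obtains d where "d \<in> torus_atlas L" "y \<in> local_dom c d f"
proof -
  obtain p where p: "p \<in> fst c" "y = snd c p" using assms(2) by (auto simp: local_dom_def)
  have "is_chart X c" using atlas assms(1) by (simp add: smooth_atlas_def)
  then have "p \<in> topspace X" using chart_inverse_simps(5) p(1) by blast
  then have "f p \<in> topspace (torus L)" using continuous_f by (auto simp: continuous_map_def)
  then obtain x where x: "f p = torus_proj L x" by (auto simp: topspace_torus)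
  obtain d where "d \<in> torus_atlas L" "torus_proj L x \<in> fst d" "snd d (torus_proj L x) = x"
    using torus_chart_through[OF full] .
  then show thesis using p x by (intro that[of d]) (auto simp: local_dom_def)
qed

lemma local_rep_flat_derivative:
  assumes h: "homeomorphic_map X (torus leaf_lattice) h" "\<And>w. h (\<sigma> w) = torus_proj leaf_lattice w"
    and c: "c \<in> A" and d: "d \<in> torus_atlas L" and e: "e \<in> torus_atlas leaf_lattice"
    and y0: "y0 \<in> local_dom c d f" "y0 \<in> local_dom c e h"
  shows "frechet_derivative (local_rep c e h) (at y0) v = K (frechet_derivative (local_rep c d f) (at y0) v)"
proof -
  let ?F = "local_rep c d f"
  have lp: "local_param X L f (local_dom c d f) (inv_into (fst c) (snd c)) ?F"
    by (rule local_param_chart(1)[OF atlas full embedding c d])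
  obtain r where r: "r > 0" "ball y0 r \<subseteq> local_dom c d f" "ball y0 r \<subseteq> local_dom c e h"
    "\<forall>y\<in>ball y0 r. local_rep c e h y = local_rep c e h y0 + K (?F y - ?F y0)"
    using local_rep_flat[OF assms] .
  have "y0 \<in> ball y0 r" using r(1) by (simp only: centre_in_ball)
  then have "frechet_derivative (local_rep c e h) (at y0) =
      frechet_derivative (\<lambda>y. local_rep c e h y0 + K (?F y - ?F y0)) (at y0)"
    by (rule frechet_derivative_cong_open[OF open_ball]) (use r(4) in blast)
  moreover have "(?F has_derivative frechet_derivative ?F (at y0)) (at y0)"
    using local_param_differentiable[OF lp y0(1)] by (simp add: frechet_derivative_works)
  then have "((\<lambda>y. ?F y - ?F y0) has_derivative frechet_derivative ?F (at y0)) (at y0)"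
    using has_derivative_diff[OF _ has_derivative_const] by fastforce
  then have "((\<lambda>y. K (?F y - ?F y0)) has_derivative (\<lambda>v. K (frechet_derivative ?F (at y0) v))) (at y0)"
    by (rule bounded_linear.has_derivative[OF linear_K[unfolded linear_conv_bounded_linear]])
  then have "((\<lambda>y. local_rep c e h y0 + K (?F y - ?F y0)) has_derivative
      (\<lambda>v. 0 + K (frechet_derivative ?F (at y0) v))) (at y0)"
    by (rule has_derivative_add[OF has_derivative_const])
  ultimately show ?thesis by (simp add: frechet_derivative_at[symmetric])
qed

lemma smooth_local_rep_flat:
  assumes h: "homeomorphic_map X (torus leaf_lattice) h" "\<And>w. h (\<sigma> w) = torus_proj leaf_lattice w"
    and c: "c \<in> A" and e: "e \<in> torus_atlas leaf_lattice"
  shows "smooth_on (local_dom c e h) (local_rep c e h)"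
proof (rule smooth_on_local)
  fix y0 assume y0: "y0 \<in> local_dom c e h"
  obtain d where d: "d \<in> torus_atlas L" "y0 \<in> local_dom c d f" using chart_at[OF c y0] .
  let ?F = "local_rep c d f"
  obtain r where r: "r > 0" "ball y0 r \<subseteq> local_dom c d f" "ball y0 r \<subseteq> local_dom c e h"
    "\<forall>y\<in>ball y0 r. local_rep c e h y = local_rep c e h y0 + K (?F y - ?F y0)"
    using local_rep_flat[OF h c d(1) e d(2) y0] .
  have "local_param X L f (local_dom c d f) (inv_into (fst c) (snd c)) ?F"
    by (rule local_param_chart(1)[OF atlas full embedding c d(1)])
  then have F: "smooth_on (ball y0 r) ?F"
    using r(2) smooth_on_subset unfolding local_param_def by blast
  have "C_on k (ball y0 r) (\<lambda>y. (local_rep c e h y0 - K (?F y0)) + K (?F y))" for k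
    using F unfolding smooth_on_def
    by (intro C_on_add C_on_const open_ball
        C_on_bounded_linear_compose[OF open_ball linear_K[unfolded linear_conv_bounded_linear]]) simp
  moreover have "(local_rep c e h y0 - K (?F y0)) + K (?F y) = local_rep c e h y" if "y \<in> ball y0 r" for y
    using r(4) that by (simp add: linear_diff[OF linear_K])
  ultimately have "C_on k (ball y0 r) (local_rep c e h)" for k
    by (rule C_on_cong[OF open_ball, rotated])
  then show "\<exists>T. open T \<and> y0 \<in> T \<and> smooth_on T (local_rep c e h)"
    using r(1) by (intro exI[of _ "ball y0 r"]) (simp add: smooth_on_def)
qed

text \<open>In coordinates the derivative of h is \<open>K\<close> after the derivative of f. On
  tangent vectors \<open>K\<close> preserves inner products, so the metrics agree; it is also
  injective there, so \<open>smooth_on_inverse_function\<close> gives smoothness of the inverse of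
  h.\<close>

theorem flat_torus: "induced_flat_torus X A L f"
proof -
  obtain h where h: "homeomorphic_map X (torus leaf_lattice) h" "\<And>w. h (\<sigma> w) = torus_proj leaf_lattice w"
    by (rule flat_torus_homeomorphism[OF quotient_\<sigma> full_lattice_leaf_lattice \<sigma>_eq]) (rule that)
  let ?hi = "inv_into (topspace X) h"
  have inj_h: "inj_on h (topspace X)" by (rule homeomorphic_imp_injective_map[OF h(1)])
  have sur: "h ` topspace X = topspace (torus leaf_lattice)" by (rule homeomorphic_imp_surjective_map[OF h(1)])
  have cont_h: "continuous_map X (torus leaf_lattice) h" by (rule homeomorphic_imp_continuous_map[OF h(1)])
  have sm: "smooth_map X A (torus leaf_lattice) (torus_atlas leaf_lattice) h"
    unfolding smooth_map_def using cont_h smooth_local_rep_flat[OF h] by blast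
  have "continuous_map (torus leaf_lattice) X ?hi"
  proof -
    obtain g where g: "homeomorphic_maps X (torus leaf_lattice) h g" using h(1) homeomorphic_map_maps by blast
    have "g s = ?hi s" if s: "s \<in> topspace (torus leaf_lattice)" for s
    proof -
      have "g s \<in> topspace X" "h (g s) = s"
        using g s by (auto simp: homeomorphic_maps_def continuous_map_def)
      then show ?thesis using inj_h by (metis inv_into_f_f)
    qed
    then show ?thesis using g continuous_map_eq unfolding homeomorphic_maps_def by metis
  qed
  moreover have "smooth_on (local_dom e c ?hi) (local_rep e c ?hi)"
    if e: "e \<in> torus_atlas leaf_lattice" and c: "c \<in> A" for e c
  proof -
    let ?G = "local_rep c e h" and ?D = "local_dom c e h"
    have ch: "is_chart X c" using atlas c by (simp add: smooth_atlas_def)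
    have ech: "is_chart (torus leaf_lattice) e" by (rule is_chart_torus[OF full_lattice_leaf_lattice e])
    have cX: "fst c \<subseteq> topspace X" by (rule chart_inverse_simps(5)[OF ch])
    have eX: "fst e \<subseteq> topspace (torus leaf_lattice)" by (rule chart_inverse_simps(5)[OF ech])
    have G: "?G (snd c p) = snd e (h p)" if "p \<in> fst c" for p
      using chart_inverse_simps(2)[OF ch that] by (simp add: local_rep_def)
    have D: "?D = snd c ` {p \<in> fst c. h p \<in> fst e}" unfolding local_dom_def by auto
    have oD: "open ?D" 
      by (rule open_local_dom(1)[OF ch cont_h]) (use ech in \<open>simp add: is_chart_def\<close>)
    have injG: "inj_on ?G ?D"
    proof (rule inj_onI)
      fix y z assume yz: "y \<in> ?D" "z \<in> ?D" "?G y = ?G z"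
      then obtain p q where pq: "p \<in> fst c" "h p \<in> fst e" "y = snd c p" "q \<in> fst c" "h q \<in> fst e" "z = snd c q"
        unfolding D by blast
      then have "snd e (h p) = snd e (h q)" using yz(3) G by simp
      then have "h p = h q" using chart_inverse_simps(1)[OF ech] pq by (auto dest: inj_onD)
      then have "p = q" using inj_h cX pq by (auto dest: inj_onD)
      then show "y = z" using pq by simp
    qed
    have imm: "inj (frechet_derivative ?G (at y))" if y: "y \<in> ?D" for y
    proof (rule injI)
      fix u v assume uv: "frechet_derivative ?G (at y) u = frechet_derivative ?G (at y) v"
      obtain d where d: "d \<in> torus_atlas L" "y \<in> local_dom c d f" using chart_at[OF c y] .
      have lp: "local_param X L f (local_dom c d f) (inv_into (fst c) (snd c)) (local_rep c d f)"
        by (rule local_param_chart(1)[OF atlas full embedding c d(1)])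
      have "J (K (frechet_derivative (local_rep c d f) (at y) u)) = J (K (frechet_derivative (local_rep c d f) (at y) v))"
        using uv by (simp only: local_rep_flat_derivative[OF h c d(1) e d(2) y])
      then have "frechet_derivative (local_rep c d f) (at y) u = frechet_derivative (local_rep c d f) (at y) v"
        by (simp only: J_K[OF derivative_in_period_span[OF lp d(2)]])
      then show "u = v" using lp d(2) unfolding local_param_def by (auto dest: injD)
    qed
    note inv = smooth_on_inverse_function[OF oD smooth_local_rep_flat[OF h c e] injG imm]
    have hp: "?hi (h p) = p" if "p \<in> fst c" for p using inj_h cX that by auto
    have dom: "local_dom e c ?hi = ?G ` ?D"
    proof
      show "local_dom e c ?hi \<subseteq> ?G ` ?D"
      proof
        fix x assume "x \<in> local_dom e c ?hi"
        then obtain s where s: "s \<in> fst e" "?hi s \<in> fst c" "x = snd e s" by (auto simp: local_dom_def)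
        have "s \<in> h ` topspace X" using s(1) eX sur by auto
        then have "h (?hi s) = s" by (rule f_inv_into_f)
        then show "x \<in> ?G ` ?D"
          using s G[OF s(2)] by (intro image_eqI[of _ _ "snd c (?hi s)"]) (auto simp: D)
      qed
      show "?G ` ?D \<subseteq> local_dom e c ?hi"
        unfolding D local_dom_def using G hp by auto
    qed
    have "inv_into ?D ?G x = local_rep e c ?hi x" if x: "x \<in> ?G ` ?D" for x
    proof -
      obtain p where p: "p \<in> fst c" "h p \<in> fst e" "x = ?G (snd c p)" using x unfolding D by blast
      have "inv_into ?D ?G x = snd c p" unfolding p(3) by (rule inv_into_f_f[OF injG]) (use p in \<open>auto simp: D\<close>)
      moreover have "local_rep e c ?hi x = snd c p"
        using p(3) G[OF p(1)] chart_inverse_simps(2)[OF ech p(2)] hp[OF p(1)] by (simp add: local_rep_def)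
      ultimately show ?thesis by simp
    qed
    then have "smooth_on (?G ` ?D) (local_rep e c ?hi)"
      using smooth_on_cong[OF inv(1) _ inv(2)] by blast
    then show ?thesis by (simp only: dom)
  qed
  ultimately have "smooth_map (torus leaf_lattice) (torus_atlas leaf_lattice) X A ?hi"
    unfolding smooth_map_def by blast
  then have "diffeomorphism X A (torus leaf_lattice) (torus_atlas leaf_lattice) h"
    unfolding diffeomorphism_def using h(1) sm by blast
  moreover have "first_fundamental_form (local_rep c d f) y u v = first_fundamental_form (local_rep c e h) y u v"
    if "c \<in> A" "d \<in> torus_atlas L" "e \<in> torus_atlas leaf_lattice" "y \<in> local_dom c d f \<inter> local_dom c e h"
    for c d e y u v
  proof -
    have y: "y \<in> local_dom c d f" "y \<in> local_dom c e h" using that by auto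
    have lp: "local_param X L f (local_dom c d f) (inv_into (fst c) (snd c)) (local_rep c d f)"
      by (rule local_param_chart(1)[OF atlas full embedding that(1,2)])
    show ?thesis
      unfolding first_fundamental_form_def local_rep_flat_derivative[OF h that(1-3) y]
      by (simp only: inner_K[OF derivative_in_period_span[OF lp y(1)] derivative_in_period_span[OF lp y(1)]])
  qed
  ultimately show ?thesis
    unfolding induced_flat_torus_def using full_lattice_leaf_lattice by blast
qed

end

section \<open>Generators of the fundamental group of a flat torus\<close>

lemma number_of_generators_leI:
  assumes "S \<subseteq> carrier G" "finite S" "generate G S = carrier G"
  shows "number_of_generators G \<le> enat (card S)"
  unfolding number_of_generators_def by (rule INF_lower) (use assms in simp)

text \<open>Every loop is homotopic to the projection of a straight segment between lifts of its
  ends, so its class depends only on a lattice vector. This makes c a surjective homomorphism from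
  the lattice onto the fundamental group, and the images of a lattice basis generate.\<close>

lemma number_of_generators_torus:
  fixes \<Lambda> :: "'a::euclidean_space set"
  assumes h: "homeomorphic_map X (torus \<Lambda>) h" and L: "full_lattice \<Lambda>" and x: "x \<in> topspace X"
  shows "number_of_generators (fundamental_group X x) \<le> enat DIM('a)"
proof -
  let ?G = "fundamental_group X x" and ?I = "top_of_set {0..1::real}"
  obtain B where "lattice_basis \<Lambda> B" using full_lattice_obtain[OF L] .
  then interpret lattice_basis \<Lambda> B .
  interpret G: group ?G by (rule group_fundamental_group[OF x])
  obtain g where g: "homeomorphic_maps X (torus \<Lambda>) h g" using h homeomorphic_map_maps by blast
  have cg: "continuous_map (torus \<Lambda>) X g" and ch: "continuous_map X (torus \<Lambda>) h"
    and gh: "\<And>p. p \<in> topspace X \<Longrightarrow> g (h p) = p"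
    using g by (auto simp: homeomorphic_maps_def)
  have "h x \<in> topspace (torus \<Lambda>)" using ch x by (auto simp: continuous_map_def)
  then obtain a where a: "torus_proj \<Lambda> a = h x" by (auto simp: topspace_torus)
  \<comment> \<open>Two lifts with common end points are joined by the straight-line homotopy in
    Euclidean space, which is then projected and carried to \<open>X\<close> by g.\<close>
  have homotopic: "(p, q) \<in> loop_homotopy X x"
    if u: "continuous_on {0..1} u" and v: "continuous_on {0..1} v"
      and e: "u 0 = v 0" "u 1 = v 1" "torus_proj \<Lambda> (u 0) = h x" "torus_proj \<Lambda> (u 1) = h x"
      and p: "\<And>t. t \<in> {0..1} \<Longrightarrow> p t = g (torus_proj \<Lambda> (u t))"
      and q: "\<And>t. t \<in> {0..1} \<Longrightarrow> q t = g (torus_proj \<Lambda> (v t))" for p q u v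
  proof -
    let ?m = "\<lambda>z. (1 - fst z) *\<^sub>R u (snd z) + fst z *\<^sub>R v (snd z)"
    let ?H = "\<lambda>z. g (torus_proj \<Lambda> (?m z))"
    have "continuous_on ({0..1} \<times> {0..1}) (\<lambda>z. u (snd z))" "continuous_on ({0..1} \<times> {0..1}) (\<lambda>z. v (snd z))"
      by (rule continuous_on_compose2[OF u] continuous_on_compose2[OF v]; auto intro!: continuous_intros)+
    then have "continuous_on ({0..1::real} \<times> {0..1::real}) ?m" by (intro continuous_intros)
    from continuous_map_compose[OF proj_continuous_on[OF this] cg]
    have "continuous_map (prod_topology ?I ?I) X ?H"
      by (simp add: o_def prod_topology_subtopology euclidean_product_topology subtopology_subtopology Times_Int_Times)
    then have "homotopic_with (\<lambda>r. r 0 = x \<and> r 1 = x) ?I X (\<lambda>t. g (torus_proj \<Lambda> (u t))) (\<lambda>t. g (torus_proj \<Lambda> (v t)))"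
      unfolding homotopic_with_def
      using e gh[OF x] by (intro exI[of _ ?H]) (auto simp flip: scaleR_add_left)
    then have "homotopic_with (\<lambda>r. r 0 = x \<and> r 1 = x) ?I X p q"
      by (rule homotopic_with_eq) (use p q in auto)
    then show ?thesis by (simp add: loop_homotopy_iff)
  qed
  define \<gamma> where "\<gamma> l t = g (torus_proj \<Lambda> (a + t *\<^sub>R l))" for l t
  have line: "continuous_on A (\<lambda>t. a + t *\<^sub>R l)" for A and l by (intro continuous_intros)
  have ends: "torus_proj \<Lambda> (a + 0 *\<^sub>R l) = h x" "l \<in> \<Lambda> \<Longrightarrow> torus_proj \<Lambda> (a + 1 *\<^sub>R l) = h x" for l
    using a proj_shift by auto
  have \<gamma>: "\<gamma> l \<in> loops X x" if "l \<in> \<Lambda>" for l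
    using loop_homotopy_subset[of X x] homotopic[OF line line refl refl ends(1) ends(2)[OF that], of "\<gamma> l" "\<gamma> l"]
    by (auto simp: \<gamma>_def)
  define c where "c l = loop_class X x (\<gamma> l)" for l
  have cI: "c l = loop_class X x p"
    if "l \<in> \<Lambda>" "continuous_on {0..1} u" "u 0 = a" "u 1 = a + l"
      "\<And>t. t \<in> {0..1} \<Longrightarrow> p t = g (torus_proj \<Lambda> (u t))" for l p u
    unfolding c_def
  proof (rule equiv_class_eq[OF equiv_loop_homotopy])
    show "(\<gamma> l, p) \<in> loop_homotopy X x"
      by (rule homotopic[OF line that(2)]) (use that ends in \<open>auto simp: \<gamma>_def\<close>)
  qed
  have c_carrier: "c l \<in> carrier ?G" if "l \<in> \<Lambda>" for l
    using \<gamma>[OF that] by (auto simp: c_def carrier_fundamental_group)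
  have c_add: "c l \<otimes>\<^bsub>?G\<^esub> c m = c (l + m)" if lm: "l \<in> \<Lambda>" "m \<in> \<Lambda>" for l m
  proof -
    let ?u = "\<lambda>t. if t \<le> 1/2 then a + (2 * t) *\<^sub>R l else (a + l) + (2 * t - 1) *\<^sub>R m"
    have "c (l + m) = loop_class X x (loop_join (\<gamma> l) (\<gamma> m))"
    proof (rule cI[of _ ?u])
      show "continuous_on {0..1} ?u"
        by (rule continuous_on_unit_cases) (auto intro!: continuous_intros)
      have "torus_proj \<Lambda> (a + s *\<^sub>R m) = torus_proj \<Lambda> (a + l + s *\<^sub>R m)" for s
        using proj_shift[OF lm(1), of "a + s *\<^sub>R m"] by (simp add: add_ac)
      then show "loop_join (\<gamma> l) (\<gamma> m) t = g (torus_proj \<Lambda> (?u t))" for t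
        by (simp add: loop_join_def \<gamma>_def)
    qed (use lm add_L in \<open>auto simp: algebra_simps\<close>)
    then show ?thesis using \<gamma> lm by (simp add: c_def mult_loop_class)
  qed
  have c_zero: "c 0 = \<one>\<^bsub>?G\<^esub>"
    unfolding one_fundamental_group
    by (rule cI[of _ "\<lambda>t. a"]) (auto simp: zero_L a gh[OF x])
  have c_minus: "c (- l) = inv\<^bsub>?G\<^esub> (c l)" if "l \<in> \<Lambda>" for l
    using c_add[of "- l" l] that minus_L c_carrier c_zero by (intro G.inv_equality[symmetric]) auto
  let ?S = "c ` B"
  have S: "?S \<subseteq> carrier ?G" using c_carrier B_subset_L by blast
  \<comment> \<open>The lattice vectors whose class is generated form a subgroup. It contains the
    basis, hence the whole lattice.\<close>
  define Q where "Q = {l \<in> \<Lambda>. c l \<in> generate ?G ?S}"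
  have Q0: "0 \<in> Q" using c_zero zero_L generate.one by (auto simp: Q_def)
  have Qdiff: "l - m \<in> Q" if lm: "l \<in> Q" "m \<in> Q" for l m
  proof -
    have "c l \<otimes>\<^bsub>?G\<^esub> c (- m) \<in> generate ?G ?S"
      using lm G.generate_m_inv_closed[OF S] c_minus unfolding Q_def by (auto intro: generate.eng)
    then show ?thesis using lm c_add[of l "- m"] minus_L diff_L unfolding Q_def by simp
  qed
  have Qadd: "l + m \<in> Q" if lm: "l \<in> Q" "m \<in> Q" for l m
    using Qdiff[OF lm(1) Qdiff[OF Q0 lm(2)]] by simp
  have "(\<Sum>b\<in>C. of_int (m b) *\<^sub>R b) \<in> Q" if "C \<subseteq> B" for C and m :: "'a \<Rightarrow> int"
    using finite_subset[OF that finite_B] that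
  proof (induction C rule: finite_induct)
    case (insert b C)
    have "b \<in> Q" using insert.prems B_subset_L by (auto simp: Q_def intro: generate.incl)
    have "of_int (m b) *\<^sub>R b \<in> Q" by (rule int_multiple_mem[OF Q0 Qdiff \<open>b \<in> Q\<close>])
    then show ?case using insert Qadd by simp
  qed (simp add: Q0)
  then have LQ: "\<Lambda> \<subseteq> Q" using L_eq by auto
  have "generate ?G ?S = carrier ?G"
  proof
    show "generate ?G ?S \<subseteq> carrier ?G" by (rule G.generate_incl[OF S])
    show "carrier ?G \<subseteq> generate ?G ?S"
    proof
      fix P assume "P \<in> carrier ?G"
      then obtain p where p: "p \<in> loops X x" "P = loop_class X x p" by (auto simp: carrier_fundamental_group)
      have pp: "pathin X p" "p 0 = x" "p 1 = x" using p(1) by (auto simp: loops_def)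
      have a0: "torus_proj \<Lambda> a = h (p 0)" using a pp by simp
      obtain u where u: "continuous_on {0..1} u" "\<And>t. t \<in> {0..1} \<Longrightarrow> torus_proj \<Lambda> (u t) = h (p t)" "u 0 = a"
        by (rule path_lift[OF pp(1) ch a0]) (rule that)
      have l: "u 1 - a \<in> \<Lambda>" using u(2)[of 1] a pp by (simp flip: torus_proj_eq)
      have "p t \<in> topspace X" if "t \<in> {0..1}" for t
        using pp(1) that by (auto simp: pathin_def continuous_map_def)
      then have "c (u 1 - a) = P"
        unfolding p(2) by (intro cI[OF l u(1)]) (use u gh in auto)
      then show "P \<in> generate ?G ?S" using l LQ by (auto simp: Q_def)
    qed
  qed
  then have "number_of_generators ?G \<le> enat (card ?S)"
    by (rule number_of_generators_leI[OF S finite_imageI[OF finite_B]])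
  also have "card ?S \<le> card B" by (rule card_image_le[OF finite_B])
  also have "card B = DIM('a)" using dim_eq_card[of B UNIV] indep spanB by simp
  finally show ?thesis by simp
qed

context minimal_hypersurface
begin

lemma flat_torus_if_few_periods:
  assumes "dim (periods L X f x0) \<le> CARD('n)"
  shows "induced_flat_torus X A L f"
proof -
  have sub: "subspace period_span" by (simp add: period_span_def)
  have "dim (UNIV :: (real^'n) set) = dim period_span"
    using assms dim_period_span by (simp add: period_span_def)
  then obtain J K where JK: "linear (J :: real^'n \<Rightarrow> real^'m)" "linear K" "J ` UNIV = period_span" "K ` period_span = UNIV"
      "\<And>v. v \<in> UNIV \<Longrightarrow> norm (J v) = norm v" "\<And>w. w \<in> period_span \<Longrightarrow> norm (K w) = norm w"
      "\<And>v. v \<in> UNIV \<Longrightarrow> K (J v) = v" "\<And>w. w \<in> period_span \<Longrightarrow> J (K w) = w"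
    using isometries_subspaces[OF subspace_UNIV sub] by metis
  have "f x0 \<in> topspace (torus L)" using continuous_f x0 by (auto simp: continuous_map_def)
  then obtain a where a: "torus_proj L a = f x0" by (auto simp: topspace_torus)
  have "flat_hypersurface L B X A f x0 J K a"
    by (intro flat_hypersurface.intro flat_hypersurface_axioms.intro minimal_hypersurface_axioms
        JK(1-3,8) JK(5,7)[OF UNIV_I] a)
  then show ?thesis by (rule flat_hypersurface.flat_torus)
qed

text \<open>Otherwise the flat case applies and \<open>X\<close> is homeomorphic to a torus of
  dimension \<open>CARD('n)\<close>, whose fundamental group has too few generators. The span then
  has at least one dimension more than \<open>CARD('n)\<close>, that is, all of the ambient
  space.\<close>

lemma period_span_UNIV:
  assumes "number_of_generators (fundamental_group X x0) > enat CARD('n)"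
  shows "period_span = UNIV"
proof -
  have "\<not> dim (periods L X f x0) \<le> CARD('n)"
  proof
    assume "dim (periods L X f x0) \<le> CARD('n)"
    then obtain L' :: "(real^'n) set" and h where "full_lattice L'" "homeomorphic_map X (torus L') h"
      using flat_torus_if_few_periods unfolding induced_flat_torus_def diffeomorphism_def by blast
    from number_of_generators_torus[OF this(2,1) x0] assms show False by simp
  qed
  then have "dim (periods L X f x0) = DIM(real^'m)"
    using card_m dim_subset_UNIV[of "periods L X f x0"] by simp
  then show ?thesis unfolding period_span_def using dim_eq_full by blast
qed

end

section \<open>A generalised cross product\<close>

text \<open>The rows of a square matrix over \<open>'m\<close> are one row \<open>i\<^sub>0\<close> and rows indexed by \<open>'n\<close> through the
  injection \<open>\<rho>\<close>.\<close>

locale row_split =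
  fixes \<rho> :: "'n::finite \<Rightarrow> 'm::finite" and i0 :: 'm
  assumes inj_\<rho>: "inj \<rho>" and range_\<rho>: "range \<rho> = UNIV - {i0}"
begin

lemma \<rho>_neq [simp]: "\<rho> j \<noteq> i0" "i0 \<noteq> \<rho> j"
  using range_\<rho> by auto

lemma inv_\<rho> [simp]: "inv_into UNIV \<rho> (\<rho> j) = j"
  using inj_\<rho> by simp

lemma ex_row: "i \<noteq> i0 \<Longrightarrow> \<exists>j. i = \<rho> j"
  using range_\<rho> by (metis DiffI UNIV_I imageE singletonD)

lemma sum_split: "(\<Sum>i\<in>UNIV. g i) = g i0 + (\<Sum>j\<in>UNIV. g (\<rho> j))"
proof -
  have "(\<Sum>i\<in>UNIV. g i) = g i0 + sum g (range \<rho>)"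
    by (subst sum.remove[of UNIV i0]) (simp_all add: range_\<rho>)
  then show ?thesis by (simp add: sum.reindex[OF inj_\<rho>])
qed

lemma prod_split: "(\<Prod>i\<in>UNIV. g i) = g i0 * (\<Prod>j\<in>UNIV. g (\<rho> j))"
proof -
  have "(\<Prod>i\<in>UNIV. g i) = g i0 * prod g (range \<rho>)"
    by (subst prod.remove[of UNIV i0]) (simp_all add: range_\<rho>)
  then show ?thesis by (simp add: prod.reindex[OF inj_\<rho>])
qed

text \<open>The matrix \<open>N\<close> bordered by 1 at position \<open>i0\<close>. Multiplying
  from the left by it recombines the rows coming from \<open>'n\<close> and leaves row
  \<open>i0\<close> alone.\<close>

definition block :: "real^'n^'n \<Rightarrow> real^'m^'m" where
  "block N = (\<chi> i k. if i = i0 \<or> k = i0 then (if i = k then 1 else 0) else N $ inv_into UNIV \<rho> i $ inv_into UNIV \<rho> k)"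

text \<open>In the permutation expansion, permutations moving \<open>i0\<close> meet an off-diagonal
  zero. Those fixing \<open>i0\<close> are exactly the permutations transported along \<rho>, with
  unchanged sign.\<close>

lemma det_block: "det (block N) = det N"
proof -
  let ?f = "\<lambda>p. of_int (sign p) * (\<Prod>i\<in>UNIV. block N $ i $ p i) :: real"
  have bij: "bij_betw (map_permutation UNIV \<rho>) {q. q permutes UNIV} {p. p permutes (range \<rho>)}"
  proof (rule bij_betw_byWitness[where f' = "map_permutation (range \<rho>) (inv_into UNIV \<rho>)"])
    have b1: "bij_betw \<rho> UNIV (range \<rho>)" and b2: "bij_betw (inv_into UNIV \<rho>) (range \<rho>) UNIV"
      using inj_\<rho> by (auto simp: inj_on_imp_bij_betw bij_betw_inv_into)
    show "\<forall>q\<in>{q. q permutes UNIV}. map_permutation (range \<rho>) (inv_into UNIV \<rho>) (map_permutation UNIV \<rho> q) = q"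
      by (auto intro!: map_permutation_compose_inv[OF b1])
    show "\<forall>p\<in>{p. p permutes range \<rho>}. map_permutation UNIV \<rho> (map_permutation (range \<rho>) (inv_into UNIV \<rho>) p) = p"
      by (auto intro!: map_permutation_compose_inv[OF b2] simp: f_inv_into_f)
    show "map_permutation UNIV \<rho> ` {q. q permutes UNIV} \<subseteq> {p. p permutes range \<rho>}"
      using map_permutation_permutes[OF b1] by auto
    show "map_permutation (range \<rho>) (inv_into UNIV \<rho>) ` {p. p permutes range \<rho>} \<subseteq> {q. q permutes UNIV}"
      using map_permutation_permutes[OF b2] by auto
  qed
  have "det (block N) = sum ?f {p. p permutes UNIV}" by (simp add: det_def)
  also have "\<dots> = sum ?f {p. p permutes (range \<rho>)}"
  proof (rule sum.mono_neutral_right)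
    show "{p. p permutes range \<rho>} \<subseteq> {p. p permutes UNIV}" using permutes_subset by blast
    show "\<forall>p\<in>{p. p permutes UNIV} - {p. p permutes range \<rho>}. ?f p = 0"
    proof
      fix p assume p: "p \<in> {p. p permutes UNIV} - {p. p permutes range \<rho>}"
      then have "p i0 \<noteq> i0" using range_\<rho> by (auto simp: permutes_def)
      then have "block N $ i0 $ p i0 = 0" by (simp add: block_def)
      then show "?f p = 0" by (simp add: prod_split)
    qed
  qed simp
  also have "\<dots> = (\<Sum>q\<in>{q. q permutes UNIV}. ?f (map_permutation UNIV \<rho> q))"
    by (rule sum.reindex_bij_betw[OF bij, symmetric])
  also have "\<dots> = det N"
    unfolding det_def
  proof (rule sum.cong[OF refl])
    fix q :: "'n \<Rightarrow> 'n" assume "q \<in> {q. q permutes UNIV}"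
    then have q: "q permutes UNIV" by simp
    let ?p = "map_permutation UNIV \<rho> q"
    have "?p i0 = i0" by (simp add: map_permutation_def restrict_id_def range_\<rho>)
    moreover have "?p (\<rho> j) = \<rho> (q j)" for j by (rule map_permutation_apply[OF inj_\<rho>]) simp
    ultimately have "(\<Prod>i\<in>UNIV. block N $ i $ ?p i) = (\<Prod>j\<in>UNIV. N $ j $ q j)"
      unfolding prod_split by (simp add: block_def)
    moreover have "sign ?p = sign q" by (rule sign_map_permutation) (use q inj_\<rho> in auto)
    ultimately show "?f ?p = of_int (sign q) * (\<Prod>j\<in>UNIV. N $ j $ q j)" by simp
  qed
  finally show ?thesis .
qed

definition rows :: "('n \<Rightarrow> real^'m) \<Rightarrow> real^'m \<Rightarrow> real^'m^'m" where
  "rows v w = (\<chi> i. if i = i0 then w else v (inv_into UNIV \<rho> i))"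

lemma linear_det_rows: "linear (\<lambda>w. det (rows v w))"
proof (rule linearI)
  show "det (rows v (a + b)) = det (rows v a) + det (rows v b)" for a b
    unfolding rows_def by (rule det_row_add)
  show "det (rows v (c *\<^sub>R a)) = c *\<^sub>R det (rows v a)" for c a
    unfolding rows_def scalar_mult_eq_scaleR[symmetric] real_scaleR_def by (rule det_row_mul)
qed

text \<open>The vector representing the linear functional w -> \<open>det (rows v w)\<close> by the
  inner product; in dimension three this is the usual cross product up to sign and order.\<close>

definition cross :: "('n \<Rightarrow> real^'m) \<Rightarrow> real^'m" where
  "cross v = (\<chi> k. det (rows v (axis k 1)))"

lemma cross_inner: "cross v \<bullet> w = det (rows v w)"
  by (subst linear_expand_vec[OF linear_det_rows]) (simp add: cross_def inner_vec_def mult.commute)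

lemma cross_orthogonal: "cross v \<bullet> v j = 0"
  unfolding cross_inner
  by (rule det_identical_rows[of i0 "\<rho> j"]) (auto simp: rows_def row_def)

text \<open>A change of the tangent rows by S is left multiplication by the block matrix of its
  transpose. This makes the normal transform by the Jacobian determinant, the quantity whose sign an
  oriented atlas controls.\<close>

lemma rows_transform:
  assumes v': "\<And>j. v' j = (\<Sum>l\<in>UNIV. S $ l $ j *\<^sub>R v l)"
  shows "det (rows v' w) = det S * det (rows v w)"
proof -
  have "rows v' w = block (transpose S) ** rows v w"
  proof -
    have "rows v' w $ i $ k = (block (transpose S) ** rows v w) $ i $ k" for i k
    proof (cases "i = i0")
      case True
      then show ?thesis by (simp add: matrix_matrix_mult_def sum_split rows_def block_def)
    next
      case False
      then obtain j where "i = \<rho> j" using ex_row by blast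
      then show ?thesis
        by (simp add: matrix_matrix_mult_def sum_split rows_def block_def v' transpose_def)
    qed
    then show ?thesis by (simp add: vec_eq_iff)
  qed
  then show ?thesis by (simp add: det_mul det_block det_transpose)
qed

lemma cross_transform:
  assumes "\<And>j. v' j = (\<Sum>l\<in>UNIV. S $ l $ j *\<^sub>R v l)"
  shows "cross v' = det S *\<^sub>R cross v"
  by (simp add: vec_eq_iff cross_def rows_transform[OF assms])

text \<open>If it vanished, the matrix with the tangent vectors and a unit normal as rows would be
  singular. A kernel vector is orthogonal to the normal, hence tangent, and orthogonal to all
  tangent vectors, hence to itself.\<close>

lemma cross_nonzero:
  fixes T :: "real^'n \<Rightarrow> real^'m"
  assumes T: "linear T" "inj T" and card: "CARD('m) = CARD('n) + 1"
  shows "cross (\<lambda>j. T (axis j 1)) \<noteq> 0"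
proof
  let ?v = "\<lambda>j. T (axis j 1)"
  assume z: "cross ?v = 0"
  obtain \<nu> where \<nu>: "norm \<nu> = 1" "\<And>u. T u \<bullet> \<nu> = 0" using normal_exists[OF T(1) card] by blast
  have "\<nu> \<noteq> 0" using \<nu>(1) by auto
  then have range: "range T = {w. \<nu> \<bullet> w = 0}" by (rule hyperplane_eq_range[OF T card _ \<nu>(2)])
  have "det (rows ?v \<nu>) = 0" using z cross_inner[of ?v \<nu>] by simp
  then have "\<not> inj ((*v) (rows ?v \<nu>))"
    using det_nz_iff_inj[OF matrix_vector_mul_linear, of "rows ?v \<nu>"] by simp
  then obtain x where x: "x \<noteq> 0" "rows ?v \<nu> *v x = 0"
    using linear_injective_0[OF matrix_vector_mul_linear, of "rows ?v \<nu>"] by blast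
  have comp: "rows ?v \<nu> $ i \<bullet> x = 0" for i
    using x(2) by (simp add: vec_eq_iff matrix_vector_mult_def inner_vec_def)
  have "\<nu> \<bullet> x = 0" using comp[of i0] by (simp add: rows_def)
  then obtain u where u: "x = T u" using range by blast
  have "T (axis j 1) \<bullet> x = 0" for j using comp[of "\<rho> j"] by (simp add: rows_def)
  then have "T u \<bullet> x = 0"
    by (subst linear_expand_vec[OF T(1), of u]) (simp add: inner_sum_left)
  then show False using u x(1) by simp
qed

lemma C_on_cross:
  assumes "open S" "\<And>j. C_on k S (\<lambda>y. v y j)"
  shows "C_on k S (\<lambda>y. cross (v y))"
proof (rule C_on_vec[OF assms(1)])
  fix l
  have "C_on k S (\<lambda>y. if i = i0 then axis l 1 $ j else v y (inv_into UNIV \<rho> i) $ j)" for i j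
    by (cases "i = i0") (simp_all add: C_on_vec_nth[OF assms])
  then have "C_on k S (\<lambda>y. det (\<chi> i j. if i = i0 then axis l 1 $ j else v y (inv_into UNIV \<rho> i) $ j))"
    by (rule C_on_det[OF assms(1)])
  moreover have "(\<chi> i j. if i = i0 then axis l 1 $ j else v y (inv_into UNIV \<rho> i) $ j) = rows (v y) (axis l 1)" for y
    by (simp add: rows_def vec_eq_iff)
  ultimately show "C_on k S (\<lambda>y. cross (v y) $ l)"
    by (simp add: cross_def)
qed

end

lemma row_split_exists:
  assumes "CARD('m::finite) = CARD('n::finite) + 1"
  obtains \<rho> :: "'n::finite \<Rightarrow> 'm::finite" and i0 where "row_split \<rho> i0"
proof -
  obtain i0 :: 'm where True by blast
  have "card (UNIV - {i0}) = CARD('n)" using assms by simp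
  then obtain \<rho> :: "'n \<Rightarrow> 'm" where "bij_betw \<rho> UNIV (UNIV - {i0})"
    by (metis finite finite_same_card_bij)
  then have "row_split \<rho> i0" by (simp add: row_split_def bij_betw_def)
  then show thesis by (rule that)
qed

section \<open>A transversal field along an orientable hypersurface\<close>

lemma mem_local_dom:
  assumes "is_chart X c"
  shows "y \<in> local_dom c d f \<longleftrightarrow> y \<in> snd c ` fst c \<and> f (inv_into (fst c) (snd c) y) \<in> fst d"
  using chart_inverse_simps(2)[OF assms] by (auto simp: local_dom_def)

text \<open>Injectivity of the derivative comes from differentiating the identity obtained by
  composing with the reverse transition.\<close>

lemma transition_facts:
  fixes b c :: "('b, 'e::euclidean_space) chart"
  assumes C: "smooth_atlas X C" "b \<in> C" "c \<in> C"
  shows "open (local_dom b c id)"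
    and "y \<in> local_dom b c id \<Longrightarrow> local_rep b c id y \<in> local_dom c b id"
    and "y \<in> local_dom b c id \<Longrightarrow> local_rep c b id (local_rep b c id y) = y"
    and "smooth_on (local_dom b c id) (local_rep b c id)"
    and "y \<in> local_dom b c id \<Longrightarrow> local_rep b c id differentiable (at y)"
    and "y \<in> local_dom b c id \<Longrightarrow> inj (frechet_derivative (local_rep b c id) (at y))"
proof -
  have *: "open (local_dom b c id)"
    "\<And>y. y \<in> local_dom b c id \<Longrightarrow> local_rep b c id y \<in> local_dom c b id"
    "\<And>y. y \<in> local_dom b c id \<Longrightarrow> local_rep c b id (local_rep b c id y) = y"
    "smooth_on (local_dom b c id) (local_rep b c id)"
    "\<And>y. y \<in> local_dom b c id \<Longrightarrow> local_rep b c id differentiable (at y)"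
    if b: "b \<in> C" and c: "c \<in> C" for b c
  proof -
    have ch: "is_chart X b" "is_chart X c" using C(1) b c by (auto simp: smooth_atlas_def)
    show "open (local_dom b c id)"
      by (rule open_local_dom(1)[OF ch(1) continuous_map_id]) (use ch in \<open>simp add: is_chart_def\<close>)
    show "local_rep b c id y \<in> local_dom c b id" if "y \<in> local_dom b c id" for y
      using that chart_inverse_simps(2)[OF ch(1)] by (auto simp: local_dom_def local_rep_def)
    show "local_rep c b id (local_rep b c id y) = y" if "y \<in> local_dom b c id" for y
      using that chart_inverse_simps(2)[OF ch(1)] chart_inverse_simps(2)[OF ch(2)]
      by (auto simp: local_dom_def local_rep_def)
    show sm: "smooth_on (local_dom b c id) (local_rep b c id)"
      using C(1) b c by (simp add: smooth_atlas_def)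
    show "local_rep b c id differentiable (at y)" if "y \<in> local_dom b c id" for y
    proof -
      have "C_on (Suc 0) (local_dom b c id) (local_rep b c id)" using sm by (simp only: smooth_on_def)
      then show ?thesis using that by simp
    qed
  qed
  note bc = *[OF C(2,3)] and cb = *[OF C(3,2)]
  show "open (local_dom b c id)" by (rule bc)
  show "smooth_on (local_dom b c id) (local_rep b c id)" by (rule bc)
  show "y \<in> local_dom b c id \<Longrightarrow> local_rep b c id y \<in> local_dom c b id" by (rule bc)
  show "y \<in> local_dom b c id \<Longrightarrow> local_rep c b id (local_rep b c id y) = y" by (rule bc)
  show "y \<in> local_dom b c id \<Longrightarrow> local_rep b c id differentiable (at y)" by (rule bc)
  show "inj (frechet_derivative (local_rep b c id) (at y))" if y: "y \<in> local_dom b c id"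
  proof -
    let ?t = "local_rep b c id" and ?s = "local_rep c b id"
    have t: "(?t has_derivative frechet_derivative ?t (at y)) (at y)"
      using bc(5)[OF y] by (simp add: frechet_derivative_works)
    have s: "(?s has_derivative frechet_derivative ?s (at (?t y))) (at (?t y))"
      using cb(5)[OF bc(2)[OF y]] by (simp add: frechet_derivative_works)
    have "((\<lambda>z. ?s (?t z)) has_derivative (\<lambda>v. frechet_derivative ?s (at (?t y)) (frechet_derivative ?t (at y) v))) (at y)"
      by (rule has_derivative_compose[OF t s])
    then have "((\<lambda>z. z) has_derivative (\<lambda>v. frechet_derivative ?s (at (?t y)) (frechet_derivative ?t (at y) v))) (at y)"
      by (rule has_derivative_transform_within_open[OF _ bc(1) y bc(3)])
    then have "(\<lambda>v. frechet_derivative ?s (at (?t y)) (frechet_derivative ?t (at y) v)) = (\<lambda>v. v)"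
      using has_derivative_unique has_derivative_ident by blast
    then show ?thesis by (metis injI)
  qed
qed

lemma frechet_derivative_compose_at:
  assumes "t differentiable (at y)" "F differentiable (at (t y))"
  shows "frechet_derivative (\<lambda>z. F (t z)) (at y) v = frechet_derivative F (at (t y)) (frechet_derivative t (at y) v)"
proof -
  have "((\<lambda>z. F (t z)) has_derivative (\<lambda>v. frechet_derivative F (at (t y)) (frechet_derivative t (at y) v))) (at y)"
    by (rule has_derivative_compose) (use assms in \<open>simp_all add: frechet_derivative_works[symmetric]\<close>)
  then show ?thesis by (simp add: frechet_derivative_at[symmetric])
qed

text \<open>Orientability provides another, compatible atlas, while the embedding is known to be
  smooth only in the given one. Near each point a representation in the new atlas factors through a
  transition map into a chart of the old.\<close>

lemma smooth_embedding_change_atlas: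
  fixes A :: "('b, 'e::euclidean_space) chart set"
  assumes A: "smooth_atlas X A" and AB: "smooth_atlas X (A \<union> B)" and L: "full_lattice L"
    and f: "smooth_embedding X A (torus L) (torus_atlas L) f"
  shows "smooth_embedding X B (torus L) (torus_atlas L) f"
proof -
  have cont: "continuous_map X (torus L) f" using f by (simp add: smooth_embedding_def smooth_map_def)
  have key: "smooth_on (local_dom b d f) (local_rep b d f) \<and>
      (\<forall>y\<in>local_dom b d f. inj (frechet_derivative (local_rep b d f) (at y)))"
    if b: "b \<in> B" and d: "d \<in> torus_atlas L" for b d
  proof -
    have bAB: "b \<in> A \<union> B" using b by blast
    have bch: "is_chart X b" using AB bAB by (auto simp: smooth_atlas_def)
    have dch: "is_chart (torus L) d" by (rule is_chart_torus[OF L d])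
    have oF: "open (local_dom b d f)"
      by (rule open_local_dom(1)[OF bch cont]) (use dch in \<open>simp add: is_chart_def\<close>)
    have loc: "\<exists>c W. c \<in> A \<and> open W \<and> y0 \<in> W \<and> W \<subseteq> local_dom b d f \<and> W \<subseteq> local_dom b c id \<and>
        (\<forall>y\<in>W. local_rep b c id y \<in> local_dom c d f \<and>
          local_rep c d f (local_rep b c id y) = local_rep b d f y)"
      if y0: "y0 \<in> local_dom b d f" for y0
    proof -
      obtain p where p: "p \<in> fst b" "f p \<in> fst d" "y0 = snd b p" using y0 by (auto simp: local_dom_def)
      have "p \<in> (\<Union>c\<in>A. fst c)"
        using A chart_inverse_simps(5)[OF bch] p(1) by (auto simp: smooth_atlas_def)
      then obtain c where c: "c \<in> A" "p \<in> fst c" by blast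
      have cch: "is_chart X c" using A c(1) by (simp add: smooth_atlas_def)
      have y0c: "y0 \<in> local_dom b c id" using p c by (auto simp: local_dom_def)
      have o: "open (local_dom b c id)" by (rule transition_facts(1)[OF AB bAB]) (use c in blast)
      have "local_rep b c id y \<in> local_dom c d f \<and> local_rep c d f (local_rep b c id y) = local_rep b d f y"
        if "y \<in> local_dom b d f \<inter> local_dom b c id" for y
        using that chart_inverse_simps(2)[OF cch]
        unfolding Int_iff mem_local_dom[OF bch] mem_local_dom[OF cch] by (simp add: local_rep_def)
      then show ?thesis
        using c(1) oF o y0 y0c by (intro exI[of _ c] exI[of _ "local_dom b d f \<inter> local_dom b c id"]) auto
    qed
    have "smooth_on (local_dom b d f) (local_rep b d f)"
    proof (rule smooth_on_local)
      fix y0 assume "y0 \<in> local_dom b d f"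
      then obtain c W where W: "c \<in> A" "open W" "y0 \<in> W" "W \<subseteq> local_dom b d f" "W \<subseteq> local_dom b c id"
        "\<forall>y\<in>W. local_rep b c id y \<in> local_dom c d f \<and> local_rep c d f (local_rep b c id y) = local_rep b d f y"
        using loc by metis
      have cAB: "c \<in> A \<union> B" using W(1) by blast
      note lp = local_param_chart(1)[OF A L f W(1) d]
      have "smooth_on W (\<lambda>y. local_rep c d f (local_rep b c id y))"
      proof (rule smooth_on_compose[OF W(2), where g = "local_rep b c id" and f = "local_rep c d f"])
        show "open (local_dom c d f)" "smooth_on (local_dom c d f) (local_rep c d f)"
          using lp by (auto simp: local_param_def)
        show "smooth_on W (local_rep b c id)"
          by (rule smooth_on_subset[OF transition_facts(4)[OF AB bAB cAB] W(5)])
      qed (use W(6) in auto)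
      then have "smooth_on W (local_rep b d f)"
        by (rule smooth_on_cong[OF W(2), rotated]) (use W(6) in auto)
      then show "\<exists>T. open T \<and> y0 \<in> T \<and> smooth_on T (local_rep b d f)" using W by blast
    qed
    moreover have "inj (frechet_derivative (local_rep b d f) (at y0))" if y0: "y0 \<in> local_dom b d f" for y0
    proof -
      obtain c W where W: "c \<in> A" "open W" "y0 \<in> W" "W \<subseteq> local_dom b d f" "W \<subseteq> local_dom b c id"
        "\<forall>y\<in>W. local_rep b c id y \<in> local_dom c d f \<and> local_rep c d f (local_rep b c id y) = local_rep b d f y"
        using loc[OF y0] by metis
      have cAB: "c \<in> A \<union> B" using W(1) by blast
      note lp = local_param_chart(1)[OF A L f W(1) d]
      let ?t = "local_rep b c id"
      have y0c: "y0 \<in> local_dom b c id" and ty0: "?t y0 \<in> local_dom c d f" using W by auto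
      have "frechet_derivative (local_rep b d f) (at y0) = frechet_derivative (\<lambda>y. local_rep c d f (?t y)) (at y0)"
        by (rule frechet_derivative_cong_open[OF W(2,3)]) (use W(6) in simp)
      then have "frechet_derivative (local_rep b d f) (at y0) v =
          frechet_derivative (local_rep c d f) (at (?t y0)) (frechet_derivative ?t (at y0) v)" for v
        by (simp only: frechet_derivative_compose_at[OF transition_facts(5)[OF AB bAB cAB y0c]
              local_param_differentiable[OF lp ty0]])
      moreover have "inj (frechet_derivative (local_rep c d f) (at (?t y0)))"
        using lp ty0 by (simp add: local_param_def)
      ultimately show ?thesis
        using transition_facts(6)[OF AB bAB cAB y0c] by (auto simp: inj_def)
    qed
    ultimately show ?thesis by blast
  qed
  then show ?thesis
    using f unfolding smooth_embedding_def smooth_map_def by blast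
qed

context minimal_hypersurface
begin

text \<open>In an oriented atlas the normalised cross product of the coordinate tangent vectors is
  independent of all choices: a change of chart multiplies the cross product by a positive
  determinant, which normalisation removes, and a change of torus chart shifts the lift by a
  constant. Orthogonality to the tangent space makes the resulting global field transversal.\<close>

theorem transversal_field:
  assumes "orientable X A"
  obtains \<nu> :: "'b \<Rightarrow> real^'m" where
    "\<And>p. p \<in> topspace X \<Longrightarrow> \<exists>U \<phi> (F :: real^'n \<Rightarrow> real^'m) y. local_param X L f U \<phi> F \<and> y \<in> U \<and> \<phi> y = p \<and>
       C_on 1 U (\<lambda>z. \<nu> (\<phi> z)) \<and> (\<forall>z\<in>U. \<nu> (\<phi> z) \<notin> range (frechet_derivative F (at z)))"
proof -
  obtain B where B: "smooth_atlas X B" "smooth_atlas X (A \<union> B)"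
    "\<And>c d y. c \<in> B \<Longrightarrow> d \<in> B \<Longrightarrow> y \<in> local_dom c d id \<Longrightarrow> det (jacobian (local_rep c d id) (at y)) > 0"
    using assms unfolding orientable_def by blast
  have emb: "smooth_embedding X B (torus L) (torus_atlas L) f"
    by (rule smooth_embedding_change_atlas[OF atlas B(2) full embedding])
  note lp = local_param_chart[OF B(1) full emb]
  obtain \<rho> :: "'n \<Rightarrow> 'm" and i0 where "row_split \<rho> i0" using row_split_exists[OF card_m] by blast
  then interpret row_split \<rho> i0 .
  define N where "N b d y = cross (\<lambda>j. frechet_derivative (local_rep b d f) (at y) (axis j 1))"
    for b :: "('b, real^'n) chart" and d :: "((real^'m) set, real^'m) chart" and y
  define n where "n b d y = inverse (sqrt (N b d y \<bullet> N b d y)) *\<^sub>R N b d y" for b d y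
  have lin: "linear (frechet_derivative (local_rep b d f) (at y))"
    if "b \<in> B" "d \<in> torus_atlas L" "y \<in> local_dom b d f" for b d y
    by (rule param_linear[OF lp(1)[OF that(1,2)] that(3)])
  have Nnz: "N b d y \<noteq> 0" if "b \<in> B" "d \<in> torus_atlas L" "y \<in> local_dom b d f" for b d y
    unfolding N_def by (rule cross_nonzero[OF lin[OF that] _ card_m])
      (use lp(1)[OF that(1,2)] that(3) in \<open>simp add: local_param_def\<close>)
  have indep: "n b' d' (snd b' p) = n b d (snd b p)"
    if b: "b \<in> B" "p \<in> fst b" and d: "d \<in> torus_atlas L" "f p \<in> fst d"
      and b': "b' \<in> B" "p \<in> fst b'" and d': "d' \<in> torus_atlas L" "f p \<in> fst d'" for b d b' d' p
  proof -
    let ?t = "local_rep b' b id" and ?F = "local_rep b d f" and ?F' = "local_rep b' d' f"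
    let ?y = "snd b' p"
    have ch: "is_chart X b" "is_chart X b'" using B(1) b b' by (auto simp: smooth_atlas_def)
    have y: "?y \<in> local_dom b' b id" "?y \<in> local_dom b' d' f" using b b' d' by (auto simp: local_dom_def)
    have ty: "?t ?y = snd b p" using chart_inverse_simps(2)[OF ch(2) b'(2)] by (simp add: local_rep_def)
    have yd: "snd b p \<in> local_dom b d f" using b d by (auto simp: local_dom_def)
    note lpb = lp(1)[OF b(1) d(1)] and lpb' = lp(1)[OF b'(1) d'(1)]
    note tr = transition_facts[OF B(1) b'(1) b(1)]
    define W where "W = local_dom b' b id \<inter> local_dom b' d' f \<inter> local_dom b' d f"
    have chd: "is_chart (torus L) d" by (rule is_chart_torus[OF full d(1)])
    have "open (local_dom b' d f)"
      by (rule open_local_dom(1)[OF ch(2) continuous_f]) (use chd in \<open>simp add: is_chart_def\<close>)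
    then have oW: "open W" using tr(1) lpb' by (auto simp: W_def local_param_def)
    have yW: "?y \<in> W" using y b' d by (auto simp: W_def local_dom_def)
    obtain r where r: "r > 0" "ball ?y r \<subseteq> W" using openE[OF oW yW] .
    have tW: "?t z \<in> local_dom b d f \<and> torus_proj L (?F (?t z)) = torus_proj L (?F' z)" if z: "z \<in> W" for z
    proof -
      have zz: "z \<in> local_dom b' b id" "z \<in> local_dom b' d' f" "z \<in> local_dom b' d f" using z by (auto simp: W_def)
      have "?t z \<in> local_dom b d f \<and> inv_into (fst b) (snd b) (?t z) = inv_into (fst b') (snd b') z"
        using zz(1,3) chart_inverse_simps(2)[OF ch(1)]
        unfolding mem_local_dom[OF ch(1)] mem_local_dom[OF ch(2)] by (simp add: local_rep_def)
      then show ?thesis using lpb lpb' zz(2) by (auto simp: local_param_def)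
    qed
    \<comment> \<open>Both functions lift the same map to the torus, so their difference is
      lattice-valued and therefore constant on the connected ball. The derivatives of the two
      representations are thus related by the transition map alone.\<close>
    have const: "?F' z - ?F (?t z) = ?F' ?y - ?F (?t ?y)" if z: "z \<in> ball ?y r" for z
    proof (rule constant_if_L_valued[of "ball ?y r" "\<lambda>z. ?F' z - ?F (?t z)"])
      have "continuous_on (ball ?y r) ?F'"
        by (rule continuous_on_subset[OF local_param_continuous[OF lpb']]) (use r(2) in \<open>auto simp: W_def\<close>)
      moreover have "continuous_on (local_dom b' b id) ?t"
        using tr(4) C_on_continuous[of 0] unfolding smooth_on_def by blast
      then have "continuous_on (ball ?y r) ?t"
        by (rule continuous_on_subset) (use r(2) in \<open>auto simp: W_def\<close>)
      then have "continuous_on (ball ?y r) (\<lambda>z. ?F (?t z))"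
        by (rule continuous_on_compose2[OF local_param_continuous[OF lpb]]) (use tW r(2) in auto)
      ultimately show "continuous_on (ball ?y r) (\<lambda>z. ?F' z - ?F (?t z))" by (intro continuous_intros)
      show "?F' z - ?F (?t z) \<in> L" if "z \<in> ball ?y r" for z
      proof -
        have "z \<in> W" using that r(2) by blast
        then show ?thesis using tW torus_proj_eq by metis
      qed
    qed (use z r in auto)
    have "?y \<in> ball ?y r" using r(1) by (simp only: centre_in_ball)
    then have "frechet_derivative ?F' (at ?y) = frechet_derivative (\<lambda>z. ?F (?t z) + (?F' ?y - ?F (?t ?y))) (at ?y)"
      by (rule frechet_derivative_cong_open[OF open_ball]) (use const in \<open>simp add: algebra_simps\<close>)
    also have "\<dots> = frechet_derivative (\<lambda>z. ?F (?t z)) (at ?y)"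
    proof -
      have "((\<lambda>z. ?F (?t z)) has_derivative frechet_derivative (\<lambda>z. ?F (?t z)) (at ?y)) (at ?y)"
        using differentiable_chain_at[OF tr(5)[OF y(1)], of ?F] local_param_differentiable[OF lpb yd] ty
        by (simp add: frechet_derivative_works[symmetric] o_def)
      from has_derivative_add[OF this has_derivative_const]
      show ?thesis by (simp add: frechet_derivative_at[symmetric])
    qed
    finally have DF': "frechet_derivative ?F' (at ?y) v =
        frechet_derivative ?F (at (snd b p)) (frechet_derivative ?t (at ?y) v)" for v
      using frechet_derivative_compose_at[OF tr(5)[OF y(1)]] local_param_differentiable[OF lpb yd] ty by simp
    have N': "N b' d' ?y = det (jacobian ?t (at ?y)) *\<^sub>R N b d (snd b p)"
      unfolding N_def
    proof (rule cross_transform)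
      fix j
      show "frechet_derivative ?F' (at ?y) (axis j 1) =
          (\<Sum>l\<in>UNIV. jacobian ?t (at ?y) $ l $ j *\<^sub>R frechet_derivative ?F (at (snd b p)) (axis l 1))"
        unfolding DF' jacobian_def
        by (subst linear_expand_vec[OF lin[OF b(1) d(1) yd]]) (simp add: matrix_def)
    qed
    have pos: "det (jacobian ?t (at ?y)) > 0" by (rule B(3)[OF b'(1) b(1) y(1)])
    with N' have "sqrt (N b' d' ?y \<bullet> N b' d' ?y) =
        det (jacobian ?t (at ?y)) * sqrt (N b d (snd b p) \<bullet> N b d (snd b p))"
      by (simp add: real_sqrt_mult flip: mult.assoc)
    with N' pos show ?thesis by (simp add: n_def)
  qed
  define \<nu> where "\<nu> p = (let (b, d) = (SOME (b, d). b \<in> B \<and> p \<in> fst b \<and> d \<in> torus_atlas L \<and> f p \<in> fst d)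
      in n b d (snd b p))" for p
  have \<nu>: "\<nu> p = n b d (snd b p)"
    if bd: "b \<in> B" "p \<in> fst b" "d \<in> torus_atlas L" "f p \<in> fst d" for p b d
  proof -
    obtain b' d' where eq: "(SOME (b, d). b \<in> B \<and> p \<in> fst b \<and> d \<in> torus_atlas L \<and> f p \<in> fst d) = (b', d')"
      by (rule prod.exhaust)
    have "case (b', d') of (b, d) \<Rightarrow> b \<in> B \<and> p \<in> fst b \<and> d \<in> torus_atlas L \<and> f p \<in> fst d"
      unfolding eq[symmetric] by (rule someI[of _ "(b, d)"]) (use bd in simp)
    then show ?thesis using indep[of b p d b' d'] bd by (simp add: \<nu>_def eq)
  qed
  show thesis
  proof (rule that[of \<nu>])
    fix p assume p: "p \<in> topspace X"
    have "p \<in> (\<Union>b\<in>B. fst b)" using B(1) p by (simp add: smooth_atlas_def)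
    then obtain b where b: "b \<in> B" "p \<in> fst b" by blast
    have "f p \<in> topspace (torus L)" using continuous_f p by (auto simp: continuous_map_def)
    then obtain x where x: "f p = torus_proj L x" by (auto simp: topspace_torus)
    obtain d where d: "d \<in> torus_atlas L" "torus_proj L x \<in> fst d" "snd d (torus_proj L x) = x"
      using torus_chart_through[OF full] .
    let ?U = "local_dom b d f" and ?\<phi> = "inv_into (fst b) (snd b)" and ?F = "local_rep b d f"
    note lpb = lp[OF b(1) d(1)]
    have ch: "is_chart X b" using B(1) b(1) by (simp add: smooth_atlas_def)
    have oU: "open ?U" using lpb(1) by (simp add: local_param_def)
    have \<nu>U: "\<nu> (?\<phi> z) = n b d z" if z: "z \<in> ?U" for z
    proof -
      have "?\<phi> z \<in> fst b \<inter> f -` fst d" using z lpb(2) by blast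
      then have "\<nu> (?\<phi> z) = n b d (snd b (?\<phi> z))" using b(1) d(1) by (intro \<nu>) auto
      moreover have "snd b (?\<phi> z) = z" using z chart_inverse_simps(3)[OF ch] by (auto simp: local_dom_def)
      ultimately show ?thesis by simp
    qed
    have "C_on 1 ?U (\<lambda>y. frechet_derivative ?F (at y) v)" for v
    proof -
      have "C_on (Suc 1) ?U ?F" using lpb(1) by (simp only: local_param_def smooth_on_def)
      then show ?thesis by (simp only: C_on.simps)
    qed
    then have CN: "C_on 1 ?U (N b d)"
      unfolding N_def[abs_def] by (intro C_on_cross[OF oU])
    have CNN: "C_on 1 ?U (\<lambda>y. N b d y \<bullet> N b d y)" by (rule C_on_inner[OF oU CN CN])
    have pos: "N b d y \<bullet> N b d y > 0" if "y \<in> ?U" for y using Nnz[OF b(1) d(1) that] by simp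
    have "C_on 1 ?U (\<lambda>y. sqrt (N b d y \<bullet> N b d y))"
      by (rule C_on_compose[OF oU open_greaterThan CNN C_on_sqrt]) (use pos in auto)
    then have "C_on 1 ?U (\<lambda>y. inverse (sqrt (N b d y \<bullet> N b d y)))"
      by (rule C_on_inverse[OF oU]) (use pos in fastforce)
    then have "C_on 1 ?U (n b d)" unfolding n_def[abs_def] by (rule C_on_scaleR[OF oU _ CN])
    then have C1: "C_on 1 ?U (\<lambda>z. \<nu> (?\<phi> z))" by (rule C_on_cong[OF oU, rotated]) (simp add: \<nu>U)
    have notin: "\<nu> (?\<phi> z) \<notin> range (frechet_derivative ?F (at z))" if z: "z \<in> ?U" for z
    proof
      assume "\<nu> (?\<phi> z) \<in> range (frechet_derivative ?F (at z))"
      then obtain u where u: "n b d z = frechet_derivative ?F (at z) u" using \<nu>U[OF z] by auto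
      have "N b d z \<bullet> frechet_derivative ?F (at z) u = 0"
      proof -
        have "N b d z \<bullet> frechet_derivative ?F (at z) (axis i 1) = 0" for i
          unfolding N_def by (rule cross_orthogonal)
        then show ?thesis
          by (subst linear_expand_vec[OF lin[OF b(1) d(1) z]]) (simp add: inner_sum_right)
      qed
      then have "N b d z \<bullet> n b d z = 0" by (simp add: u)
      then show False using pos[OF z] by (simp add: n_def)
    qed
    have "p \<in> ?\<phi> ` ?U" unfolding lpb(2) using b d x by simp
    then obtain y where "y \<in> ?U" "?\<phi> y = p" by blast
    then show "\<exists>U \<phi> (F :: real^'n \<Rightarrow> real^'m) y. local_param X L f U \<phi> F \<and> y \<in> U \<and> \<phi> y = p \<and>
       C_on 1 U (\<lambda>z. \<nu> (\<phi> z)) \<and> (\<forall>z\<in>U. \<nu> (\<phi> z) \<notin> range (frechet_derivative F (at z)))"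
      using lpb(1) C1 notin by blast
  qed
qed

end

section \<open>Tubular neighbourhoods\<close>

text \<open>The local injectivity theorem asks for continuity of the derivative in operator norm.
  Continuity in each basis direction suffices, since the operator norm is at most the sum of the
  norms on the basis.\<close>

lemma C1_locally_injective:
  fixes G :: "'a::euclidean_space \<Rightarrow> 'f::euclidean_space"
  assumes S: "open S" "a \<in> S" and G: "C_on 1 S G" and inj: "inj (frechet_derivative G (at a))"
  obtains r where "r > 0" "ball a r \<subseteq> S" "inj_on G (ball a r)"
proof -
  let ?D = "\<lambda>x. frechet_derivative G (at x)"
  have diff: "G differentiable (at x)" if "x \<in> S" for x using G that by simp
  have lin: "linear (?D x)" if "x \<in> S" for x by (rule linear_frechet_derivative[OF diff[OF that]])
  have cont: "continuous_on S (\<lambda>x. ?D x v)" for v using G by simp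
  obtain g' where g': "linear g'" "g' \<circ> ?D a = id"
    using linear_injective_left_inverse[OF lin[OF S(2)] inj] by blast
  obtain r0 where r0: "r0 > 0" "ball a r0 \<subseteq> S" using openE[OF S] .
  have small: "\<exists>d>0. \<forall>x. dist a x < d \<longrightarrow> onorm (\<lambda>v. ?D x v - ?D a v) < e" if e: "e > 0" for e
  proof -
    have "continuous_on S (\<lambda>x. \<Sum>b\<in>Basis. norm (?D x b - ?D a b))"
      by (intro continuous_on_sum continuous_on_norm continuous_on_diff cont continuous_on_const)
    then have "isCont (\<lambda>x. \<Sum>b\<in>Basis. norm (?D x b - ?D a b)) a"
      using S by (simp add: continuous_on_eq_continuous_at)
    from this[unfolded continuous_at_eps_delta, rule_format, of e] e
    obtain d where d: "d > 0" "\<And>x. dist x a < d \<Longrightarrow>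
        dist (\<Sum>b\<in>Basis. norm (?D x b - ?D a b)) (\<Sum>b\<in>Basis. norm (?D a b - ?D a b)) < e"
      by blast
    have "onorm (\<lambda>v. ?D x v - ?D a v) < e" if x: "dist a x < min d r0" for x
    proof -
      have xS: "x \<in> S" using x r0(2) by auto
      have "linear (\<lambda>v. ?D x v - ?D a v)" by (rule linear_compose_sub[OF lin[OF xS] lin[OF S(2)]])
      then have "norm (?D x v - ?D a v) \<le> (\<Sum>b\<in>Basis. norm (?D x b - ?D a b)) * norm v" for v
        by (rule norm_linear_le)
      then have "onorm (\<lambda>v. ?D x v - ?D a v) \<le> (\<Sum>b\<in>Basis. norm (?D x b - ?D a b))"
        by (intro onorm_bound sum_nonneg) auto
      also have "\<dots> \<le> \<bar>\<Sum>b\<in>Basis. norm (?D x b - ?D a b)\<bar>" by simp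
      also have "\<dots> < e" using d(2)[of x] x e by (simp add: dist_commute dist_real_def)
      finally show ?thesis .
    qed
    then show ?thesis using d(1) r0(1) by (intro exI[of _ "min d r0"]) auto
  qed
  show thesis
  proof (rule has_derivative_locally_injective[OF S(2,1) g'(1)[unfolded linear_conv_bounded_linear] g'(2) _ small])
    show "(G has_derivative ?D x) (at x)" if "x \<in> S" for x
      using diff[OF that] by (simp add: frechet_derivative_works)
  qed (assumption | rule that)+
qed

text \<open>A minimum over a finite subcover works because smaller constants remain admissible.
  Inserting 1 keeps the minimum defined and positive when the index set is empty.\<close>

lemma compact_space_uniform:
  fixes P :: "real \<Rightarrow> 'z \<Rightarrow> bool"
  assumes Z: "compact_space Z"
    and loc: "\<And>z. z \<in> topspace Z \<Longrightarrow> \<exists>Q \<epsilon>. openin Z Q \<and> z \<in> Q \<and> \<epsilon> > 0 \<and> (\<forall>z'\<in>Q. P \<epsilon> z')"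
    and mono: "\<And>\<epsilon> \<epsilon>' z. P \<epsilon> z \<Longrightarrow> 0 < \<epsilon>' \<Longrightarrow> \<epsilon>' \<le> \<epsilon> \<Longrightarrow> P \<epsilon>' z"
  obtains \<epsilon> where "\<epsilon> > 0" "\<And>z. z \<in> topspace Z \<Longrightarrow> P \<epsilon> z"
proof -
  have "\<forall>z\<in>topspace Z. \<exists>Q \<epsilon>. openin Z Q \<and> z \<in> Q \<and> \<epsilon> > 0 \<and> (\<forall>z'\<in>Q. P \<epsilon> z')" using loc by blast
  then obtain Q \<epsilon> where Q: "\<And>z. z \<in> topspace Z \<Longrightarrow> openin Z (Q z) \<and> z \<in> Q z \<and> \<epsilon> z > 0 \<and> (\<forall>z'\<in>Q z. P (\<epsilon> z) z')"
    by metis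
  have "compactin Z (topspace Z)" using Z by (simp add: compact_space_def)
  then have "\<exists>\<F>. finite \<F> \<and> \<F> \<subseteq> Q ` topspace Z \<and> topspace Z \<subseteq> \<Union>\<F>"
    by (rule compactinD) (use Q in auto)
  then obtain I where I: "finite I" "I \<subseteq> topspace Z" "topspace Z \<subseteq> (\<Union>z\<in>I. Q z)"
    by (metis finite_subset_image)
  define e where "e = Min (insert 1 (\<epsilon> ` I))"
  have fin: "finite (insert 1 (\<epsilon> ` I))" using I(1) by simp
  have "e > 0" unfolding e_def using fin I(2) Q by (subst Min_gr_iff) auto
  moreover have "P e z" if z: "z \<in> topspace Z" for z
  proof -
    obtain w where w: "w \<in> I" "z \<in> Q w" using I(3) z by blast
    have "e \<le> \<epsilon> w" unfolding e_def using fin w(1) by (intro Min_le) auto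
    then show ?thesis using mono[OF _ \<open>e > 0\<close>] Q[of w] w I(2) by blast
  qed
  ultimately show thesis by (rule that)
qed

locale two_sided_hypersurface = minimal_hypersurface L B X A f x0
  for L :: "(real^'m) set" and B and X :: "'b topology" and A :: "('b, real^'n) chart set" and f x0 +
  fixes \<nu> :: "'b \<Rightarrow> real^'m"
  assumes transversal: "\<And>p. p \<in> topspace X \<Longrightarrow>
      \<exists>U \<phi> (F :: real^'n \<Rightarrow> real^'m) y. local_param X L f U \<phi> F \<and> y \<in> U \<and> \<phi> y = p \<and>
       C_on 1 U (\<lambda>z. \<nu> (\<phi> z)) \<and> (\<forall>z\<in>U. \<nu> (\<phi> z) \<notin> range (frechet_derivative F (at z)))"
begin

text \<open>The point at height t over p, moved along the field \<nu>. By \<open>push_lift\<close>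
  the lift chosen by \<open>SOME\<close> is irrelevant, since a lattice translation commutes with
  adding a vector.\<close>

definition push :: "'b \<times> real \<Rightarrow> (real^'m) set" where
  "push z = torus_proj L ((SOME x. torus_proj L x = f (fst z)) + snd z *\<^sub>R \<nu> (fst z))"

lemma push_lift: "torus_proj L x = f p \<Longrightarrow> push (p, t) = torus_proj L (x + t *\<^sub>R \<nu> p)"
proof -
  assume x: "torus_proj L x = f p"
  then have "torus_proj L (SOME x. torus_proj L x = f p) = f p" by (rule someI[of "\<lambda>x. torus_proj L x = f p"])
  then have "(SOME x. torus_proj L x = f p) - x \<in> L" unfolding x[symmetric] torus_proj_eq .
  then show ?thesis unfolding push_def torus_proj_eq fst_conv snd_conv by simp
qed

lemma push_param: "local_param X L f U \<phi> F \<Longrightarrow> y \<in> U \<Longrightarrow> push (\<phi> y, t) = torus_proj L (F y + t *\<^sub>R \<nu> (\<phi> y))"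
  by (rule push_lift) (simp add: local_param_def)

lemma push_zero: "p \<in> topspace X \<Longrightarrow> push (p, 0) = f p"
proof -
  assume "p \<in> topspace X"
  then have "f p \<in> topspace (torus L)" using continuous_f by (auto simp: continuous_map_def)
  then obtain x where x: "torus_proj L x = f p" by (auto simp: topspace_torus)
  show ?thesis using push_lift[OF x, of 0] x by simp
qed

lemma push_topspace: "push z \<in> topspace (torus L)"
  by (simp add: push_def topspace_torus)

lemma transversal_param:
  assumes "p \<in> topspace X"
  obtains U \<phi> and F :: "real^'n \<Rightarrow> real^'m" and y where "local_param X L f U \<phi> F" "y \<in> U" "\<phi> y = p"
    "C_on 1 U (\<lambda>z. \<nu> (\<phi> z))" "\<forall>z\<in>U. \<nu> (\<phi> z) \<notin> range (frechet_derivative F (at z))"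
  using transversal[OF assms] by (elim exE conjE) (rule that)

lemma C_on_tube:
  fixes F :: "real^'n \<Rightarrow> real^'m"
  assumes lp: "local_param X L f U \<phi> F" and \<nu>: "C_on 1 U (\<lambda>z. \<nu> (\<phi> z))"
  shows "C_on 1 (U \<times> UNIV) (\<lambda>z :: (real^'n) \<times> real. F (fst z) + snd z *\<^sub>R \<nu> (\<phi> (fst z)))"
proof -
  have oU: "open U" and F: "C_on 1 U F" using lp by (auto simp: local_param_def smooth_on_def)
  have o: "open (U \<times> (UNIV :: real set))" by (simp add: oU open_Times)
  have fst: "C_on 1 (U \<times> (UNIV :: real set)) fst" by (rule C_on_bounded_linear[OF bounded_linear_fst])
  have snd: "C_on 1 (U \<times> (UNIV :: real set)) snd" by (rule C_on_bounded_linear[OF bounded_linear_snd])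
  have "C_on 1 (U \<times> (UNIV :: real set)) (\<lambda>z. F (fst z))" by (rule C_on_compose[OF o oU fst F]) auto
  moreover have "C_on 1 (U \<times> (UNIV :: real set)) (\<lambda>z. \<nu> (\<phi> (fst z)))"
    by (rule C_on_compose[OF o oU fst \<nu>]) auto
  ultimately show ?thesis by (intro C_on_add C_on_scaleR o snd)
qed

lemma continuous_push: "continuous_map (prod_topology X euclideanreal) (torus L) push"
  unfolding continuous_map_def
proof (intro conjI allI impI)
  fix W assume W: "openin (torus L) W"
  show "openin (prod_topology X euclideanreal) {z \<in> topspace (prod_topology X euclideanreal). push z \<in> W}"
  proof (subst openin_subopen, intro ballI)
    fix z assume z: "z \<in> {z \<in> topspace (prod_topology X euclideanreal). push z \<in> W}"
    obtain p t where pt: "z = (p, t)" by (rule prod.exhaust)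
    have p: "p \<in> topspace X" using z pt by simp
    obtain U \<phi> y and F :: "real^'n \<Rightarrow> real^'m" where lp: "local_param X L f U \<phi> F" and y: "y \<in> U" "\<phi> y = p"
      and \<nu>: "C_on 1 U (\<lambda>z. \<nu> (\<phi> z))"
      by (rule transversal_param[OF p]) (rule that)
    let ?G = "\<lambda>z :: (real^'n) \<times> real. F (fst z) + snd z *\<^sub>R \<nu> (\<phi> (fst z))"
    have oU: "open U" using lp by (simp add: local_param_def)
    have cG: "continuous_on (U \<times> UNIV) ?G" by (rule C_on_continuous[OF C_on_tube[OF lp \<nu>]])
    have "open (torus_proj L -` W)" using W by (simp add: openin_torus)
    then have o: "open ((U \<times> UNIV) \<inter> ?G -` (torus_proj L -` W))"
      by (intro continuous_open_preimage[OF cG]) (simp_all add: oU open_Times)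
    have "(y, t) \<in> (U \<times> UNIV) \<inter> ?G -` (torus_proj L -` W)"
      using z pt y push_param[OF lp y(1), of t] by simp
    then obtain V T where VT: "open V" "open T" "(y, t) \<in> V \<times> T" "V \<times> T \<subseteq> (U \<times> UNIV) \<inter> ?G -` (torus_proj L -` W)"
      by (rule open_prod_elim[OF o])
    have VU: "V \<subseteq> U" using VT(3,4) by auto
    have oV: "openin X (\<phi> ` V)" using lp VT(1) VU by (auto simp: local_param_def)
    show "\<exists>Q. openin (prod_topology X euclideanreal) Q \<and> z \<in> Q \<and>
        Q \<subseteq> {z \<in> topspace (prod_topology X euclideanreal). push z \<in> W}"
    proof (intro exI conjI)
      show "openin (prod_topology X euclideanreal) (\<phi> ` V \<times> T)"
        using oV VT(2) by (simp add: openin_prod_Times_iff)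
      show "z \<in> \<phi> ` V \<times> T" using VT(3) y(2) pt by auto
      show "\<phi> ` V \<times> T \<subseteq> {z \<in> topspace (prod_topology X euclideanreal). push z \<in> W}"
      proof clarify
        fix v s assume v: "v \<in> V" "s \<in> T"
        then have "torus_proj L (?G (v, s)) \<in> W" using VT(4) by blast
        then show "(\<phi> v, s) \<in> topspace (prod_topology X euclideanreal) \<and> push (\<phi> v, s) \<in> W"
          using push_param[OF lp, of v s] v VU openin_subset[OF oV] by auto
      qed
    qed
  qed
qed (simp add: push_topspace)

text \<open>Upstairs, the map (y, t) -> F y + t \<nu> has injective derivative at t = 0 exactly
  because \<nu> is transversal, so it is locally injective. Shrinking until its values lie in a ball
  on which the torus projection is injective keeps injectivity downstairs, and invariance of domain
  gives openness.\<close>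

lemma local_tube:
  assumes p: "p \<in> topspace X"
  obtains Q \<epsilon> where "openin X Q" "p \<in> Q" "\<epsilon> > 0" "inj_on push (Q \<times> {-\<epsilon><..<\<epsilon>})"
    "\<And>V T. openin X V \<Longrightarrow> V \<subseteq> Q \<Longrightarrow> open T \<Longrightarrow> T \<subseteq> {-\<epsilon><..<\<epsilon>} \<Longrightarrow> openin (torus L) (push ` (V \<times> T))"
proof -
  obtain U \<phi> y and F :: "real^'n \<Rightarrow> real^'m" where lp: "local_param X L f U \<phi> F" and y: "y \<in> U" "\<phi> y = p"
    and \<nu>: "C_on 1 U (\<lambda>z. \<nu> (\<phi> z))" "\<forall>z\<in>U. \<nu> (\<phi> z) \<notin> range (frechet_derivative F (at z))"
    by (rule transversal_param[OF p]) (rule that)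
  let ?G = "\<lambda>z :: (real^'n) \<times> real. F (fst z) + snd z *\<^sub>R \<nu> (\<phi> (fst z))"
  let ?D = "frechet_derivative F (at y)"
  have oU: "open U" using lp by (simp add: local_param_def)
  have o: "open (U \<times> (UNIV :: real set))" by (simp add: oU open_Times)
  have C1: "C_on 1 (U \<times> UNIV) ?G" by (rule C_on_tube[OF lp \<nu>(1)])
  have cG: "continuous_on (U \<times> UNIV) ?G" by (rule C_on_continuous[OF C1])
  have lin: "linear ?D" by (rule param_linear[OF lp y(1)])
  have injG: "inj (frechet_derivative ?G (at (y, 0)))"
  proof -
    have dF: "(F has_derivative ?D) (at (fst (y, 0::real)))"
      using local_param_differentiable[OF lp y(1)] by (simp add: frechet_derivative_works)
    have "(\<lambda>z. \<nu> (\<phi> z)) differentiable (at y)" using \<nu>(1) y(1) by simp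
    then have d\<nu>: "((\<lambda>z. \<nu> (\<phi> z)) has_derivative frechet_derivative (\<lambda>z. \<nu> (\<phi> z)) (at y)) (at (fst (y, 0::real)))"
      by (simp add: frechet_derivative_works)
    have fst: "(fst has_derivative fst) (at (y, 0::real))" and snd: "(snd has_derivative snd) (at (y, 0::real))"
      using bounded_linear_imp_has_derivative[OF bounded_linear_fst]
        bounded_linear_imp_has_derivative[OF bounded_linear_snd] by auto
    have 1: "((\<lambda>z. F (fst z)) has_derivative (\<lambda>w. ?D (fst w))) (at (y, 0::real))"
      by (rule has_derivative_compose[OF fst dF])
    have 2: "((\<lambda>z. \<nu> (\<phi> (fst z))) has_derivative
        (\<lambda>w. frechet_derivative (\<lambda>z. \<nu> (\<phi> z)) (at y) (fst w))) (at (y, 0::real))"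
      by (rule has_derivative_compose[OF fst d\<nu>])
    have D: "frechet_derivative ?G (at (y, 0)) = (\<lambda>w. ?D (fst w) + snd w *\<^sub>R \<nu> p)"
      using frechet_derivative_at[OF has_derivative_add[OF 1 has_derivative_scaleR[OF snd 2]]]
      by (simp add: y(2))
    show ?thesis
    proof (rule injI)
      fix v w assume "frechet_derivative ?G (at (y, 0)) v = frechet_derivative ?G (at (y, 0)) w"
      then have e: "?D (fst v - fst w) = (snd w - snd v) *\<^sub>R \<nu> p"
        by (simp add: D linear_diff[OF lin] algebra_simps)
      have s: "snd w = snd v"
      proof (rule ccontr)
        assume ne: "snd w \<noteq> snd v"
        have "?D ((fst v - fst w) /\<^sub>R (snd w - snd v)) = \<nu> p"
          using e ne by (simp add: linear_scale[OF lin])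
        then show False using \<nu>(2) y by (metis rangeI)
      qed
      then have "?D (fst v) = ?D (fst w)" using e by (simp add: linear_diff[OF lin])
      then have "fst v = fst w" using lp y(1) by (auto simp: local_param_def dest: injD)
      then show "v = w" using s by (simp add: prod_eq_iff)
    qed
  qed
  have y0: "(y, 0) \<in> U \<times> (UNIV :: real set)" using y(1) by simp
  obtain r where r: "r > 0" "ball (y, 0 :: real) r \<subseteq> U \<times> UNIV" "inj_on ?G (ball (y, 0) r)"
    by (rule C1_locally_injective[OF o y0 C1 injG]) (rule that)
  obtain \<delta> where \<delta>: "\<delta> > 0" "\<And>x. inj_on (torus_proj L) (ball x \<delta>)" using inj_on_ball by blast
  have "open (ball (y, 0) r \<inter> ?G -` ball (?G (y, 0)) \<delta>)"
    by (rule continuous_open_preimage[OF continuous_on_subset[OF cG r(2)]]) auto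
  moreover have "(y, 0) \<in> ball (y, 0) r \<inter> ?G -` ball (?G (y, 0)) \<delta>" using r(1) \<delta>(1) by simp
  ultimately obtain V0 T0 where VT: "open V0" "open T0" "(y, 0) \<in> V0 \<times> T0"
      "V0 \<times> T0 \<subseteq> ball (y, 0) r \<inter> ?G -` ball (?G (y, 0)) \<delta>"
    by (rule open_prod_elim)
  obtain \<epsilon> where "\<epsilon> > 0" "ball 0 \<epsilon> \<subseteq> T0" using openE[OF VT(2), of 0] VT(3) by blast
  then have \<epsilon>: "\<epsilon> > 0" "{-\<epsilon><..<\<epsilon>} \<subseteq> T0" by (auto simp: ball_eq_greaterThanLessThan)
  have box: "V0 \<times> {-\<epsilon><..<\<epsilon>} \<subseteq> ball (y, 0) r \<inter> ?G -` ball (?G (y, 0)) \<delta>" using VT(4) \<epsilon>(2) by blast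
  have VU: "V0 \<subseteq> U"
  proof
    fix v assume "v \<in> V0"
    then have "(v, 0) \<in> V0 \<times> T0" using VT(3) by blast
    then show "v \<in> U" using VT(4) r(2) by blast
  qed
  show thesis
  proof (rule that[of "\<phi> ` V0" \<epsilon>])
    show "openin X (\<phi> ` V0)" using lp VT(1) VU by (auto simp: local_param_def)
    show "p \<in> \<phi> ` V0" using VT(3) y(2) by auto
    show "\<epsilon> > 0" by (rule \<epsilon>(1))
    show "inj_on push (\<phi> ` V0 \<times> {-\<epsilon><..<\<epsilon>})"
    proof (rule inj_onI, clarify)
      fix v t w s assume v: "v \<in> V0" "t \<in> {-\<epsilon><..<\<epsilon>}" and w: "w \<in> V0" "s \<in> {-\<epsilon><..<\<epsilon>}"
        and e: "push (\<phi> v, t) = push (\<phi> w, s)"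
      have eqG: "torus_proj L (?G (v, t)) = torus_proj L (?G (w, s))"
        using e push_param[OF lp] v(1) w(1) VU by (auto simp: subset_iff)
      have "(v, t) \<in> V0 \<times> {-\<epsilon><..<\<epsilon>}" "(w, s) \<in> V0 \<times> {-\<epsilon><..<\<epsilon>}" using v w by auto
      then have vw: "(v, t) \<in> ball (y, 0) r" "(w, s) \<in> ball (y, 0) r"
        "?G (v, t) \<in> ball (?G (y, 0)) \<delta>" "?G (w, s) \<in> ball (?G (y, 0)) \<delta>"
        using box by blast+
      have "?G (v, t) = ?G (w, s)" by (rule inj_onD[OF \<delta>(2) eqG vw(3,4)])
      then have "(v, t) = (w, s)" by (rule inj_onD[OF r(3) _ vw(1,2)])
      then show "\<phi> v = \<phi> w \<and> t = s" by simp
    qed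
    fix V T assume V: "openin X V" "V \<subseteq> \<phi> ` V0" and T: "open T" "T \<subseteq> {-\<epsilon><..<\<epsilon>}"
    define V' where "V' = V0 \<inter> {v \<in> U. \<phi> v \<in> V}"
    have "openin (top_of_set U) {v \<in> topspace (top_of_set U). \<phi> v \<in> V}"
      by (rule openin_continuous_map_preimage[OF _ V(1)]) (use lp in \<open>simp add: local_param_def\<close>)
    then have "open {v \<in> U. \<phi> v \<in> V}" using oU by (simp add: openin_open_eq)
    then have oV': "open V'" unfolding V'_def by (rule open_Int[OF VT(1)])
    have V: "V = \<phi> ` V'" using V(2) VU by (auto simp: V'_def)
    have sub: "V' \<times> T \<subseteq> ball (y, 0) r" using box T(2) by (auto simp: V'_def)
    have "open (?G ` (V' \<times> T))"
    proof (rule invariance_of_domain_gen)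
      show "open (V' \<times> T)" using oV' T(1) by (rule open_Times)
      show "continuous_on (V' \<times> T) ?G" by (rule continuous_on_subset[OF cG]) (use sub r(2) in blast)
      show "inj_on ?G (V' \<times> T)" by (rule inj_on_subset[OF r(3) sub])
      show "DIM(real^'m) \<le> DIM((real^'n) \<times> real)" using card_m by simp
    qed
    moreover have "push ` (V \<times> T) = torus_proj L ` (?G ` (V' \<times> T))"
    proof -
      have "push (\<phi> v, t) = torus_proj L (?G (v, t))" if "v \<in> V'" for v t
        using push_param[OF lp, of v t] that VU by (auto simp: V'_def)
      then show ?thesis unfolding V by (force simp: image_iff)
    qed
    ultimately show "openin (torus L) (push ` (V \<times> T))" by (simp add: openin_proj_image)
  qed
qed

text \<open>Openness is local on \<open>X\<close>, so compactness of \<open>X\<close> gives its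
  width. Injectivity concerns pairs of points, so compactness of the product of \<open>X\<close>
  with itself is used; the two widths are combined by a minimum.\<close>

theorem tube:
  obtains \<epsilon> where "\<epsilon> > 0" "inj_on push (topspace X \<times> {-\<epsilon><..<\<epsilon>})"
    "\<And>V T. openin X V \<Longrightarrow> open T \<Longrightarrow> T \<subseteq> {-\<epsilon><..<\<epsilon>} \<Longrightarrow> openin (torus L) (push ` (V \<times> T))"
proof -
  obtain \<epsilon>1 where \<epsilon>1: "\<epsilon>1 > 0" "\<And>p. p \<in> topspace X \<Longrightarrow> \<exists>Q. openin X Q \<and> p \<in> Q \<and>
      (\<forall>V T. openin X V \<longrightarrow> V \<subseteq> Q \<longrightarrow> open T \<longrightarrow> T \<subseteq> {-\<epsilon>1<..<\<epsilon>1} \<longrightarrow> openin (torus L) (push ` (V \<times> T)))"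
  proof (rule compact_space_uniform[OF compact, where P = "\<lambda>\<epsilon> p. \<exists>Q. openin X Q \<and> p \<in> Q \<and>
      (\<forall>V T. openin X V \<longrightarrow> V \<subseteq> Q \<longrightarrow> open T \<longrightarrow> T \<subseteq> {-\<epsilon><..<\<epsilon>} \<longrightarrow> openin (torus L) (push ` (V \<times> T)))"])
    fix p assume p: "p \<in> topspace X"
    obtain Q \<epsilon> where Q: "openin X Q" "p \<in> Q" "\<epsilon> > 0"
      "\<And>V T. openin X V \<Longrightarrow> V \<subseteq> Q \<Longrightarrow> open T \<Longrightarrow> T \<subseteq> {-\<epsilon><..<\<epsilon>} \<Longrightarrow> openin (torus L) (push ` (V \<times> T))"
      by (rule local_tube[OF p]) (rule that)
    then show "\<exists>Q \<epsilon>. openin X Q \<and> p \<in> Q \<and> 0 < \<epsilon> \<and> (\<forall>z'\<in>Q. \<exists>Q. openin X Q \<and> z' \<in> Q \<and>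
       (\<forall>V T. openin X V \<longrightarrow> V \<subseteq> Q \<longrightarrow> open T \<longrightarrow> T \<subseteq> {-\<epsilon><..<\<epsilon>} \<longrightarrow> openin (torus L) (push ` (V \<times> T))))"
      by (intro exI[of _ Q] exI[of _ \<epsilon>]) auto
  next
    fix \<epsilon> \<epsilon>' :: real and p
    assume "\<exists>Q. openin X Q \<and> p \<in> Q \<and>
        (\<forall>V T. openin X V \<longrightarrow> V \<subseteq> Q \<longrightarrow> open T \<longrightarrow> T \<subseteq> {-\<epsilon><..<\<epsilon>} \<longrightarrow> openin (torus L) (push ` (V \<times> T)))"
      and "0 < \<epsilon>'" "\<epsilon>' \<le> \<epsilon>"
    moreover have "T \<subseteq> {-\<epsilon><..<\<epsilon>}" if "T \<subseteq> {-\<epsilon>'<..<\<epsilon>'}" for T using that \<open>\<epsilon>' \<le> \<epsilon>\<close> by fastforce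
    ultimately show "\<exists>Q. openin X Q \<and> p \<in> Q \<and>
        (\<forall>V T. openin X V \<longrightarrow> V \<subseteq> Q \<longrightarrow> open T \<longrightarrow> T \<subseteq> {-\<epsilon>'<..<\<epsilon>'} \<longrightarrow> openin (torus L) (push ` (V \<times> T)))"
      by metis
  qed (rule that)
  \<comment> \<open>A statement about pairs: near the diagonal it follows from the local tube, away
    from it from disjoint neighbourhoods of the images, which a short push cannot leave.\<close>
  define P where "P \<epsilon> z \<longleftrightarrow> (\<forall>t s. \<bar>t\<bar> < \<epsilon> \<longrightarrow> \<bar>s\<bar> < \<epsilon> \<longrightarrow>
      push (fst z, t) = push (snd z, s) \<longrightarrow> fst z = snd z \<and> t = s)" for \<epsilon> :: real and z
  have "compact_space (prod_topology X X)" using compact compact_space_prod_topology by blast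
  then obtain \<epsilon>2 where \<epsilon>2: "\<epsilon>2 > 0" "\<And>z. z \<in> topspace (prod_topology X X) \<Longrightarrow> P \<epsilon>2 z"
  proof (rule compact_space_uniform[where P = P])
    fix z assume z: "z \<in> topspace (prod_topology X X)"
    obtain p q where pq: "z = (p, q)" by (rule prod.exhaust)
    have p: "p \<in> topspace X" and q: "q \<in> topspace X" using z pq by auto
    show "\<exists>Q \<epsilon>. openin (prod_topology X X) Q \<and> z \<in> Q \<and> 0 < \<epsilon> \<and> (\<forall>z'\<in>Q. P \<epsilon> z')"
    proof (cases "p = q")
      case True
      obtain Q \<epsilon> where Q: "openin X Q" "p \<in> Q" "\<epsilon> > 0" "inj_on push (Q \<times> {-\<epsilon><..<\<epsilon>})"
        by (rule local_tube[OF p]) (rule that)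
      have "P \<epsilon> z" if z: "z \<in> Q \<times> Q" for z
        unfolding P_def
      proof (intro allI impI)
        fix t s assume ts: "\<bar>t\<bar> < \<epsilon>" "\<bar>s\<bar> < \<epsilon>" "push (fst z, t) = push (snd z, s)"
        have "(fst z, t) = (snd z, s)"
          by (rule inj_onD[OF Q(4) ts(3)]) (use z ts in \<open>auto simp: abs_less_iff\<close>)
        then show "fst z = snd z \<and> t = s" by simp
      qed
      moreover have "openin (prod_topology X X) (Q \<times> Q)" using Q(1) by (simp add: openin_prod_Times_iff)
      moreover have "z \<in> Q \<times> Q" using Q(2) True pq by simp
      ultimately show ?thesis using Q(3) by blast
    next
      case False
      then have "f p \<noteq> f q" using inj_f p q by (auto dest: inj_onD)
      moreover have "f p \<in> topspace (torus L)" "f q \<in> topspace (torus L)"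
        using continuous_f p q by (auto simp: continuous_map_def)
      ultimately obtain V W where VW: "openin (torus L) V" "openin (torus L) W" "f p \<in> V" "f q \<in> W" "disjnt V W"
        using Hausdorff_torus unfolding Hausdorff_space_def by blast
      have nbhd: "\<exists>Q \<epsilon>. openin X Q \<and> a \<in> Q \<and> \<epsilon> > 0 \<and> (\<forall>q\<in>Q. \<forall>t. \<bar>t\<bar> < \<epsilon> \<longrightarrow> push (q, t) \<in> G)"
        if a: "a \<in> topspace X" and G: "openin (torus L) G" "f a \<in> G" for a G
      proof -
        have o: "openin (prod_topology X euclideanreal) {z \<in> topspace (prod_topology X euclideanreal). push z \<in> G}"
          by (rule openin_continuous_map_preimage[OF continuous_push G(1)])
        have "(a, 0) \<in> {z \<in> topspace (prod_topology X euclideanreal). push z \<in> G}"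
          using a G(2) by (simp add: push_zero)
        from o[unfolded openin_prod_topology_alt, rule_format, OF this] obtain Q T where QT: "openin X Q" "openin euclideanreal T" "a \<in> Q" "0 \<in> T"
            "Q \<times> T \<subseteq> {z \<in> topspace (prod_topology X euclideanreal). push z \<in> G}"
          by (elim exE conjE)
        then obtain \<epsilon> where \<epsilon>: "\<epsilon> > 0" "ball 0 \<epsilon> \<subseteq> T" using openE[of T 0] by auto
        have "push (q, t) \<in> G" if "q \<in> Q" "\<bar>t\<bar> < \<epsilon>" for q t
        proof -
          have "t \<in> T" using \<epsilon>(2) that(2) by (auto simp: subset_iff dist_real_def)
          then show ?thesis using QT(5) that(1) by blast
        qed
        then show ?thesis using QT(1,3) \<epsilon>(1) by blast
      qed
      obtain Q1 e1 where Q1: "openin X Q1" "p \<in> Q1" "e1 > 0" "\<forall>q\<in>Q1. \<forall>t. \<bar>t\<bar> < e1 \<longrightarrow> push (q, t) \<in> V"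
        using nbhd[OF p VW(1,3)] by blast
      obtain Q2 e2 where Q2: "openin X Q2" "q \<in> Q2" "e2 > 0" "\<forall>q\<in>Q2. \<forall>t. \<bar>t\<bar> < e2 \<longrightarrow> push (q, t) \<in> W"
        using nbhd[OF q VW(2,4)] by blast
      have "P (min e1 e2) z" if z: "z \<in> Q1 \<times> Q2" for z
        unfolding P_def
      proof (intro allI impI)
        fix t s assume ts: "\<bar>t\<bar> < min e1 e2" "\<bar>s\<bar> < min e1 e2" "push (fst z, t) = push (snd z, s)"
        have "push (fst z, t) \<in> V" "push (snd z, s) \<in> W" using Q1(4) Q2(4) z ts(1,2) by auto
        then show "fst z = snd z \<and> t = s" using ts(3) VW(5) by (auto simp: disjnt_iff)
      qed
      moreover have "openin (prod_topology X X) (Q1 \<times> Q2)" using Q1(1) Q2(1) by (simp add: openin_prod_Times_iff)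
      moreover have "z \<in> Q1 \<times> Q2" using Q1(2) Q2(2) pq by simp
      moreover have "min e1 e2 > 0" using Q1(3) Q2(3) by simp
      ultimately show ?thesis by blast
    qed
  next
    fix \<epsilon> \<epsilon>' :: real and z assume "P \<epsilon> z" "0 < \<epsilon>'" "\<epsilon>' \<le> \<epsilon>"
    then show "P \<epsilon>' z" unfolding P_def by (meson order_less_le_trans)
  qed (rule that)
  show thesis
  proof (rule that[of "min \<epsilon>1 \<epsilon>2"])
    show "min \<epsilon>1 \<epsilon>2 > 0" using \<epsilon>1(1) \<epsilon>2(1) by simp
    show "inj_on push (topspace X \<times> {- min \<epsilon>1 \<epsilon>2<..<min \<epsilon>1 \<epsilon>2})"
    proof (rule inj_onI, clarify)
      fix p t q s assume pq: "p \<in> topspace X" "q \<in> topspace X" "push (p, t) = push (q, s)"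
        and ts: "t \<in> {- min \<epsilon>1 \<epsilon>2<..<min \<epsilon>1 \<epsilon>2}" "s \<in> {- min \<epsilon>1 \<epsilon>2<..<min \<epsilon>1 \<epsilon>2}"
      have "\<bar>t\<bar> < \<epsilon>2" "\<bar>s\<bar> < \<epsilon>2" using ts by (auto simp: abs_less_iff min_def split: if_splits)
      then show "p = q \<and> t = s" using \<epsilon>2(2)[of "(p, q)"] pq unfolding P_def by simp
    qed
    fix V and T :: "real set" assume V: "openin X V" and T: "open T" "T \<subseteq> {- min \<epsilon>1 \<epsilon>2<..<min \<epsilon>1 \<epsilon>2}"
    have T1: "T \<subseteq> {-\<epsilon>1<..<\<epsilon>1}" using T(2) by fastforce
    have "\<forall>p\<in>V. \<exists>Q. openin X Q \<and> p \<in> Q \<and> openin (torus L) (push ` ((V \<inter> Q) \<times> T))"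
    proof
      fix p assume "p \<in> V"
      then have "p \<in> topspace X" using openin_subset[OF V] by blast
      from \<epsilon>1(2)[OF this] obtain Q where Q: "openin X Q" "p \<in> Q" "\<forall>V T. openin X V \<longrightarrow> V \<subseteq> Q \<longrightarrow> open T \<longrightarrow>
          T \<subseteq> {-\<epsilon>1<..<\<epsilon>1} \<longrightarrow> openin (torus L) (push ` (V \<times> T))"
        by (elim exE conjE)
      have "openin (torus L) (push ` ((V \<inter> Q) \<times> T))"
        using Q(3) T(1) T1 openin_Int[OF V Q(1)] by blast
      then show "\<exists>Q. openin X Q \<and> p \<in> Q \<and> openin (torus L) (push ` ((V \<inter> Q) \<times> T))" using Q by blast
    qed
    then obtain Q where Q: "\<And>p. p \<in> V \<Longrightarrow> p \<in> Q p \<and> openin (torus L) (push ` ((V \<inter> Q p) \<times> T))"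
      by metis
    have "push ` (V \<times> T) = (\<Union>p\<in>V. push ` ((V \<inter> Q p) \<times> T))" using Q by blast
    moreover have "openin (torus L) (\<Union>p\<in>V. push ` ((V \<inter> Q p) \<times> T))" using Q by (intro openin_Union) auto
    ultimately show "openin (torus L) (push ` (V \<times> T))" by simp
  qed
qed

end

section \<open>The complement of a hypersurface with full periods\<close>

lemma cis_eq_cis_imp:
  assumes "cis a = cis b"
  shows "\<exists>n::int. a = b + 2 * pi * n"
proof -
  have "exp (\<i> * complex_of_real a) = exp (\<i> * complex_of_real b)" using assms by (simp add: cis_conv_exp)
  then obtain n :: int where "\<i> * complex_of_real a = \<i> * complex_of_real b + (of_int (2 * n) * pi) * \<i>"
    unfolding exp_eq by auto
  then have "\<i> * complex_of_real a = \<i> * complex_of_real (b + 2 * pi * n)" by (simp add: algebra_simps)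
  then have "a = b + 2 * pi * n" by (metis mult_cancel_left of_real_eq_iff complex_i_not_zero)
  then show ?thesis by blast
qed

lemma continuous_period_multiple_constant:
  fixes \<theta> :: "'z::topological_space \<Rightarrow> real"
  assumes "connected S" "continuous_on S \<theta>" and mult: "\<And>x. x \<in> S \<Longrightarrow> \<exists>n::int. \<theta> x = 2 * pi * n"
    and "s \<in> S" "t \<in> S"
  shows "\<theta> s = \<theta> t"
proof -
  have "\<theta> constant_on S"
  proof (rule continuous_discrete_range_constant[OF assms(1,2)])
    fix x assume x: "x \<in> S"
    show "\<exists>e>0. \<forall>y. y \<in> S \<and> \<theta> y \<noteq> \<theta> x \<longrightarrow> e \<le> norm (\<theta> y - \<theta> x)"
    proof (intro exI[of _ "2 * pi"] conjI allI impI)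
      fix y assume y: "y \<in> S \<and> \<theta> y \<noteq> \<theta> x"
      obtain m n :: int where mn: "\<theta> x = 2 * pi * m" "\<theta> y = 2 * pi * n" using mult x y by metis
      then have "n \<noteq> m" using y by auto
      then have "\<bar>real_of_int n - real_of_int m\<bar> \<ge> 1" by linarith
      then have "2 * pi * 1 \<le> 2 * pi * \<bar>real_of_int n - real_of_int m\<bar>" by (intro mult_left_mono) auto
      also have "\<dots> = norm (\<theta> y - \<theta> x)" by (simp add: mn abs_mult flip: right_diff_distrib)
      finally show "2 * pi \<le> norm (\<theta> y - \<theta> x)" by simp
    qed simp
  qed
  then show ?thesis using assms(4,5) by (auto simp: constant_on_def)
qed

context two_sided_hypersurface
begin

lemma continuous_\<nu>: "continuous_map X euclidean \<nu>"
  unfolding continuous_map_def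
proof (intro conjI allI impI)
  fix W :: "(real^'m) set" assume W: "openin euclidean W"
  show "openin X {p \<in> topspace X. \<nu> p \<in> W}"
  proof (subst openin_subopen, intro ballI)
    fix p assume p: "p \<in> {p \<in> topspace X. \<nu> p \<in> W}"
    then have pX: "p \<in> topspace X" by simp
    obtain U \<phi> y and F :: "real^'n \<Rightarrow> real^'m" where lp: "local_param X L f U \<phi> F" and y: "y \<in> U" "\<phi> y = p"
      and \<nu>: "C_on 1 U (\<lambda>z. \<nu> (\<phi> z))"
      by (rule transversal_param[OF pX]) (rule that)
    have oU: "open U" using lp by (simp add: local_param_def)
    have o: "open (U \<inter> (\<lambda>z. \<nu> (\<phi> z)) -` W)"
      using W by (intro continuous_open_preimage[OF C_on_continuous[OF \<nu>] oU]) simp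
    then have oV: "openin X (\<phi> ` (U \<inter> (\<lambda>z. \<nu> (\<phi> z)) -` W))" using lp by (auto simp: local_param_def)
    moreover have "p \<in> \<phi> ` (U \<inter> (\<lambda>z. \<nu> (\<phi> z)) -` W)" using p y by auto
    moreover have "\<phi> ` (U \<inter> (\<lambda>z. \<nu> (\<phi> z)) -` W) \<subseteq> {p \<in> topspace X. \<nu> p \<in> W}"
      using openin_subset[OF oV] by auto
    ultimately show "\<exists>T. openin X T \<and> p \<in> T \<and> T \<subseteq> {p \<in> topspace X. \<nu> p \<in> W}" by blast
  qed
qed auto

text \<open>The additive map agrees on the lattice with the linear map \<psi> having the same values
  on the basis. That linear map vanishes on a spanning set, hence everywhere, even though
  \<open>P\<close> need not generate the lattice as a group.\<close>

lemma additive_zero_if_zero_on_spanning: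
  fixes \<xi> :: "real^'m \<Rightarrow> real"
  assumes add: "\<And>l m. l \<in> L \<Longrightarrow> m \<in> L \<Longrightarrow> \<xi> (l + m) = \<xi> l + \<xi> m"
    and P: "P \<subseteq> L" "span P = UNIV" "\<And>v. v \<in> P \<Longrightarrow> \<xi> v = 0" and l: "l \<in> L"
  shows "\<xi> l = 0"
proof -
  define \<psi> where "\<psi> x = (\<Sum>b\<in>B. coord b x * \<xi> b)" for x
  have lin: "linear \<psi>"
    unfolding \<psi>_def
    by (intro linearI) (simp_all add: sum.distrib sum_distrib_left algebra_simps linear_scale[OF linear_coord])
  have \<xi>0: "\<xi> 0 = 0" using add[OF zero_L zero_L] by simp
  have \<xi>diff: "\<xi> (l - m) = \<xi> l - \<xi> m" if "l \<in> L" "m \<in> L" for l m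
    using add[OF diff_L[OF that] that(2)] by simp
  define Q where "Q = {l \<in> L. \<xi> l = \<psi> l}"
  have Q0: "0 \<in> Q" using zero_L \<xi>0 linear_0[OF lin] by (simp add: Q_def)
  have Qdiff: "l - m \<in> Q" if "l \<in> Q" "m \<in> Q" for l m
    using that \<xi>diff diff_L linear_diff[OF lin] by (simp add: Q_def)
  have Qadd: "l + m \<in> Q" if lm: "l \<in> Q" "m \<in> Q" for l m
    using Qdiff[OF lm(1) Qdiff[OF Q0 lm(2)]] by simp
  have BQ: "b \<in> Q" if b: "b \<in> B" for b
  proof -
    have "\<psi> b = (\<Sum>c\<in>B. if c = b then \<xi> b else 0)"
      unfolding \<psi>_def by (rule sum.cong) (use b in \<open>auto simp: coord_basis\<close>)
    then have "\<psi> b = \<xi> b" using finite_B b by simp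
    then show ?thesis using B_subset_L b by (auto simp: Q_def)
  qed
  have "(\<Sum>b\<in>C. of_int (m b) *\<^sub>R b) \<in> Q" if "C \<subseteq> B" for C and m :: "real^'m \<Rightarrow> int"
    using finite_subset[OF that finite_B] that
  proof (induction C rule: finite_induct)
    case (insert b C)
    have "b \<in> Q" using insert.prems BQ by blast
    have "of_int (m b) *\<^sub>R b \<in> Q" by (rule int_multiple_mem[OF Q0 Qdiff \<open>b \<in> Q\<close>])
    then show ?case using insert Qadd by simp
  qed (simp add: Q0)
  then have LQ: "L \<subseteq> Q" using L_eq by auto
  have sub: "subspace {x. \<psi> x = 0}"
    using lin by (auto simp: subspace_def linear_0 linear_add linear_scale)
  have "P \<subseteq> {x. \<psi> x = 0}" using P(1,3) LQ by (auto simp: Q_def)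
  then have "span P \<subseteq> {x. \<psi> x = 0}" by (rule span_minimal[OF _ sub])
  then have "\<psi> l = 0" using P(2) by auto
  then show ?thesis using LQ l by (auto simp: Q_def)
qed

lemma periods_subset_L: "periods L X f x0 \<subseteq> L"
proof
  fix v assume "v \<in> periods L X f x0"
  then obtain p g where "p \<in> loops X x0" "\<forall>t\<in>{0..1}. torus_proj L (g t) = f (p t)" "v = g 1 - g 0"
    unfolding periods_def by blast
  then have "torus_proj L (g 1) = torus_proj L (g 0)" by (simp add: loops_def)
  then show "v \<in> L" using \<open>v = g 1 - g 0\<close> by (simp add: torus_proj_eq)
qed

text \<open>The map \<open>E\<close> to the circle winds once when crossing the tube and is constant outside. It is
  constant on the hypersurface, so the homomorphism it induces on the lattice kills the periods; if
  these span, \<open>E\<close> has a real logarithm on the torus.\<close>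

lemma crossing_function:
  assumes span: "period_span = UNIV"
    and \<epsilon>: "\<epsilon> > 0" and inj: "inj_on push (topspace X \<times> {-\<epsilon><..<\<epsilon>})"
    and op: "\<And>V T. openin X V \<Longrightarrow> open T \<Longrightarrow> T \<subseteq> {-\<epsilon><..<\<epsilon>} \<Longrightarrow> openin (torus L) (push ` (V \<times> T))"
  obtains \<Theta> where "continuous_map (torus L) euclideanreal \<Theta>"
    "\<And>p t. p \<in> topspace X \<Longrightarrow> \<bar>t\<bar> < \<epsilon> / 2 \<Longrightarrow> cis (\<Theta> (push (p, t))) = cis (2 * pi * t / \<epsilon>)"
    "\<And>s. s \<in> topspace (torus L) - f ` topspace X \<Longrightarrow> cis (\<Theta> s) \<noteq> 1"
proof -
  define V where "V = push ` (topspace X \<times> {-\<epsilon><..<\<epsilon>})"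
  \<comment> \<open>The height is clamped to half the tube width. As t crosses that range e runs
    once round the circle, from -1 through 1 at t = 0 back to -1; since it stays at -1 near the
    boundary of the tube, the extension by -1 is continuous.\<close>
  define e where "e t = cis (2 * pi * max (- \<epsilon> / 2) (min (\<epsilon> / 2) t) / \<epsilon>)" for t
  have ce: "continuous_on A e" for A
    unfolding e_def[abs_def] by (intro continuous_intros) (use \<epsilon> in auto)
  have e_small: "e t = cis (2 * pi * t / \<epsilon>)" if "\<bar>t\<bar> < \<epsilon> / 2" for t
  proof -
    have "max (- \<epsilon> / 2) (min (\<epsilon> / 2) t) = t" using that by linarith
    then show ?thesis by (simp add: e_def)
  qed
  have e_big: "e t = -1" if "\<bar>t\<bar> \<ge> \<epsilon> / 2" for t
  proof (cases "t \<ge> 0")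
    case True
    then have "max (- \<epsilon> / 2) (min (\<epsilon> / 2) t) = \<epsilon> / 2" using that \<epsilon> by linarith
    then have "e t = cis (2 * pi * (\<epsilon> / 2) / \<epsilon>)" by (simp only: e_def)
    then show ?thesis using \<epsilon> by simp
  next
    case False
    then have "max (- \<epsilon> / 2) (min (\<epsilon> / 2) t) = - \<epsilon> / 2" using that \<epsilon> by linarith
    then have "e t = cis (2 * pi * (- \<epsilon> / 2) / \<epsilon>)" by (simp only: e_def)
    also have "2 * pi * (- \<epsilon> / 2) / \<epsilon> = - pi" using \<epsilon> by simp
    finally show ?thesis by (simp add: complex_eq_iff)
  qed
  define E where "E s = (if s \<in> V then e (snd (inv_into (topspace X \<times> {-\<epsilon><..<\<epsilon>}) push s)) else -1)" for s
  have E_push: "E (push (p, t)) = e t" if "p \<in> topspace X" "t \<in> {-\<epsilon><..<\<epsilon>}" for p t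
    using that inj by (auto simp: E_def V_def)
  have E_out: "E s = -1" if out: "s \<notin> push ` (topspace X \<times> {-\<epsilon>/2..\<epsilon>/2})" for s
  proof (cases "s \<in> V")
    case True
    then obtain p t where pt: "s = push (p, t)" "p \<in> topspace X" "t \<in> {-\<epsilon><..<\<epsilon>}" by (auto simp: V_def)
    have "t \<notin> {-\<epsilon>/2..\<epsilon>/2}" using out pt(1,2) by blast
    then have "\<not> \<bar>t\<bar> \<le> \<epsilon> / 2" by (auto simp: abs_le_iff)
    then show ?thesis using E_push[OF pt(2,3)] e_big[of t] pt(1) by simp
  qed (simp add: E_def)
  have "compactin (prod_topology X euclideanreal) (topspace X \<times> {-\<epsilon>/2..\<epsilon>/2})"
    using compact by (simp add: compactin_Times compact_space_def compactin_euclidean_iff)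
  then have "compactin (torus L) (push ` (topspace X \<times> {-\<epsilon>/2..\<epsilon>/2}))"
    by (rule image_compactin[OF _ continuous_push])
  then have closed: "closedin (torus L) (push ` (topspace X \<times> {-\<epsilon>/2..\<epsilon>/2}))"
    by (rule compactin_imp_closedin[OF Hausdorff_torus])
  have cE: "continuous_map (torus L) euclidean E"
    unfolding continuous_map_def
  proof (intro conjI allI impI)
    fix W :: "complex set" assume W: "openin euclidean W"
    let ?T = "{-\<epsilon><..<\<epsilon>} \<inter> e -` W" and ?K = "push ` (topspace X \<times> {-\<epsilon>/2..\<epsilon>/2})"
    have "open ?T" using W by (intro continuous_open_preimage[OF ce]) auto
    then have 1: "openin (torus L) (push ` (topspace X \<times> ?T))" by (intro op) auto
    \<comment> \<open>Outside the closed tube of half width \<open>E\<close> is -1, so this set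
      supplies the part of the preimage that the open tube misses.\<close>
    have 2: "openin (torus L) (if -1 \<in> W then topspace (torus L) - ?K else {})"
      using closed by auto
    have "{s \<in> topspace (torus L). E s \<in> W} = push ` (topspace X \<times> ?T) \<union> (if -1 \<in> W then topspace (torus L) - ?K else {})"
    proof (intro equalityI subsetI)
      fix s assume s: "s \<in> {s \<in> topspace (torus L). E s \<in> W}"
      show "s \<in> push ` (topspace X \<times> ?T) \<union> (if -1 \<in> W then topspace (torus L) - ?K else {})"
      proof (cases "s \<in> V")
        case True
        then obtain p t where pt: "s = push (p, t)" "p \<in> topspace X" "t \<in> {-\<epsilon><..<\<epsilon>}" by (auto simp: V_def)
        then have "t \<in> ?T" using s E_push by auto
        then show ?thesis using pt by blast
      next
        case False
        have "?K \<subseteq> V"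
        proof (unfold V_def, rule image_mono, rule Sigma_mono[OF order_refl])
          show "{-\<epsilon>/2..\<epsilon>/2} \<subseteq> {-\<epsilon><..<\<epsilon>}" using \<epsilon> by auto
        qed
        then have "s \<notin> ?K" using False by blast
        then show ?thesis using s E_out[of s] by auto
      qed
    next
      fix s assume s: "s \<in> push ` (topspace X \<times> ?T) \<union> (if -1 \<in> W then topspace (torus L) - ?K else {})"
      then show "s \<in> {s \<in> topspace (torus L). E s \<in> W}"
        using E_push E_out push_topspace by (auto split: if_splits)
    qed
    then show "openin (torus L) {s \<in> topspace (torus L). E s \<in> W}"
      using openin_Un[OF 1 2] by simp
  qed auto
  have norm_E: "norm (E s) = 1" for s by (simp add: E_def e_def)
  have "continuous_map euclidean euclidean (E \<circ> torus_proj L)"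
    by (rule continuous_map_compose[OF continuous_proj cE])
  then have cEp: "continuous_on UNIV (\<lambda>x. E (torus_proj L x))" by (simp add: o_def)
  have nz: "E (torus_proj L x) \<noteq> 0" for x using norm_E[of "torus_proj L x"] by auto
  obtain g where g: "continuous_on UNIV g" "\<And>x. x \<in> UNIV \<Longrightarrow> E (torus_proj L x) = exp (g x)"
    by (rule continuous_logarithm_on_contractible[OF cEp contractible_UNIV nz]) (rule that)
  define \<theta> where "\<theta> x = Im (g x)" for x
  have c\<theta>: "continuous_on A \<theta>" for A
    unfolding \<theta>_def using continuous_on_subset[OF g(1)] by (intro continuous_intros) auto
  have E\<theta>: "E (torus_proj L x) = cis (\<theta> x)" for x
  proof -
    have e: "E (torus_proj L x) = exp (g x)" using g(2) by simp
    then have "exp (Re (g x)) = 1" using norm_E[of "torus_proj L x"] by (simp add: norm_exp_eq_Re)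
    then show ?thesis unfolding e \<theta>_def by (simp add: exp_eq_polar)
  qed
  \<comment> \<open>The increment of the logarithm under a lattice translation is a multiple of 2
    pi, hence the same at every point by continuity. This independence is what makes the increment
    additive in the lattice vector.\<close>
  define \<xi> where "\<xi> l = \<theta> l - \<theta> 0" for l
  have \<xi>: "\<theta> (x + l) = \<theta> x + \<xi> l" if l: "l \<in> L" for x l
  proof -
    have "\<theta> (x + l) - \<theta> x = \<theta> (0 + l) - \<theta> 0"
    proof (rule continuous_period_multiple_constant[of UNIV "\<lambda>x. \<theta> (x + l) - \<theta> x"])
      show "continuous_on UNIV (\<lambda>x. \<theta> (x + l) - \<theta> x)"
        by (intro continuous_on_diff c\<theta> continuous_on_compose2[OF c\<theta>[of UNIV]] continuous_on_add
            continuous_on_id continuous_on_const) auto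
      show "\<exists>n::int. \<theta> (x + l) - \<theta> x = 2 * pi * n" for x
        using cis_eq_cis_imp[of "\<theta> (x + l)" "\<theta> x"] E\<theta>[of "x + l"] E\<theta>[of x] proj_shift[OF l, of x] by auto
    qed (auto simp: connected_UNIV)
    then show ?thesis by (simp add: \<xi>_def)
  qed
  have "\<xi> v = 0" if v: "v \<in> periods L X f x0" for v
  proof -
    obtain p u where pu: "p \<in> loops X x0" "continuous_on {0..1} u"
        "\<forall>t\<in>{0..1}. torus_proj L (u t) = f (p t)" "v = u 1 - u 0"
      using v unfolding periods_def by blast
    have "\<theta> (u 1) = \<theta> (u 0)"
    proof (rule continuous_period_multiple_constant[of "{0..1::real}" "\<lambda>t. \<theta> (u t)"])
      show "continuous_on {0..1} (\<lambda>t. \<theta> (u t))"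
        by (rule continuous_on_compose2[OF c\<theta>[of UNIV] pu(2)]) auto
      fix t :: real assume t: "t \<in> {0..1}"
      have pt: "p t \<in> topspace X" using pu(1) t by (auto simp: loops_def pathin_def continuous_map_def)
      have "cis (\<theta> (u t)) = E (push (p t, 0))" using E\<theta>[of "u t"] pu(3) t pt by (simp add: push_zero)
      also have "\<dots> = e 0" using E_push[OF pt, of 0] \<epsilon> by simp
      also have "\<dots> = cis 0" using e_small[of 0] \<epsilon> by simp
      finally show "\<exists>n::int. \<theta> (u t) = 2 * pi * n" using cis_eq_cis_imp by fastforce
    qed auto
    moreover have "v \<in> L" using v periods_subset_L by blast
    from \<xi>[OF this, of "u 0"] have "\<theta> (u 1) = \<theta> (u 0) + \<xi> v" by (simp add: pu(4))
    ultimately show ?thesis by simp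
  qed
  moreover have "\<xi> (l + m) = \<xi> l + \<xi> m" if "l \<in> L" "m \<in> L" for l m
    using \<xi>[OF that(2), of l] by (simp add: \<xi>_def)
  ultimately have \<xi>0: "\<xi> l = 0" if "l \<in> L" for l
    using additive_zero_if_zero_on_spanning[of \<xi> "periods L X f x0" l] periods_subset_L span that
    by (simp add: period_span_def)
  define \<Theta> where "\<Theta> s = \<theta> (SOME x. torus_proj L x = s)" for s
  have \<Theta>: "\<Theta> (torus_proj L x) = \<theta> x" for x
  proof -
    have "torus_proj L (SOME y. torus_proj L y = torus_proj L x) = torus_proj L x"
      by (rule someI[of "\<lambda>y. torus_proj L y = torus_proj L x"]) simp
    then have l: "(SOME y. torus_proj L y = torus_proj L x) - x \<in> L" by (simp only: torus_proj_eq)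
    show ?thesis using \<xi>[OF l, of x] \<xi>0[OF l] by (simp add: \<Theta>_def)
  qed
  have E\<Theta>: "E s = cis (\<Theta> s)" if "s \<in> topspace (torus L)" for s
    using that E\<theta> \<Theta> by (auto simp: topspace_torus)
  show thesis
  proof (rule that[of \<Theta>])
    show "continuous_map (torus L) euclideanreal \<Theta>"
      by (rule continuous_compose_quotient_map[OF quotient_proj]) (simp add: o_def \<Theta> c\<theta>)
    show "cis (\<Theta> (push (p, t))) = cis (2 * pi * t / \<epsilon>)" if "p \<in> topspace X" "\<bar>t\<bar> < \<epsilon> / 2" for p t
    proof -
      have "t \<in> {-\<epsilon><..<\<epsilon>}" using that(2) by (auto simp: abs_less_iff)
      then show ?thesis using E_push[OF that(1)] e_small[OF that(2)] E\<Theta>[OF push_topspace] by metis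
    qed
    show "cis (\<Theta> s) \<noteq> 1" if s: "s \<in> topspace (torus L) - f ` topspace X" for s
    proof
      assume "cis (\<Theta> s) = 1"
      then have E1: "E s = 1" using E\<Theta> s by simp
      \<comment> \<open>The value -1 excludes points outside the half-width tube, and inside it the
        winding function takes the value 1 only at height 0. So the value 1 detects the hypersurface
        exactly.\<close>
      then have "s \<in> push ` (topspace X \<times> {-\<epsilon>/2..\<epsilon>/2})" using E_out[of s] by fastforce
      then obtain p t where pt: "s = push (p, t)" "p \<in> topspace X" "t \<in> {-\<epsilon>/2..\<epsilon>/2}" by blast
      have tin: "t \<in> {-\<epsilon><..<\<epsilon>}" using pt(3) \<epsilon> by auto
      have et: "e t = 1" using E1 E_push[OF pt(2) tin] pt(1) by simp
      then have small: "\<bar>t\<bar> < \<epsilon> / 2" using e_big[of t] by fastforce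
      then have "cis (2 * pi * t / \<epsilon>) = cis 0" using et e_small by simp
      then obtain n :: int where n: "2 * pi * t / \<epsilon> = 0 + 2 * pi * n" using cis_eq_cis_imp by blast
      then have "t = \<epsilon> * n" using \<epsilon> by (simp add: field_simps)
      then have "\<bar>real_of_int n\<bar> < 1 / 2" using small \<epsilon> by (simp add: abs_mult)
      then have "n = 0" by linarith
      then have "t = 0" using \<open>t = \<epsilon> * n\<close> by simp
      then show False using pt s push_zero by auto
    qed
  qed
qed

end

text \<open>A loop at y is conjugated by a path from x to y; the contributions of that path cancel
  because displacements add in a commutative group.\<close>

lemma (in lattice_basis) periods_base_point:
  assumes F: "continuous_map Y (torus L) F" and Y: "path_connected_space Y"
    and x: "x \<in> topspace Y" and y: "y \<in> topspace Y"
  shows "periods L Y F y \<subseteq> periods L Y F x"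
proof -
  obtain c where c: "pathin Y c" "c 0 = x" "c 1 = y" using Y x y unfolding path_connected_space_def by blast
  have "period L F q \<in> periods L Y F x" if q: "q \<in> loops Y y" for q
  proof -
    have pq: "pathin Y q" "c 1 = q 0" "q 1 = y" using q c by (auto simp: loops_def)
    have "period L F (loop_join c q) - period L F c \<in> periods L Y F x"
      by (rule period_difference_in_periods[OF F pathin_join[OF c(1) pq(1,2)] _ c(1,2)])
        (use c pq in \<open>simp_all add: loop_join_def\<close>)
    then show ?thesis using period_join[OF F c(1) pq(1,2)] by simp
  qed
  then show ?thesis by (auto simp: periods_eq[OF F])
qed

lemma component_of_open_in_locally_path_connected:
  assumes lpc: "locally_path_connected_space M" and Q: "openin M Q"
    and D: "D \<in> connected_components_of (subtopology M Q)"
  shows "openin M D" and "path_connected_space (subtopology M D)"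
proof -
  have l: "locally_path_connected_space (subtopology M Q)"
    by (rule locally_path_connected_space_open_subset[OF lpc Q])
  have "openin (subtopology M Q) D"
    by (rule openin_connected_components_of_locally_connected_space
        [OF locally_path_connected_imp_locally_connected_space[OF l] D])
  then show o: "openin M D" using openin_trans_full Q by blast
  have "D \<in> path_components_of (subtopology M Q)"
    using D by (simp add: path_components_eq_connected_components_of[OF l])
  then have "path_connectedin M D"
    using path_connectedin_path_components_of by (fastforce simp: path_connectedin_subtopology)
  then show "path_connected_space (subtopology M D)" by (simp add: path_connectedin_def)
qed

section \<open>Components of the complement and the two sides of the tube\<close>

context two_sided_hypersurface
begin

abbreviation complement :: "(real^'m) set topology" where
  "complement \<equiv> subtopology (torus L) (topspace (torus L) - f ` topspace X)"

lemma openin_complement: "openin (torus L) (topspace (torus L) - f ` topspace X)"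
proof -
  have "compactin (torus L) (f ` topspace X)"
    by (rule image_compactin[OF _ continuous_f]) (use compact in \<open>simp add: compact_space_def\<close>)
  then show ?thesis using compactin_imp_closedin[OF Hausdorff_torus] by blast
qed

lemmas component_open = component_of_open_in_locally_path_connected(1)
    [OF locally_path_connected_torus[OF full] openin_complement]
  and component_path_connected = component_of_open_in_locally_path_connected(2)
    [OF locally_path_connected_torus[OF full] openin_complement]

context
  fixes \<epsilon> :: real
  assumes \<epsilon>: "\<epsilon> > 0" and inj: "inj_on push (topspace X \<times> {-\<epsilon><..<\<epsilon>})"
    and op: "\<And>V T. openin X V \<Longrightarrow> open T \<Longrightarrow> T \<subseteq> {-\<epsilon><..<\<epsilon>} \<Longrightarrow> openin (torus L) (push ` (V \<times> T))"
begin

lemma push_not_in_image: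
  assumes p: "p \<in> topspace X" and t: "t \<in> {-\<epsilon><..<\<epsilon>} - {0}"
  shows "push (p, t) \<notin> f ` topspace X"
proof
  assume "push (p, t) \<in> f ` topspace X"
  then obtain q where q: "q \<in> topspace X" "push (p, t) = push (q, 0)" using push_zero by auto
  then have "(p, t) = (q, 0)" using p t \<epsilon> by (intro inj_onD[OF inj q(2)]) auto
  then show False using t by simp
qed

lemma connectedin_side:
  assumes "connected T" "T \<subseteq> {-\<epsilon><..<\<epsilon>} - {0}"
  shows "connectedin complement (push ` (topspace X \<times> T))"
proof -
  have "connectedin (prod_topology X euclideanreal) (topspace X \<times> T)"
    using connected assms(1) by (simp add: connectedin_Times connectedin_topspace)
  then have "connectedin (torus L) (push ` (topspace X \<times> T))"
    by (rule connectedin_continuous_map_image[OF continuous_push])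
  moreover have "push ` (topspace X \<times> T) \<subseteq> topspace (torus L) - f ` topspace X"
  proof
    fix s assume "s \<in> push ` (topspace X \<times> T)"
    then obtain p t where "s = push (p, t)" "p \<in> topspace X" "t \<in> T" by blast
    then show "s \<in> topspace (torus L) - f ` topspace X"
      using push_not_in_image[of p t] assms(2) push_topspace by blast
  qed
  ultimately show ?thesis by (simp add: connectedin_subtopology)
qed

text \<open>If an open component missed the tube, its complement, being the tube together with the
  other components, would be open too, and the connected torus would be split. Once the component
  meets the tube it does so off height 0, and it absorbs the connected side through that
  point.\<close>

lemma component_contains_side:
  assumes D: "D \<in> connected_components_of complement"
  obtains T where "T = {0<..<\<epsilon>} \<or> T = {-\<epsilon><..<0}" "push ` (topspace X \<times> T) \<subseteq> D"
proof -
  let ?V = "push ` (topspace X \<times> {-\<epsilon><..<\<epsilon>})" and ?CC = "connected_components_of complement"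
  have DQ: "D \<subseteq> topspace (torus L) - f ` topspace X"
    using connected_components_of_subset[OF D] by simp
  have D0: "D \<noteq> {}" by (rule nonempty_connected_components_of[OF D])
  have fV: "f ` topspace X \<subseteq> ?V"
  proof
    fix s assume "s \<in> f ` topspace X"
    then obtain p where p: "p \<in> topspace X" "s = push (p, 0)" using push_zero by auto
    then show "s \<in> ?V" using \<epsilon> by auto
  qed
  have "D \<inter> ?V \<noteq> {}"
  proof
    assume dV: "D \<inter> ?V = {}"
    have "?V \<union> \<Union>(?CC - {D}) = topspace (torus L) - D"
    proof (intro equalityI subsetI)
      fix s assume s: "s \<in> ?V \<union> \<Union>(?CC - {D})"
      show "s \<in> topspace (torus L) - D"
      proof (cases "s \<in> ?V")
        case True
        then show ?thesis using dV push_topspace by auto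
      next
        case False
        then obtain C where C: "C \<in> ?CC" "C \<noteq> D" "s \<in> C" using s by blast
        have "disjnt C D" using pairwiseD[OF pairwise_disjoint_connected_components_of C(1) D C(2)] by simp
        then show ?thesis using C(3) connected_components_of_subset[OF C(1)] by (auto simp: disjnt_def)
      qed
    next
      fix s assume s: "s \<in> topspace (torus L) - D"
      show "s \<in> ?V \<union> \<Union>(?CC - {D})"
      proof (cases "s \<in> f ` topspace X")
        case False
        then have "s \<in> \<Union>?CC" using s by (simp add: Union_connected_components_of)
        then show ?thesis using s by blast
      qed (use fV in blast)
    qed
    moreover have "openin (torus L) (?V \<union> \<Union>(?CC - {D}))"
    proof (rule openin_Un[OF op openin_Union])
      show "openin X (topspace X)" "open {-\<epsilon><..<\<epsilon>}" "{-\<epsilon><..<\<epsilon>} \<subseteq> {-\<epsilon><..<\<epsilon>}" by auto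
      show "openin (torus L) C" if "C \<in> ?CC - {D}" for C using component_open that by blast
    qed
    ultimately have "closedin (torus L) D" using DQ by (auto simp: closedin_def)
    then have "D = {} \<or> D = topspace (torus L)"
      using connected_torus component_open[OF D] unfolding connected_space_clopen_in by blast
    moreover have "f x0 \<in> topspace (torus L)" "f x0 \<notin> D"
      using x0 DQ continuous_f by (auto simp: continuous_map_def)
    ultimately show False using D0 by blast
  qed
  then obtain p t where pt: "p \<in> topspace X" "t \<in> {-\<epsilon><..<\<epsilon>}" "push (p, t) \<in> D" by blast
  have "t \<noteq> 0" using pt DQ push_zero by auto
  define T where "T = (if t > 0 then {0<..<\<epsilon>} else {-\<epsilon><..<0})"
  have tT: "t \<in> T" using pt(2) \<open>t \<noteq> 0\<close> by (auto simp: T_def)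
  have "connectedin complement (push ` (topspace X \<times> T))"
    by (rule connectedin_side) (auto simp: T_def)
  moreover have "\<not> disjnt D (push ` (topspace X \<times> T))" using pt(1,3) tT by (auto simp: disjnt_def)
  ultimately have "push ` (topspace X \<times> T) \<subseteq> D" by (rule connected_components_of_maximal[OF D])
  moreover have "T = {0<..<\<epsilon>} \<or> T = {-\<epsilon><..<0}" by (simp add: T_def)
  ultimately show thesis using that by blast
qed

text \<open>Along the normal fibre at \<open>x0\<close> the real logarithm is 2 pi n + 2 pi t /
  \<epsilon>, so heights -\<epsilon>/4 and \<epsilon>/4 give values a quarter turn below and above 2
  pi n. On a connected set containing both points the value 2 pi n is attained, but it occurs only
  on the hypersurface.\<close>

lemma sides_in_different_components:
  assumes span: "period_span = UNIV" and D: "D \<in> connected_components_of complement"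
  shows "push (x0, \<epsilon> / 4) \<notin> D \<or> push (x0, - \<epsilon> / 4) \<notin> D"
proof (rule ccontr)
  assume "\<not> ?thesis"
  then have in_D: "push (x0, \<epsilon> / 4) \<in> D" "push (x0, - \<epsilon> / 4) \<in> D" by auto
  obtain \<Theta> where \<Theta>: "continuous_map (torus L) euclideanreal \<Theta>"
    "\<And>p t. p \<in> topspace X \<Longrightarrow> \<bar>t\<bar> < \<epsilon> / 2 \<Longrightarrow> cis (\<Theta> (push (p, t))) = cis (2 * pi * t / \<epsilon>)"
    "\<And>s. s \<in> topspace (torus L) - f ` topspace X \<Longrightarrow> cis (\<Theta> s) \<noteq> 1"
    by (rule crossing_function[OF span \<epsilon> inj op]) (assumption | rule that)+
  define h where "h t = \<Theta> (push (x0, t)) - 2 * pi * t / \<epsilon>" for t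
  have "continuous_map euclideanreal (prod_topology X euclideanreal) (\<lambda>t. (x0, t))"
    by (intro continuous_map_pairedI continuous_map_id[unfolded id_def]) (use x0 in auto)
  from continuous_map_compose[OF continuous_map_compose[OF this continuous_push] \<Theta>(1)]
  have "continuous_on UNIV (\<lambda>t. \<Theta> (push (x0, t)))" by (simp add: o_def)
  then have ch: "continuous_on {-\<epsilon>/2<..<\<epsilon>/2} h" unfolding h_def
    by (intro continuous_on_diff continuous_intros) (use \<epsilon> continuous_on_subset in auto)
  have hm: "\<exists>n::int. h t = 2 * pi * n" if t: "t \<in> {-\<epsilon>/2<..<\<epsilon>/2}" for t
  proof -
    have "\<bar>t\<bar> < \<epsilon> / 2" using t by (auto simp: abs_less_iff)
    from cis_eq_cis_imp[OF \<Theta>(2)[OF x0 this]] show ?thesis by (auto simp: h_def)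
  qed
  have h0: "h t = h 0" if "t \<in> {-\<epsilon>/2<..<\<epsilon>/2}" for t
    by (rule continuous_period_multiple_constant[OF _ ch hm that]) (use \<epsilon> in auto)
  have "\<epsilon> / 4 \<in> {-\<epsilon>/2<..<\<epsilon>/2}" "- \<epsilon> / 4 \<in> {-\<epsilon>/2<..<\<epsilon>/2}" "0 \<in> {-\<epsilon>/2<..<\<epsilon>/2}" using \<epsilon> by auto
  then obtain n :: int where n: "h 0 = 2 * pi * n" and "h (\<epsilon> / 4) = h 0" "h (- \<epsilon> / 4) = h 0"
    using h0 hm by metis
  then have "\<Theta> (push (x0, - \<epsilon> / 4)) = 2 * pi * n - pi / 2" "\<Theta> (push (x0, \<epsilon> / 4)) = 2 * pi * n + pi / 2"
    using \<epsilon> by (simp_all add: h_def)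
  then have le: "\<Theta> (push (x0, - \<epsilon> / 4)) \<le> 2 * pi * n" "2 * pi * n \<le> \<Theta> (push (x0, \<epsilon> / 4))"
    using pi_gt_zero by simp_all
  have "connectedin (torus L) D"
    using connectedin_connected_components_of[OF D] by (simp add: connectedin_subtopology)
  then have "connected (\<Theta> ` D)"
    using connectedin_continuous_map_image[OF \<Theta>(1)] by simp
  then have "2 * pi * n \<in> \<Theta> ` D"
    by (rule connectedD_interval[OF _ imageI[OF in_D(2)] imageI[OF in_D(1)] le])
  then obtain s where s: "s \<in> D" "\<Theta> s = 2 * pi * n" by auto
  have "s \<in> topspace (torus L) - f ` topspace X" using s(1) connected_components_of_subset[OF D] by auto
  from \<Theta>(3)[OF this] show False unfolding s(2) by (simp add: cis_multiple_2pi)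
qed

text \<open>Every component contains one of the two sides, so there are at most two; the sides lie
  in different components, so there are at least two.\<close>

lemma card_components:
  assumes span: "period_span = UNIV"
  shows "card (connected_components_of complement) = 2"
proof -
  let ?CC = "connected_components_of complement"
  have ex: "\<exists>D\<in>?CC. push ` (topspace X \<times> T) \<subseteq> D" if "connected T" "T \<subseteq> {-\<epsilon><..<\<epsilon>} - {0}" for T
  proof -
    have "complement \<noteq> trivial_topology"
    proof
      assume "complement = trivial_topology"
      moreover have "push (x0, \<epsilon> / 4) \<in> topspace complement"
        using push_not_in_image[OF x0, of "\<epsilon> / 4"] push_topspace \<epsilon> by auto
      ultimately show False by simp
    qed
    then show ?thesis
      using exists_connected_component_of_superset[OF connectedin_side[OF that]] by blast
  qed
  have T: "{0<..<\<epsilon>} \<subseteq> {-\<epsilon><..<\<epsilon>} - {0}" "{-\<epsilon><..<0} \<subseteq> {-\<epsilon><..<\<epsilon>} - {0}"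
    by (use \<epsilon> in \<open>auto simp: subset_iff\<close>)
  obtain P where P: "P \<in> ?CC" "push ` (topspace X \<times> {0<..<\<epsilon>}) \<subseteq> P"
    using ex[OF connected_Ioo T(1)] by blast
  obtain N where N: "N \<in> ?CC" "push ` (topspace X \<times> {-\<epsilon><..<0}) \<subseteq> N"
    using ex[OF connected_Ioo T(2)] by blast
  have eq: "C = D" if "C \<in> ?CC" "D \<in> ?CC" "s \<in> C" "s \<in> D" for C D s
    using pairwiseD[OF pairwise_disjoint_connected_components_of that(1,2)] that(3,4) by (auto simp: disjnt_def)
  have pos: "push (x0, \<epsilon> / 4) \<in> push ` (topspace X \<times> {0<..<\<epsilon>})"
    and neg: "push (x0, - \<epsilon> / 4) \<in> push ` (topspace X \<times> {-\<epsilon><..<0})"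
    by (rule imageI, use x0 \<epsilon> in simp)+
  have "P \<noteq> N" using sides_in_different_components[OF span P(1)] P(2) N(2) pos neg by blast
  moreover have "?CC = {P, N}"
  proof (intro equalityI subsetI)
    fix D assume D: "D \<in> ?CC"
    obtain T where T: "T = {0<..<\<epsilon>} \<or> T = {-\<epsilon><..<0}" "push ` (topspace X \<times> T) \<subseteq> D"
      by (rule component_contains_side[OF D])
    from T(1) show "D \<in> {P, N}"
    proof
      assume "T = {0<..<\<epsilon>}"
      then have "D = P" using T(2) P(2) pos by (intro eq[OF D P(1), of "push (x0, \<epsilon> / 4)"]) auto
      then show ?thesis by simp
    next
      assume "T = {-\<epsilon><..<0}"
      then have "D = N" using T(2) N(2) neg by (intro eq[OF D N(1), of "push (x0, - \<epsilon> / 4)"]) auto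
      then show ?thesis by simp
    qed
  qed (use P N in auto)
  ultimately show ?thesis by simp
qed

text \<open>A loop in the hypersurface, pushed into a side, keeps its period.\<close>

lemma periods_component:
  assumes D: "D \<in> connected_components_of complement" and x: "x \<in> D"
  shows "periods L X f x0 \<subseteq> periods L (subtopology (torus L) D) (\<lambda>s. s) x"
proof
  fix v assume "v \<in> periods L X f x0"
  then obtain p g where p: "p \<in> loops X x0" and g: "continuous_on {0..1} g"
      "\<forall>t\<in>{0..1}. torus_proj L (g t) = f (p t)" "v = g 1 - g 0"
    unfolding periods_def by blast
  obtain T where T: "T = {0<..<\<epsilon>} \<or> T = {-\<epsilon><..<0}" "push ` (topspace X \<times> T) \<subseteq> D"
    by (rule component_contains_side[OF D])
  obtain s where s: "s \<in> T" using T(1) \<epsilon> dense[of 0 \<epsilon>] dense[of "-\<epsilon>" 0] by fastforce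
  let ?Y = "subtopology (torus L) D"
  have DQ: "D \<subseteq> topspace (torus L)" using connected_components_of_subset[OF D] by auto
  have id: "continuous_map ?Y (torus L) (\<lambda>s. s)" by (rule continuous_map_from_subtopology) simp
  have pp: "continuous_map (top_of_set {0..1}) X p" using p by (simp add: loops_def pathin_def)
  have pX: "p t \<in> topspace X" if "t \<in> {0..1}" for t using pp that by (auto simp: continuous_map_def)
  have "continuous_map X (prod_topology X euclideanreal) (\<lambda>p. (p, s))"
    by (intro continuous_map_pairedI continuous_map_id[unfolded id_def]) auto
  from continuous_map_compose[OF continuous_map_compose[OF pp this] continuous_push]
  have "continuous_map (top_of_set {0..1}) (torus L) (\<lambda>t. push (p t, s))" by (simp add: o_def)
  then have "pathin ?Y (\<lambda>t. push (p t, s))"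
    using pX s T(2) by (auto simp: pathin_def continuous_map_in_subtopology)
  then have loop: "(\<lambda>t. push (p t, s)) \<in> loops ?Y (push (x0, s))" using p by (simp add: loops_def)
  have "continuous_map (top_of_set {0..1}) euclidean (\<nu> \<circ> p)"
    by (rule continuous_map_compose[OF pp continuous_\<nu>])
  then have cG: "continuous_on {0..1} (\<lambda>t. g t + s *\<^sub>R \<nu> (p t))"
    using g(1) by (intro continuous_intros) (simp_all add: o_def)
  \<comment> \<open>Adding the normal displacement to the lift \<open>g\<close> gives a lift of the
    pushed loop. The corrections at both ends agree because \<open>p\<close> is closed.\<close>
  have "period L (\<lambda>s. s) (\<lambda>t. push (p t, s)) = (g 1 + s *\<^sub>R \<nu> (p 1)) - (g 0 + s *\<^sub>R \<nu> (p 0))"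
    by (rule period_eq[OF cG], rule push_lift[symmetric]) (use g(2) in blast)
  then have "period L (\<lambda>s. s) (\<lambda>t. push (p t, s)) = v" using p g(3) by (simp add: loops_def)
  then have "v \<in> periods L ?Y (\<lambda>s. s) (push (x0, s))" using loop by (auto simp: periods_eq[OF id])
  moreover have "push (x0, s) \<in> topspace ?Y" "x \<in> topspace ?Y" using T(2) x0 s x DQ by auto
  ultimately show "v \<in> periods L ?Y (\<lambda>s. s) x"
    using periods_base_point[OF id component_path_connected[OF D]] by blast
qed

end

theorem separating_if_periods_span:
  assumes span: "period_span = UNIV"
  shows "separating (torus L) (f ` topspace X)"
proof -
  obtain \<epsilon> where "\<epsilon> > 0" "inj_on push (topspace X \<times> {-\<epsilon><..<\<epsilon>})"
    "\<And>V T. openin X V \<Longrightarrow> open T \<Longrightarrow> T \<subseteq> {-\<epsilon><..<\<epsilon>} \<Longrightarrow> openin (torus L) (push ` (V \<times> T))"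
    by (rule tube) (rule that)
  from card_components[OF this span] show ?thesis by (simp add: separating_def)
qed

text \<open>The periods of the component contain those of the hypersurface, which span
  \<open>CARD('n)\<close> + 1 dimensions, whereas at most \<open>CARD('n)\<close> generators would
  bound the dimension by \<open>CARD('n)\<close>.\<close>

theorem generators_of_component:
  assumes span: "period_span = UNIV"
    and D: "D \<in> connected_components_of complement" and x: "x \<in> D"
  shows "number_of_generators (fundamental_group (subtopology (torus L) D) x) > enat (CARD('n))"
proof (rule ccontr)
  let ?Y = "subtopology (torus L) D"
  assume "\<not> ?thesis"
  then have le: "number_of_generators (fundamental_group ?Y x) \<le> enat (CARD('n))" by simp
  have id: "continuous_map ?Y (torus L) (\<lambda>s. s)" by (rule continuous_map_from_subtopology) simp
  have xY: "x \<in> topspace ?Y" using x connected_components_of_subset[OF D] by auto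
  obtain \<epsilon> where "\<epsilon> > 0" "inj_on push (topspace X \<times> {-\<epsilon><..<\<epsilon>})"
    "\<And>V T. openin X V \<Longrightarrow> open T \<Longrightarrow> T \<subseteq> {-\<epsilon><..<\<epsilon>} \<Longrightarrow> openin (torus L) (push ` (V \<times> T))"
    by (rule tube) (rule that)
  from dim_subset[OF periods_component[OF this D x]]
  have "dim (periods L X f x0) \<le> dim (periods L ?Y (\<lambda>s. s) x)" .
  also have "\<dots> \<le> CARD('n)" by (rule dim_periods_le[OF id xY le])
  finally have "dim (periods L X f x0) \<le> CARD('n)" .
  moreover have "dim (periods L X f x0) = CARD('n) + 1"
    using span dim_span[of "periods L X f x0"] card_m by (simp add: period_span_def)
  ultimately show False by simp
qed

end

text \<open>The first two cases compare the upper bound \<open>dim_le\<close> with the dimension of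
  a tangent space. In the third, the number of generators excludes the flat case, and the
  transversal field from orientability turns spanning periods into two sides.\<close>

theorem theorem4p1:
  fixes X :: "'b topology"
    and A :: "('b, real^'n) chart set"
    and x0 :: 'b
    and k :: nat
    and L :: "(real^'m) set"
  assumes "smooth_manifold X A"
    and "compact_space X"
    and "connected_space X"
    and "orientable X A"
    and "x0 \<in> topspace X"
    and "number_of_generators (fundamental_group X x0) = enat k"
    and "CARD('m) = CARD('n) + 1"
    and "full_lattice L"
  shows "(k < CARD('n) \<longrightarrow> \<not> (\<exists>f. minimal_embedding X A L f)) \<and>
    (k = CARD('n) \<longrightarrow> (\<forall>f. minimal_embedding X A L f \<longrightarrow> induced_flat_torus X A L f)) \<and>
    (k > CARD('n) \<longrightarrow> (\<forall>f. minimal_embedding X A L f \<longrightarrow>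
       separating (torus L) (f ` topspace X) \<and>
       (\<forall>D \<in> connected_components_of
               (subtopology (torus L) (topspace (torus L) - f ` topspace X)).
          \<forall>x\<in>D. number_of_generators (fundamental_group (subtopology (torus L) D) x)
                  > enat (CARD('n)))))"
proof -
  obtain B where B: "lattice_basis L B" by (rule full_lattice_obtain[OF assms(8)])
  have hyp: "minimal_hypersurface L B X A f x0" if "minimal_embedding X A L f" for f
    using B assms(1,2,3,5,8) that by (intro minimal_hypersurface.intro minimal_hypersurface_axioms.intro)
  have dim_le: "dim (periods L X f x0) \<le> k" if "minimal_embedding X A L f" for f
    by (rule lattice_basis.dim_periods_le[OF B minimal_hypersurface.continuous_f[OF hyp[OF that]] assms(5)])
      (simp add: assms(6))
  have sides: "separating (torus L) (f ` topspace X) \<and>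
       (\<forall>D \<in> connected_components_of
               (subtopology (torus L) (topspace (torus L) - f ` topspace X)).
          \<forall>x\<in>D. number_of_generators (fundamental_group (subtopology (torus L) D) x)
                  > enat (CARD('n)))"
    if k: "k > CARD('n)" and f: "minimal_embedding X A L f" for f
  proof -
    interpret minimal_hypersurface L B X A f x0 by (rule hyp[OF f])
    have span: "period_span = UNIV" by (rule period_span_UNIV) (simp add: assms(6) k)
    obtain \<nu> :: "'b \<Rightarrow> real^'m" where \<nu>: "\<And>p. p \<in> topspace X \<Longrightarrow>
        \<exists>U \<phi> (F :: real^'n \<Rightarrow> real^'m) y. local_param X L f U \<phi> F \<and> y \<in> U \<and> \<phi> y = p \<and>
          C_on 1 U (\<lambda>z. \<nu> (\<phi> z)) \<and> (\<forall>z\<in>U. \<nu> (\<phi> z) \<notin> range (frechet_derivative F (at z)))"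
      by (rule transversal_field[OF assms(4)]) (rule that)
    interpret two_sided_hypersurface L B X A f x0 \<nu>
      by (intro two_sided_hypersurface.intro two_sided_hypersurface_axioms.intro hyp[OF f] \<nu>)
    show ?thesis using separating_if_periods_span[OF span] generators_of_component[OF span] by blast
  qed
  show ?thesis
  proof (intro conjI impI allI notI)
    assume k: "k < CARD('n)" and "\<exists>f. minimal_embedding X A L f"
    then obtain f where f: "minimal_embedding X A L f" by blast
    show False using minimal_hypersurface.dim_period_span[OF hyp[OF f]] dim_le[OF f] k by simp
  next
    fix f assume k: "k = CARD('n)" and f: "minimal_embedding X A L f"
    show "induced_flat_torus X A L f"
      by (rule minimal_hypersurface.flat_torus_if_few_periods[OF hyp[OF f]]) (use dim_le[OF f] k in simp)
  qed (use sides in blast)+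
qed

end
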